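(* Assume (H1) and (H2) of the context, let $\varsigma\in(0,1)$, and let $F:\mathcal P_1(\Gamma)\to PC^\varsigma(\Gamma)$, where each $F[\mathfrak m]$ also has prescribed values $F[\mathfrak m](v)$ at the vertices $v\in\mathcal V\setminus\partial\mathcal V$. Assume that one of the following holds, where $\mathfrak m_1,\mathfrak m_2$ range over the elements of $\mathcal P_1(\Gamma)$ of the form $\mathfrak m_i=m_i\mathscr L+\sum_{v\in\mathcal V\setminus\partial\mathcal V}\eta_vT_v[m_i]\,\delta_v$: (i) the map $p\mapsto H(x,p)$ is convex and $F$ is strictly monotone, in the sense that $$\int_\Gamma(F[\mathfrak m_1]-F[\mathfrak m_2])\,(\mathfrak m_1-\mathfrak m_2)(dx)>0\qquad\text{for all such }\mathfrak m_1\neq\mathfrak m_2;$$ (ii) the map $p\mapsto H(x,p)$ is strictly convex and $F$ is monotone, in the sense that $$\int_\Gamma(F[\mathfrak m_1]-F[\mathfrak m_2])\,(\mathfrak m_1-\mathfrak m_2)(dx)\ge0\qquad\text{for all such }\mathfrak m_1,\mathfrak m_2.$$ Then there exists at most one solution $(u,\rho,m)\in\mathscr C^{2,\varsigma}(\Gamma)\times\mathbb R\times V^{1,2}_{\boldsymbol\gamma}(\Gamma)$ to the MFG system, i.e. at most one triple such that, with $\mathfrak m=m\,\mathscr L+\sum_{v\in\mathcal V\setminus\partial\mathcal V}\eta_vT_v[m]\,\delta_v$, $$\begin{cases}-\mu_\alpha\partial^2u(x)+H(x,\partial u(x))+\rho=F[\mathfrak m](x)&\text{for all }x\in\Gamma_\alpha\setminus\mathcal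 V,\ \alpha\in\mathcal A,\\ u_{|\Gamma_\alpha}(v)=u_{|\Gamma_\beta}(v)&\text{for all }\alpha,\beta\in\mathcal A_v,\ v\in\mathcal V,\\ \sum_{\alpha\in\mathcal A_v}\mu_\alpha\gamma_{v,\alpha}\,\partial_\alpha u(v)=\eta_v\big(\theta_v+F[\mathfrak m](v)-\rho\big)&\text{for all }v\in\mathcal V\setminus\partial\mathcal V,\\ \partial_\alpha u(v)=0&\text{for all }v\in\partial\mathcal V,\ \alpha\in\mathcal A_v,\\ \int_\Gamma u\,dx=0,\end{cases}$$ and $m$ is a weak solution of the Fokker–Planck problem (FP) of the context with $b=\partial_pH(\cdot,\partial u(\cdot))$.
   Context: Network. $\mathcal V\subset\mathbb R^d$ is a finite set of vertices; $P\subset\mathcal V\times\mathcal V$ contains no pair $(v,v)$, and every vertex occurs in at least one pair of $P$. The edges are the segments joining the two points of a pair in $P$, indexed as $\Gamma_\alpha$, $\alpha\in\mathcal A$ ($\mathcal A$ finite); for $\alpha\ne\beta$, $\Gamma_\alpha\cap\Gamma_\beta=\{v\}$ if both edges contain the vertex $v$, and $\Gamma_\alpha\cap\Gamma_\beta=\varnothing$ otherwise. The network $\Gamma=\bigcup_{\alpha}\Gamma_\alpha$ is assumed connected and carries its geodesic distance. $\mathcal A_v=\{\alpha\in\mathcal A: v\in\Gamma_\alpha\}$; $\partial\mathcal V$ is the set of boundary vertices, i.e. those $v$ for which there is a unique $\bar v\in\mathcal V$ with $(v,\bar v)\in P$ or $(\bar v,v)\in P$. An edge $\Gamma_\alpha$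 with vertices $v_i,v_j$ and length $L_\alpha$ is parametrized by $\pi_\alpha(s)=v_i+s\,e_\alpha$, $e_\alpha=(v_j-v_i)/L_\alpha$, $s\in[0,L_\alpha]$. For $u:\Gamma\to\mathbb R$, $u_\alpha=u\circ\pi_\alpha$ on $(0,L_\alpha)$, and $u_{|\Gamma_\alpha}(v)$ is the limit of $u_\alpha$ at the endpoint corresponding to $v\in\Gamma_\alpha$. $\partial u$, $\partial^2u$ inside $\Gamma_\alpha$ are derivatives of $u_\alpha$ with respect to $s$; $\mathscr L$ is the length measure on $\Gamma$ and $\int_\Gamma f\,dx=\int_\Gamma f\,d\mathscr L=\sum_\alpha\int_0^{L_\alpha}f_\alpha\,ds$. At a vertex $v\in\Gamma_\alpha$, $\partial_\alpha u(v)$ is the outward derivative: $-u_\alpha'(0)$ if $v=\pi_\alpha(0)$, $u_\alpha'(L_\alpha)$ if $v=\pi_\alpha(L_\alpha)$. Spaces. $\mathscr C^k(\Gamma)$: continuous functions on $\Gamma$ with $u_\alpha\in C^k([0,L_\alpha])$ for all $\alpha$; $\mathscr C^{k,\varsigma}(\Gamma)$: those for which moreover each $\partial^ku_\alpha$ is $\varsigma$-Hölder on $[0,L_\alpha]$. $PC(\Gamma)$: functions with each $u_\alpha$ continuous on $(0,L_\alpha)$ with finite limits at the endpoints, identified if they agree on the interior of every edge; $PC^\varsigma(\Gamma)$: those $u\in PC(\Gamma)$ with each $u_\alpha$ (extended) $\varsigma$-Hölder on $[0,L_\alpha]$. $W^{1,2}(\Gamma)=\{u\in L^2(\Gamma):u_\alpha\in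 W^{1,2}(0,L_\alpha)\ \forall\alpha\}$. $V^{1,2}_{\boldsymbol\gamma}(\Gamma)$, $\boldsymbol\gamma=\{\gamma_{v,\alpha}\}$, is the subspace of $u\in W^{1,2}(\Gamma)$ with $u_{|\Gamma_\alpha}(v)/\gamma_{v,\alpha}=u_{|\Gamma_\beta}(v)/\gamma_{v,\beta}$ for all $v\in\mathcal V\setminus\partial\mathcal V$, $\alpha,\beta\in\mathcal A_v$. More generally, for $u\in PC(\Gamma)$ satisfying this compatibility condition, $T_v[u]$ denotes the common value; in the monotonicity conditions the densities $m_i$ are nonnegative elements of $PC(\Gamma)$ satisfying it. $V^{1,2}(\Gamma)$: elements of $W^{1,2}(\Gamma)$ continuous on $\Gamma$. $\mathcal P_1(\Gamma)$: Borel probability measures on $\Gamma$ (with the Kantorovich–Rubinstein metric). In $\int_\Gamma(F[\mathfrak m_1]-F[\mathfrak m_2])(\mathfrak m_1-\mathfrak m_2)(dx)$ the vertex values $F[\mathfrak m_i](v)$ are integrated against the Dirac masses. Problem (FP). A weak solution with coefficient $b\in PC(\Gamma)$ is $m\in V^{1,2}_{\boldsymbol\gamma}(\Gamma)$ with $\int_\Gamma(\mu\,\partial m\,\partial w+b\,m\,\partial w)\,dx=0$ for every $w\in V^{1,2}(\Gamma)$ ($\mu=\mu_\alpha$ on $\Gamma_\alpha$), $m\ge0$, and $1\ge\int_\Gamma m\,dx=1-\sum_{v\in\mathcal V\setminus\partial\mathcal V}\eta_vT_v[m]\ge0$. (It is the weak form of $-\mu_\alpha\partial^2m-\partial(bm)=0$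 in each edge, with the jump condition defining $T_v[m]$ and flux conservation at vertices.) (H1) For each $v\in\mathcal V\setminus\partial\mathcal V$ and $\alpha\in\mathcal A_v$: $\gamma_{v,\alpha}>0$, $\eta_v\ge0$, $\theta_v\in\mathbb R$; $\mu_\alpha>0$ for all $\alpha\in\mathcal A$; and $\sum_{\alpha\in\mathcal A_v}\mu_\alpha\gamma_{v,\alpha}=1$ for all $v\in\mathcal V\setminus\partial\mathcal V$. (H2) For each $\alpha\in\mathcal A$, the map $H_\alpha:\Gamma_\alpha\times\mathbb R\to\mathbb R$, $H_\alpha(x,p)=H(x,p)$ for $x\in\Gamma_\alpha\setminus\mathcal V$ and $H_\alpha(x,p)=\lim_{y\to x,\,y\in\Gamma_\alpha\setminus\mathcal V}H(y,p)$ for $x\in\mathcal V$, is well defined and continuous; for each $x\in\Gamma_\alpha\setminus\mathcal V$, $p\mapsto H_\alpha(x,p)$ is continuously differentiable and $\partial_pH_\alpha$ extends to a continuous map on $\Gamma_\alpha\times\mathbb R$. There exist $C_H>0$ and $q\in(1,2]$ such that for all $(x,p)\in\Gamma_\alpha\times\mathbb R$: $|H_\alpha(x,p)|\le C_H(1+|p|^q)$, $|\partial_pH_\alpha(x,p)|\le C_H(1+|p|^{q-1})$, $H_\alpha(x,p)\ge C_H^{-1}|p|^q-C_H$. *)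

theory Defs
  imports "HOL-Probability.Probability"
begin

section \<open>Networks\<close>

text \<open>
  The edge with index \<open>\<alpha>\<close> joins \<open>src \<alpha>\<close> to \<open>tgt \<alpha>\<close>; this fixes the orientation of its
  arc-length parametrization. It need not agree with the order in which the two vertices
  occur in \<open>pairs\<close>.
\<close>

record ('d::finite, 'e) network =
  verts :: "(real ^ 'd) set"
  pairs :: "((real ^ 'd) \<times> (real ^ 'd)) set"
  edges :: "'e set"
  src :: "'e \<Rightarrow> real ^ 'd"
  tgt :: "'e \<Rightarrow> real ^ 'd"

definition seg :: "('d::finite, 'e) network \<Rightarrow> 'e \<Rightarrow> (real ^ 'd) set" where
  "seg N \<alpha> = closed_segment (src N \<alpha>) (tgt N \<alpha>)"

definition len :: "('d::finite, 'e) network \<Rightarrow> 'e \<Rightarrow> real" where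
  "len N \<alpha> = dist (src N \<alpha>) (tgt N \<alpha>)"

definition param :: "('d::finite, 'e) network \<Rightarrow> 'e \<Rightarrow> real \<Rightarrow> real ^ 'd" where
  "param N \<alpha> s = src N \<alpha> + s *\<^sub>R ((1 / len N \<alpha>) *\<^sub>R (tgt N \<alpha> - src N \<alpha>))"

definition points :: "('d::finite, 'e) network \<Rightarrow> (real ^ 'd) set" where
  "points N = (\<Union>\<alpha>\<in>edges N. seg N \<alpha>)"

text \<open>
  The clause \<open>verts N \<inter> seg N \<alpha> = {src N \<alpha>, tgt N \<alpha>}\<close> makes explicit that the vertices contained
  in an edge are its endpoints, so that no vertex lies in the relative interior of an edge.
\<close>

definition is_network :: "('d::finite, 'e) network \<Rightarrow> bool" where
  "is_network N \<longleftrightarrow>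
     finite (verts N) \<and> finite (edges N) \<and>
     pairs N \<subseteq> verts N \<times> verts N \<and>
     (\<forall>v. (v, v) \<notin> pairs N) \<and>
     (\<forall>v\<in>verts N. \<exists>w. (v, w) \<in> pairs N \<or> (w, v) \<in> pairs N) \<and>
     (\<forall>\<alpha>\<in>edges N. (src N \<alpha>, tgt N \<alpha>) \<in> pairs N \<or> (tgt N \<alpha>, src N \<alpha>) \<in> pairs N) \<and>
     (\<forall>(v, w)\<in>pairs N. \<exists>\<alpha>\<in>edges N. {src N \<alpha>, tgt N \<alpha>} = {v, w}) \<and>
     (\<forall>\<alpha>\<in>edges N. verts N \<inter> seg N \<alpha> = {src N \<alpha>, tgt N \<alpha>}) \<and>
     (\<forall>\<alpha>\<in>edges N. \<forall>\<beta>\<in>edges N. \<alpha> \<noteq> \<beta> \<longrightarrow>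
        (\<forall>v\<in>verts N. v \<in> seg N \<alpha> \<and> v \<in> seg N \<beta> \<longrightarrow> seg N \<alpha> \<inter> seg N \<beta> = {v}) \<and>
        ((\<nexists>v. v \<in> verts N \<and> v \<in> seg N \<alpha> \<and> v \<in> seg N \<beta>) \<longrightarrow> seg N \<alpha> \<inter> seg N \<beta> = {})) \<and>
     connected (points N)"

definition incident :: "('d::finite, 'e) network \<Rightarrow> real ^ 'd \<Rightarrow> 'e set" where
  "incident N v = {\<alpha> \<in> edges N. v \<in> seg N \<alpha>}"

definition boundary_verts :: "('d::finite, 'e) network \<Rightarrow> (real ^ 'd) set" where
  "boundary_verts N = {v \<in> verts N. \<exists>!w. w \<in> verts N \<and> ((v, w) \<in> pairs N \<or> (w, v) \<in> pairs N)}"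

definition inner_verts :: "('d::finite, 'e) network \<Rightarrow> (real ^ 'd) set" where
  "inner_verts N = verts N - boundary_verts N"


section \<open>Functions on a network\<close>

definition on_edge :: "('d::finite, 'e) network \<Rightarrow> (real ^ 'd \<Rightarrow> real) \<Rightarrow> 'e \<Rightarrow> real \<Rightarrow> real" where
  "on_edge N u \<alpha> s = u (param N \<alpha> s)"

text \<open>The network integral of a function given by its family of restrictions to the edges.\<close>

definition net_integral :: "('d::finite, 'e) network \<Rightarrow> ('e \<Rightarrow> real \<Rightarrow> real) \<Rightarrow> real" where
  "net_integral N f = (\<Sum>\<alpha>\<in>edges N. LBINT s:{0<..<len N \<alpha>}. f \<alpha> s)"

definition trace :: "('d::finite, 'e) network \<Rightarrow> (real ^ 'd \<Rightarrow> real) \<Rightarrow> 'e \<Rightarrow> real ^ 'd \<Rightarrow> real" where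
  "trace N u \<alpha> v = (if v = src N \<alpha> then Lim (at_right 0) (on_edge N u \<alpha>)
                    else Lim (at_left (len N \<alpha>)) (on_edge N u \<alpha>))"

definition holder_on :: "real \<Rightarrow> real set \<Rightarrow> (real \<Rightarrow> real) \<Rightarrow> bool" where
  "holder_on \<sigma> I f \<longleftrightarrow> (\<exists>C. \<forall>s\<in>I. \<forall>t\<in>I. \<bar>f s - f t\<bar> \<le> C * \<bar>s - t\<bar> powr \<sigma>)"

text \<open>Derivatives relative to a closed interval are one-sided at its endpoints.\<close>

primrec iter_deriv :: "real set \<Rightarrow> nat \<Rightarrow> (real \<Rightarrow> real) \<Rightarrow> real \<Rightarrow> real" where
  "iter_deriv I 0 f = f"
| "iter_deriv I (Suc k) f = (\<lambda>s. vector_derivative (iter_deriv I k f) (at s within I))"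

definition Ck_on :: "nat \<Rightarrow> real set \<Rightarrow> (real \<Rightarrow> real) \<Rightarrow> bool" where
  "Ck_on k I f \<longleftrightarrow>
     (\<forall>i<k. \<forall>s\<in>I. iter_deriv I i f differentiable (at s within I)) \<and>
     continuous_on I (iter_deriv I k f)"

definition edge_deriv ::
  "('d::finite, 'e) network \<Rightarrow> nat \<Rightarrow> (real ^ 'd \<Rightarrow> real) \<Rightarrow> 'e \<Rightarrow> real \<Rightarrow> real" where
  "edge_deriv N k u \<alpha> = iter_deriv {0..len N \<alpha>} k (on_edge N u \<alpha>)"

definition outward_deriv ::
  "('d::finite, 'e) network \<Rightarrow> (real ^ 'd \<Rightarrow> real) \<Rightarrow> 'e \<Rightarrow> real ^ 'd \<Rightarrow> real" where
  "outward_deriv N u \<alpha> v =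
     (if v = src N \<alpha> then - edge_deriv N 1 u \<alpha> 0 else edge_deriv N 1 u \<alpha> (len N \<alpha>))"

text \<open>
  The geodesic distance of a finite network of segments induces the subspace topology of the
  surrounding Euclidean space, so continuity on the network is \<^const>\<open>continuous_on\<close>.
\<close>

definition net_Ck :: "('d::finite, 'e) network \<Rightarrow> nat \<Rightarrow> (real ^ 'd \<Rightarrow> real) set" where
  "net_Ck N k = {u. continuous_on (points N) u \<and>
                    (\<forall>\<alpha>\<in>edges N. Ck_on k {0..len N \<alpha>} (on_edge N u \<alpha>))}"

definition net_Ck_holder ::
  "('d::finite, 'e) network \<Rightarrow> nat \<Rightarrow> real \<Rightarrow> (real ^ 'd \<Rightarrow> real) set" where
  "net_Ck_holder N k \<sigma> =
     {u \<in> net_Ck N k. \<forall>\<alpha>\<in>edges N. holder_on \<sigma> {0..len N \<alpha>} (edge_deriv N k u \<alpha>)}"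

text \<open>
  Piecewise continuity involves the interiors of the edges only; values at vertices are
  unconstrained, and elements are identified if they agree off the vertices.
\<close>

definition PC_family :: "('d::finite, 'e) network \<Rightarrow> ('e \<Rightarrow> real \<Rightarrow> real) set" where
  "PC_family N = {f. \<forall>\<alpha>\<in>edges N. continuous_on {0<..<len N \<alpha>} (f \<alpha>) \<and>
                       (\<exists>l. (f \<alpha> \<longlongrightarrow> l) (at_right 0)) \<and>
                       (\<exists>l. (f \<alpha> \<longlongrightarrow> l) (at_left (len N \<alpha>)))}"

definition PC :: "('d::finite, 'e) network \<Rightarrow> (real ^ 'd \<Rightarrow> real) set" where
  "PC N = {u. on_edge N u \<in> PC_family N}"

definition edge_extension ::
  "('d::finite, 'e) network \<Rightarrow> (real ^ 'd \<Rightarrow> real) \<Rightarrow> 'e \<Rightarrow> real \<Rightarrow> real" where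
  "edge_extension N u \<alpha> s =
     (if s \<le> 0 then trace N u \<alpha> (src N \<alpha>)
      else if s \<ge> len N \<alpha> then trace N u \<alpha> (tgt N \<alpha>)
      else on_edge N u \<alpha> s)"

definition PC_holder :: "('d::finite, 'e) network \<Rightarrow> real \<Rightarrow> (real ^ 'd \<Rightarrow> real) set" where
  "PC_holder N \<sigma> = {u \<in> PC N. \<forall>\<alpha>\<in>edges N. holder_on \<sigma> {0..len N \<alpha>} (edge_extension N u \<alpha>)}"


section \<open>Sobolev spaces\<close>

definition L2_on :: "real set \<Rightarrow> (real \<Rightarrow> real) \<Rightarrow> bool" where
  "L2_on I f \<longleftrightarrow> set_borel_measurable lborel I f \<and> set_integrable lborel I (\<lambda>s. (f s)\<^sup>2)"

text \<open>The test functions are continuously differentiable with compact support in the open interval.\<close>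

definition test_functions :: "real set \<Rightarrow> (real \<Rightarrow> real) set" where
  "test_functions I = {\<phi>. (\<forall>s. \<phi> differentiable (at s)) \<and> continuous_on UNIV (deriv \<phi>) \<and>
                          compact (closure {s. \<phi> s \<noteq> 0}) \<and> closure {s. \<phi> s \<noteq> 0} \<subseteq> I}"

definition has_L2_weak_deriv :: "real set \<Rightarrow> (real \<Rightarrow> real) \<Rightarrow> (real \<Rightarrow> real) \<Rightarrow> bool" where
  "has_L2_weak_deriv I f g \<longleftrightarrow> L2_on I g \<and>
     (\<forall>\<phi>\<in>test_functions I. (LBINT s:I. f s * deriv \<phi> s) = - (LBINT s:I. g s * \<phi> s))"

definition W12_on :: "real set \<Rightarrow> (real \<Rightarrow> real) set" where
  "W12_on I = {f. L2_on I f \<and> (\<exists>g. has_L2_weak_deriv I f g)}"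

text \<open>Weak derivatives are unique up to null sets; one version is selected.\<close>

definition weak_deriv ::
  "('d::finite, 'e) network \<Rightarrow> (real ^ 'd \<Rightarrow> real) \<Rightarrow> 'e \<Rightarrow> real \<Rightarrow> real" where
  "weak_deriv N u \<alpha> = (SOME g. has_L2_weak_deriv {0<..<len N \<alpha>} (on_edge N u \<alpha>) g)"

definition W12 :: "('d::finite, 'e) network \<Rightarrow> (real ^ 'd \<Rightarrow> real) set" where
  "W12 N = {u. \<forall>\<alpha>\<in>edges N. on_edge N u \<alpha> \<in> W12_on {0<..<len N \<alpha>}}"

definition V12 :: "('d::finite, 'e) network \<Rightarrow> (real ^ 'd \<Rightarrow> real) set" where
  "V12 N = {u \<in> W12 N. continuous_on (points N) u}"

definition compatible ::
  "('d::finite, 'e) network \<Rightarrow> (real ^ 'd \<Rightarrow> 'e \<Rightarrow> real) \<Rightarrow> (real ^ 'd \<Rightarrow> real) \<Rightarrow> bool" where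
  "compatible N \<gamma> u \<longleftrightarrow>
     (\<forall>v\<in>inner_verts N. \<forall>\<alpha>\<in>incident N v. \<forall>\<beta>\<in>incident N v.
        trace N u \<alpha> v / \<gamma> v \<alpha> = trace N u \<beta> v / \<gamma> v \<beta>)"

text \<open>
  Traces refer to the representative that is continuous in the interior of each edge with limits
  at the endpoints. Every element of \<^const>\<open>W12\<close> has such a representative, unique off the vertices,
  and membership in \<^const>\<open>PC\<close> selects it.
\<close>

definition V12_gamma ::
  "('d::finite, 'e) network \<Rightarrow> (real ^ 'd \<Rightarrow> 'e \<Rightarrow> real) \<Rightarrow> (real ^ 'd \<Rightarrow> real) set" where
  "V12_gamma N \<gamma> = {u \<in> W12 N. u \<in> PC N \<and> compatible N \<gamma> u}"

definition common_value ::
  "('d::finite, 'e) network \<Rightarrow> (real ^ 'd \<Rightarrow> 'e \<Rightarrow> real) \<Rightarrow> real ^ 'd \<Rightarrow> (real ^ 'd \<Rightarrow> real) \<Rightarrow> real" where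
  "common_value N \<gamma> v u = (THE t. \<forall>\<alpha>\<in>incident N v. trace N u \<alpha> v / \<gamma> v \<alpha> = t)"


section \<open>Measures\<close>

definition length_measure :: "('d::finite, 'e) network \<Rightarrow> (real ^ 'd) measure" where
  "length_measure N =
     measure_of (points N) (sets (restrict_space borel (points N)))
       (\<lambda>S. \<Sum>\<alpha>\<in>edges N. emeasure lborel (param N \<alpha> -` S \<inter> {0..len N \<alpha>}))"

definition prob_measures :: "('d::finite, 'e) network \<Rightarrow> (real ^ 'd) measure set" where
  "prob_measures N = {M. prob_space M \<and> sets M = sets (restrict_space borel (points N))}"

text \<open>The measure with density \<open>m\<close> and the atoms \<open>\<eta> v * T\<^sub>v[m]\<close> at the inner vertices (for \<open>m \<ge> 0\<close>).\<close>

definition net_measure ::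
  "('d::finite, 'e) network \<Rightarrow> (real ^ 'd \<Rightarrow> 'e \<Rightarrow> real) \<Rightarrow> (real ^ 'd \<Rightarrow> real) \<Rightarrow>
   (real ^ 'd \<Rightarrow> real) \<Rightarrow> (real ^ 'd) measure" where
  "net_measure N \<gamma> \<eta> m =
     measure_of (points N) (sets (restrict_space borel (points N)))
       (\<lambda>S. emeasure (density (length_measure N) (\<lambda>x. ennreal (m x))) S +
            (\<Sum>v\<in>inner_verts N. ennreal (\<eta> v * common_value N \<gamma> v m) * indicator S v))"

definition admissible_densities ::
  "('d::finite, 'e) network \<Rightarrow> (real ^ 'd \<Rightarrow> 'e \<Rightarrow> real) \<Rightarrow> (real ^ 'd \<Rightarrow> real) \<Rightarrow>
   (real ^ 'd \<Rightarrow> real) set" where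
  "admissible_densities N \<gamma> \<eta> =
     {m \<in> PC N. (\<forall>x\<in>points N - verts N. 0 \<le> m x) \<and> compatible N \<gamma> m \<and>
                net_measure N \<gamma> \<eta> m \<in> prob_measures N}"

text \<open>
  A coupling sends a measure to a function whose values at the inner vertices are the prescribed
  ones; these are unrelated to its limits along the edges and are seen by the atoms.
\<close>

definition coupling_pairing ::
  "((real ^ 'd::finite) measure \<Rightarrow> real ^ 'd \<Rightarrow> real) \<Rightarrow> (real ^ 'd) measure \<Rightarrow> (real ^ 'd) measure \<Rightarrow> real"
  where
  "coupling_pairing F M1 M2 = (\<integral>x. (F M1 x - F M2 x) \<partial>M1) - (\<integral>x. (F M1 x - F M2 x) \<partial>M2)"

definition monotone_coupling ::
  "('d::finite, 'e) network \<Rightarrow> (real ^ 'd \<Rightarrow> 'e \<Rightarrow> real) \<Rightarrow> (real ^ 'd \<Rightarrow> real) \<Rightarrow>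
   ((real ^ 'd) measure \<Rightarrow> real ^ 'd \<Rightarrow> real) \<Rightarrow> bool" where
  "monotone_coupling N \<gamma> \<eta> F \<longleftrightarrow>
     (\<forall>m1\<in>admissible_densities N \<gamma> \<eta>. \<forall>m2\<in>admissible_densities N \<gamma> \<eta>.
        coupling_pairing F (net_measure N \<gamma> \<eta> m1) (net_measure N \<gamma> \<eta> m2) \<ge> 0)"

definition strictly_monotone_coupling ::
  "('d::finite, 'e) network \<Rightarrow> (real ^ 'd \<Rightarrow> 'e \<Rightarrow> real) \<Rightarrow> (real ^ 'd \<Rightarrow> real) \<Rightarrow>
   ((real ^ 'd) measure \<Rightarrow> real ^ 'd \<Rightarrow> real) \<Rightarrow> bool" where
  "strictly_monotone_coupling N \<gamma> \<eta> F \<longleftrightarrow>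
     (\<forall>m1\<in>admissible_densities N \<gamma> \<eta>. \<forall>m2\<in>admissible_densities N \<gamma> \<eta>.
        net_measure N \<gamma> \<eta> m1 \<noteq> net_measure N \<gamma> \<eta> m2 \<longrightarrow>
        coupling_pairing F (net_measure N \<gamma> \<eta> m1) (net_measure N \<gamma> \<eta> m2) > 0)"


section \<open>Standing hypotheses\<close>

definition H1 ::
  "('d::finite, 'e) network \<Rightarrow> ('e \<Rightarrow> real) \<Rightarrow> (real ^ 'd \<Rightarrow> 'e \<Rightarrow> real) \<Rightarrow> (real ^ 'd \<Rightarrow> real) \<Rightarrow> bool"
  where
  "H1 N \<mu> \<gamma> \<eta> \<longleftrightarrow>
     (\<forall>v\<in>inner_verts N. \<forall>\<alpha>\<in>incident N v. 0 < \<gamma> v \<alpha>) \<and>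
     (\<forall>v\<in>inner_verts N. 0 \<le> \<eta> v) \<and>
     (\<forall>\<alpha>\<in>edges N. 0 < \<mu> \<alpha>) \<and>
     (\<forall>v\<in>inner_verts N. (\<Sum>\<alpha>\<in>incident N v. \<mu> \<alpha> * \<gamma> v \<alpha>) = 1)"

definition edge_ham ::
  "('d::finite, 'e) network \<Rightarrow> (real ^ 'd \<Rightarrow> real \<Rightarrow> real) \<Rightarrow> 'e \<Rightarrow> real ^ 'd \<Rightarrow> real \<Rightarrow> real" where
  "edge_ham N H \<alpha> x p =
     (if x \<in> verts N then Lim (at x within seg N \<alpha> - verts N) (\<lambda>y. H y p) else H x p)"

text \<open>\<open>G \<alpha>\<close> is the (unique) continuous extension of the \<open>p\<close>-derivative of \<open>H\<close> to the whole edge \<open>\<alpha>\<close>.\<close>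

definition H2 :: "('d::finite, 'e) network \<Rightarrow> (real ^ 'd \<Rightarrow> real \<Rightarrow> real) \<Rightarrow> bool" where
  "H2 N H \<longleftrightarrow>
     (\<forall>\<alpha>\<in>edges N.
        (\<forall>x\<in>seg N \<alpha> \<inter> verts N. \<forall>p. \<exists>l. ((\<lambda>y. H y p) \<longlongrightarrow> l) (at x within seg N \<alpha> - verts N)) \<and>
        continuous_on (seg N \<alpha> \<times> UNIV) (\<lambda>(x, p). edge_ham N H \<alpha> x p) \<and>
        (\<forall>x\<in>seg N \<alpha> - verts N.
           (\<forall>p. edge_ham N H \<alpha> x differentiable (at p)) \<and>
           continuous_on UNIV (deriv (edge_ham N H \<alpha> x)))) \<and>
     (\<exists>G. (\<forall>\<alpha>\<in>edges N.
             continuous_on (seg N \<alpha> \<times> UNIV) (\<lambda>(x, p). G \<alpha> x p) \<and>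
             (\<forall>x\<in>seg N \<alpha> - verts N. \<forall>p. G \<alpha> x p = deriv (edge_ham N H \<alpha> x) p)) \<and>
          (\<exists>C q. 0 < C \<and> 1 < q \<and> q \<le> 2 \<and>
             (\<forall>\<alpha>\<in>edges N. \<forall>x\<in>seg N \<alpha>. \<forall>p.
                \<bar>edge_ham N H \<alpha> x p\<bar> \<le> C * (1 + \<bar>p\<bar> powr q) \<and>
                \<bar>G \<alpha> x p\<bar> \<le> C * (1 + \<bar>p\<bar> powr (q - 1)) \<and>
                edge_ham N H \<alpha> x p \<ge> inverse C * \<bar>p\<bar> powr q - C)))"

definition strictly_convex_on :: "real set \<Rightarrow> (real \<Rightarrow> real) \<Rightarrow> bool" where
  "strictly_convex_on S f \<longleftrightarrow> convex S \<and>
     (\<forall>t>0. t < 1 \<longrightarrow> (\<forall>x\<in>S. \<forall>y\<in>S. x \<noteq> y \<longrightarrow>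
        f ((1 - t) * x + t * y) < (1 - t) * f x + t * f y))"


section \<open>The mean field game system\<close>

definition FP_weak_solution ::
  "('d::finite, 'e) network \<Rightarrow> ('e \<Rightarrow> real) \<Rightarrow> (real ^ 'd \<Rightarrow> 'e \<Rightarrow> real) \<Rightarrow> (real ^ 'd \<Rightarrow> real) \<Rightarrow>
   ('e \<Rightarrow> real \<Rightarrow> real) \<Rightarrow> (real ^ 'd \<Rightarrow> real) \<Rightarrow> bool" where
  "FP_weak_solution N \<mu> \<gamma> \<eta> b m \<longleftrightarrow>
     b \<in> PC_family N \<and>
     m \<in> V12_gamma N \<gamma> \<and>
     (\<forall>w\<in>V12 N. net_integral N (\<lambda>\<alpha> s. \<mu> \<alpha> * weak_deriv N m \<alpha> s * weak_deriv N w \<alpha> s +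
                                     b \<alpha> s * on_edge N m \<alpha> s * weak_deriv N w \<alpha> s) = 0) \<and>
     (\<forall>x\<in>points N - verts N. 0 \<le> m x) \<and>
     1 \<ge> net_integral N (on_edge N m) \<and>
     net_integral N (on_edge N m) = 1 - (\<Sum>v\<in>inner_verts N. \<eta> v * common_value N \<gamma> v m) \<and>
     1 - (\<Sum>v\<in>inner_verts N. \<eta> v * common_value N \<gamma> v m) \<ge> 0"

definition MFG_solution ::
  "('d::finite, 'e) network \<Rightarrow> ('e \<Rightarrow> real) \<Rightarrow> (real ^ 'd \<Rightarrow> 'e \<Rightarrow> real) \<Rightarrow> (real ^ 'd \<Rightarrow> real) \<Rightarrow>
   (real ^ 'd \<Rightarrow> real) \<Rightarrow> (real ^ 'd \<Rightarrow> real \<Rightarrow> real) \<Rightarrow>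
   ((real ^ 'd) measure \<Rightarrow> real ^ 'd \<Rightarrow> real) \<Rightarrow> real \<Rightarrow>
   (real ^ 'd \<Rightarrow> real) \<Rightarrow> real \<Rightarrow> (real ^ 'd \<Rightarrow> real) \<Rightarrow> bool" where
  "MFG_solution N \<mu> \<gamma> \<eta> \<theta> H F \<sigma> u \<rho> m \<longleftrightarrow>
     (let M = net_measure N \<gamma> \<eta> m in
        u \<in> net_Ck_holder N 2 \<sigma> \<and>
        m \<in> V12_gamma N \<gamma> \<and>
        (\<forall>\<alpha>\<in>edges N. \<forall>s\<in>{0<..<len N \<alpha>}.
           - \<mu> \<alpha> * edge_deriv N 2 u \<alpha> s + H (param N \<alpha> s) (edge_deriv N 1 u \<alpha> s) + \<rho>
             = F M (param N \<alpha> s)) \<and>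
        (\<forall>v\<in>verts N. \<forall>\<alpha>\<in>incident N v. \<forall>\<beta>\<in>incident N v. trace N u \<alpha> v = trace N u \<beta> v) \<and>
        (\<forall>v\<in>inner_verts N.
           (\<Sum>\<alpha>\<in>incident N v. \<mu> \<alpha> * \<gamma> v \<alpha> * outward_deriv N u \<alpha> v) = \<eta> v * (\<theta> v + F M v - \<rho>)) \<and>
        (\<forall>v\<in>boundary_verts N. \<forall>\<alpha>\<in>incident N v. outward_deriv N u \<alpha> v = 0) \<and>
        net_integral N (on_edge N u) = 0 \<and>
        FP_weak_solution N \<mu> \<gamma> \<eta>
          (\<lambda>\<alpha> s. deriv (H (param N \<alpha> s)) (edge_deriv N 1 u \<alpha> s)) m)"

end

theory Submission
  imports Defs
begin

text \<open>
  The proof is the Lasry--Lions duality argument. Write \<open>w = u\<^sub>1 - u\<^sub>2\<close>, \<open>r = \<rho>\<^sub>1 - \<rho>\<^sub>2\<close>, and test the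
  difference of the two Hamilton--Jacobi equations with \<open>m\<^sub>1 - m\<^sub>2\<close> and the difference of the two
  Fokker--Planck equations with \<open>w\<close>. The second-order terms cancel. The vertex terms left by the
  integration by parts are, by the jump condition \<open>m = \<gamma> T\<close> and the weighted Kirchhoff condition
  for \<open>u\<close>, precisely the atoms of the two measures, the Neumann condition removing the boundary
  vertices; the terms with \<open>r\<close> cancel because both measures
  have total mass one. What remains (\<open>duality_identity\<close>) says that the pairing of
  \<open>F \<mm>\<^sub>1 - F \<mm>\<^sub>2\<close> with \<open>\<mm>\<^sub>1 - \<mm>\<^sub>2\<close> is the integral of
  \<open>m\<^sub>1 (H u\<^sub>1' - H u\<^sub>2' - (u\<^sub>1' - u\<^sub>2') \<partial>\<^sub>p H u\<^sub>1') + m\<^sub>2 (H u\<^sub>2' - H u\<^sub>1' - (u\<^sub>2' - u\<^sub>1') \<partial>\<^sub>p H u\<^sub>2')\<close>,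
  which is at most zero since \<open>H\<close> lies above its tangents and the densities are nonnegative.

  Under strict monotonicity this forces \<open>\<mm>\<^sub>1 = \<mm>\<^sub>2\<close> at once. Under strict convexity and monotonicity
  the integrand vanishes; the densities are positive (\<open>classical_FP_positive\<close>), so \<open>u\<^sub>1' = u\<^sub>2'\<close>, both
  densities solve the same linear Fokker--Planck problem, and that problem has one solution
  (\<open>classical_FP_unique\<close>). In both cases \<open>F \<mm>\<^sub>1 = F \<mm>\<^sub>2\<close>, and \<open>w\<close> solves
  \<open>\<mu> w'' = D + r\<close>, where \<open>D = H u\<^sub>1' - H u\<^sub>2'\<close> satisfies \<open>\<bar>D\<bar> \<le> K \<bar>w'\<bar>\<close>; a strong maximum principle on the network
  (\<open>strong_maximum_principle\<close>) gives \<open>r = 0\<close> and \<open>w\<close> constant, and the zero mean makes \<open>w = 0\<close>.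

  All of this is elementary calculus once weak solutions of the Fokker--Planck problem are known to
  be classical. On an edge, the du Bois-Reymond lemma turns the weak equation into
  \<open>\<mu> m' + b m = c\<close> with a constant flux \<open>c\<close>; testing with functions that are affine on the edges
  shows that the fluxes balance at every vertex (\<open>weak_FP_solution_is_classical\<close>). Positivity and
  the maximum principle then both follow one pattern: on an edge, a first-order
  differential inequality spreads a zero over the whole edge; at a vertex, the one-sided derivatives
  have a common sign and a vanishing weighted sum, so all of them vanish; connectedness does the rest
  (\<open>edge_propagation\<close>).
\<close>

section \<open>Weak derivatives and differential inequalities on an interval\<close>

text \<open>
  The square of the positive part is the simplest continuously differentiable function that vanishes on a
  half-line. It serves twice: to build test functions, and to localize a Gronwall argument to the
  set where a function is negative.
\<close>

lemma has_real_derivative_max_zero_squared: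
  "((\<lambda>x::real. (max 0 x)\<^sup>2) has_real_derivative 2 * max 0 x) (at x)"
proof -
  consider "x < 0" | "x = 0" | "x > 0" by linarith
  then show ?thesis
  proof cases
    case 1
    have "((\<lambda>x::real. 0) has_real_derivative 0) (at x)" by simp
    then show ?thesis
      by (rule has_field_derivative_transform_within_open[where S="{..<0}", THEN DERIV_cong]) (use 1 in auto)
  next
    case 3
    have "((\<lambda>x::real. x\<^sup>2) has_real_derivative 2 * x) (at x)"
      by (auto intro!: derivative_eq_intros)
    then show ?thesis
      by (rule has_field_derivative_transform_within_open[where S="{0<..}", THEN DERIV_cong]) (use 3 in auto)
  next
    case 2
    have "((\<lambda>h::real. max 0 h) \<longlongrightarrow> 0) (at 0)"
      by (intro tendsto_eq_intros) auto
    moreover have "(max 0 h)\<^sup>2 / h = max 0 h" if "h \<noteq> 0" for h :: real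
      using that by (auto simp: max_def power2_eq_square)
    ultimately have "((\<lambda>h::real. (max 0 h)\<^sup>2 / h) \<longlongrightarrow> 0) (at 0)"
      by (subst Lim_cong_within[where g="\<lambda>h. max 0 h"]) auto
    then show ?thesis using 2 by (simp add: DERIV_def)
  qed
qed

lemma test_functionsI:
  assumes "\<And>s. (\<phi> has_real_derivative \<phi>' s) (at s)" "continuous_on UNIV \<phi>'"
    and "{c..d} \<subseteq> I" "\<And>s. s \<notin> {c..d} \<Longrightarrow> \<phi> s = 0"
  shows "\<phi> \<in> test_functions I" "deriv \<phi> = \<phi>'"
proof -
  show *: "deriv \<phi> = \<phi>'" using assms(1) DERIV_imp_deriv by blast
  have sub: "closure {s. \<phi> s \<noteq> 0} \<subseteq> {c..d}" using assms(4) by (intro closure_minimal) (blast, simp)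
  have "compact (closure {s. \<phi> s \<noteq> 0})"
    using sub by (meson bounded_closed_interval bounded_subset closed_closure compact_eq_bounded_closed)
  then show "\<phi> \<in> test_functions I"
    unfolding test_functions_def using * assms sub real_differentiable_def by auto
qed

lemma test_function_support:
  assumes "\<phi> \<in> test_functions {a<..<b}" "a < b"
  obtains c d where "a < c" "c \<le> d" "d < b" "\<And>s. s \<notin> {c..d} \<Longrightarrow> \<phi> s = 0"
proof (cases "closure {s. \<phi> s \<noteq> 0} = {}")
  case True
  then show ?thesis by (intro that[of "(a+b)/2" "(a+b)/2"]) (use assms in auto)
next
  case False
  let ?K = "closure {s. \<phi> s \<noteq> 0}"
  have K: "compact ?K" "?K \<subseteq> {a<..<b}" using assms by (auto simp: test_functions_def)
  obtain c where c: "c \<in> ?K" "\<And>t. t \<in> ?K \<Longrightarrow> c \<le> t" using compact_attains_inf[OF K(1) False] by blast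
  obtain d where d: "d \<in> ?K" "\<And>t. t \<in> ?K \<Longrightarrow> t \<le> d" using compact_attains_sup[OF K(1) False] by blast
  show ?thesis
  proof (rule that[of c d])
    show "\<phi> s = 0" if "s \<notin> {c..d}" for s
      using that c d closure_subset[of "{s. \<phi> s \<noteq> 0}"] by auto
  qed (use K c d in auto)
qed

lemma test_function_derivative:
  assumes "\<phi> \<in> test_functions I"
  shows "(\<phi> has_real_derivative deriv \<phi> s) (at s)" "continuous_on S (deriv \<phi>)" "continuous_on S \<phi>"
proof -
  show 1: "(\<phi> has_real_derivative deriv \<phi> s) (at s)" for s
    using assms DERIV_deriv_iff_real_differentiable by (auto simp: test_functions_def)
  show "continuous_on S (deriv \<phi>)" using assms continuous_on_subset by (auto simp: test_functions_def)
  show "continuous_on S \<phi>" using 1 by (meson DERIV_isCont continuous_at_imp_continuous_on)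
qed

text \<open>
  With \<open>p\<close> the product of the squared positive parts of \<open>s - c\<close> and \<open>d - s\<close>, this is
  \<open>k p / (1 + k p)\<close>: a test function with values in \<open>[0, 1]\<close> and support \<open>[c, d]\<close>, which increases
  to the indicator of \<open>(c, d)\<close> as \<open>k\<close> grows.
\<close>

definition bump :: "real \<Rightarrow> real \<Rightarrow> real \<Rightarrow> real \<Rightarrow> real" where
  "bump k c d s = k * ((max 0 (s - c))\<^sup>2 * (max 0 (d - s))\<^sup>2) /
                  (1 + k * ((max 0 (s - c))\<^sup>2 * (max 0 (d - s))\<^sup>2))"

lemma bump_range: "0 \<le> k \<Longrightarrow> 0 \<le> bump k c d s" "0 \<le> k \<Longrightarrow> bump k c d s \<le> 1"
  by (auto simp: bump_def divide_simps add_pos_nonneg)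

lemma bump_outside: "s \<notin> {c..d} \<Longrightarrow> bump k c d s = 0"
  by (auto simp: bump_def)

lemma bump_test:
  assumes "0 \<le> k" "{c..d} \<subseteq> I"
  shows "bump k c d \<in> test_functions I"
proof -
  define p p' where "p s = (max 0 (s - c))\<^sup>2 * (max 0 (d - s))\<^sup>2"
    and "p' s = 2 * max 0 (s - c) * (max 0 (d - s))\<^sup>2 - (max 0 (s - c))\<^sup>2 * (2 * max 0 (d - s))" for s :: real
  have p0: "p s \<ge> 0" for s by (simp add: p_def)
  have p: "(p has_real_derivative p' s) (at s)" for s
    unfolding p_def p'_def
    by (rule derivative_eq_intros DERIV_chain2[OF has_real_derivative_max_zero_squared] refl | simp)+
  have pos: "1 + k * p s > 0" for s using p0 assms by (simp add: add_pos_nonneg)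
  have "(bump k c d has_real_derivative (k * p' s) / (1 + k * p s)\<^sup>2) (at s)" for s
  proof -
    have "((\<lambda>s. k * p s / (1 + k * p s)) has_real_derivative (k * p' s) / (1 + k * p s)\<^sup>2) (at s)"
      by (rule derivative_eq_intros p refl | use pos[of s] in \<open>simp add: field_simps power2_eq_square\<close>)+
    then show ?thesis by (simp add: bump_def[abs_def] p_def)
  qed
  moreover have "continuous_on UNIV (\<lambda>s. (k * p' s) / (1 + k * p s)\<^sup>2)"
    unfolding p_def p'_def
    by (intro continuous_intros ballI) (use pos in \<open>auto simp: p_def dest: less_imp_neq[symmetric]\<close>)
  ultimately show ?thesis
    by (rule test_functionsI(1)[OF _ _ assms(2) bump_outside])
qed

text \<open>
  The supports are shrunk by \<open>1 / (n + 1)\<close> so that they stay compact in \<open>(c, d)\<close>, even when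
  \<open>c\<close> or \<open>d\<close> is an endpoint of the interval in which the test functions live.
\<close>

lemma bump_tendsto_indicator:
  "(\<lambda>n. bump (real n) (c + 1 / real (Suc n)) (d - 1 / real (Suc n)) s) \<longlonglongrightarrow> indicator {c<..<d} s"
proof (cases "s \<in> {c<..<d}")
  case False
  have "(max 0 (s - (c + 1 / real (Suc n))))\<^sup>2 * (max 0 (d - 1 / real (Suc n) - s))\<^sup>2 = 0" for n
  proof -
    have "1 / real (Suc n) > 0" by simp
    then have "s - (c + 1 / real (Suc n)) \<le> 0 \<or> d - 1 / real (Suc n) - s \<le> 0"
      using False unfolding greaterThanLessThan_iff by linarith
    then show ?thesis by (auto simp: max_def)
  qed
  then have "bump (real n) (c + 1 / real (Suc n)) (d - 1 / real (Suc n)) s = 0" for n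
    by (simp only: bump_def mult_zero_right div_0)
  then show ?thesis using False by simp
next
  case True
  define q where "q n = (max 0 (s - (c + 1 / real (Suc n))))\<^sup>2 * (max 0 (d - 1 / real (Suc n) - s))\<^sup>2" for n
  have i: "(\<lambda>n. 1 / real (Suc n)) \<longlonglongrightarrow> 0"
    using LIMSEQ_inverse_real_of_nat by (simp add: inverse_eq_divide)
  have "q \<longlonglongrightarrow> (max 0 (s - (c + 0)))\<^sup>2 * (max 0 (d - 0 - s))\<^sup>2"
    unfolding q_def by (intro tendsto_intros i)
  then have "q \<longlonglongrightarrow> (s - c)\<^sup>2 * (d - s)\<^sup>2" using True by simp
  moreover have "(s - c)\<^sup>2 * (d - s)\<^sup>2 > 0" using True by simp
  moreover have "filterlim (\<lambda>n. real n) at_top sequentially"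
    by (rule filterlim_real_sequentially)
  ultimately have "filterlim (\<lambda>n. q n * real n) at_top sequentially"
    using filterlim_tendsto_pos_mult_at_top by blast
  then have "((\<lambda>n. 1 / (1 + q n * real n)) \<longlonglongrightarrow> 0)"
    by (intro tendsto_divide_0[OF tendsto_const] filterlim_at_top_imp_at_infinity
        filterlim_tendsto_add_at_top[OF tendsto_const])
  then have "(\<lambda>n. 1 - 1 / (1 + q n * real n)) \<longlonglongrightarrow> 1 - 0" by (intro tendsto_intros)
  moreover have "1 - 1 / (1 + q n * real n) = bump (real n) (c + 1 / real (Suc n)) (d - 1 / real (Suc n)) s" for n
  proof -
    have "1 + q n * real n > 0" by (simp add: q_def add_pos_nonneg)
    then show ?thesis unfolding bump_def q_def[symmetric] by (simp add: field_simps)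
  qed
  ultimately show ?thesis using True by simp
qed

lemma set_integral_Icc_eq_Ioo:
  fixes f :: "real \<Rightarrow> real"
  assumes "a \<le> b"
  shows "(LBINT s:{a<..<b}. f s) = (LBINT s:{a..b}. f s)"
  using interval_integral_Ioo[of a b f] interval_integral_Icc[of a b f] assms by simp

lemma integral_against_tests_zero_imp_interval_integrals_zero:
  fixes f :: "real \<Rightarrow> real"
  assumes f: "set_integrable lborel {a<..<b} f"
    and z: "\<And>\<phi>. \<phi> \<in> test_functions {a<..<b} \<Longrightarrow> (LBINT s:{a<..<b}. f s * \<phi> s) = 0"
    and cd: "a \<le> c" "d \<le> b"
  shows "(LBINT s:{c<..<d}. f s) = 0"
proof -
  let ?\<phi> = "\<lambda>n. bump (real n) (c + 1 / real (Suc n)) (d - 1 / real (Suc n))"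
  have t: "?\<phi> n \<in> test_functions {a<..<b}" for n
  proof (rule bump_test)
    have "1 / real (Suc n) > 0" by simp
    then show "{c + 1 / real (Suc n)..d - 1 / real (Suc n)} \<subseteq> {a<..<b}"
      using cd by (intro subsetI) (simp only: atLeastAtMost_iff greaterThanLessThan_iff, linarith)
  qed simp
  have m: "?\<phi> n \<in> borel_measurable lborel" for n
    using test_function_derivative(3)[OF t, of UNIV n] borel_measurable_continuous_onI by simp
  have i: "integrable lborel (\<lambda>s. indicator {a<..<b} s * f s)"
    using f by (simp add: set_integrable_def)
  have "(\<lambda>n. LINT s|lborel. indicator {a<..<b} s * f s * ?\<phi> n s) \<longlonglongrightarrow>
      (LINT s|lborel. indicator {c<..<d} s * f s)"
  proof (rule integral_dominated_convergence[where w="\<lambda>s. norm (indicator {a<..<b} s * f s)"])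
    have "(\<lambda>s. indicator {c<..<d} s * (indicator {a<..<b} s * f s)) \<in> borel_measurable lborel"
      by (rule borel_measurable_times[OF _ borel_measurable_integrable[OF i]]) simp
    moreover have "(\<lambda>s. indicator {c<..<d} s * (indicator {a<..<b} s * f s)) = (\<lambda>s. indicator {c<..<d} s * f s)"
      using cd by (auto simp: indicator_def)
    ultimately show "(\<lambda>s. indicator {c<..<d} s * f s) \<in> borel_measurable lborel" by simp
    show "(\<lambda>s. indicator {a<..<b} s * f s * ?\<phi> n s) \<in> borel_measurable lborel" for n
      by (rule borel_measurable_times[OF borel_measurable_integrable[OF i] m])
    show "integrable lborel (\<lambda>s. norm (indicator {a<..<b} s * f s))" using i by (rule integrable_norm)
    show "AE s in lborel. (\<lambda>n. indicator {a<..<b} s * f s * ?\<phi> n s) \<longlonglongrightarrow> indicator {c<..<d} s * f s"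
    proof (rule AE_I2)
      fix s
      have "(\<lambda>n. indicator {a<..<b} s * f s * ?\<phi> n s) \<longlonglongrightarrow> indicator {a<..<b} s * f s * indicator {c<..<d} s"
        by (intro tendsto_mult tendsto_const bump_tendsto_indicator)
      also have "indicator {a<..<b} s * f s * indicator {c<..<d} s = indicator {c<..<d} s * f s"
        using cd by (auto simp: indicator_def)
      finally show "(\<lambda>n. indicator {a<..<b} s * f s * ?\<phi> n s) \<longlonglongrightarrow> indicator {c<..<d} s * f s" .
    qed
    show "AE s in lborel. norm (indicator {a<..<b} s * f s * ?\<phi> n s) \<le> norm (indicator {a<..<b} s * f s)" for n
    proof (rule AE_I2)
      fix s
      have "\<bar>?\<phi> n s\<bar> \<le> 1" using bump_range[of "real n"] by (simp add: abs_le_iff order_trans[OF _ bump_range(1)])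
      then show "norm (indicator {a<..<b} s * f s * ?\<phi> n s) \<le> norm (indicator {a<..<b} s * f s)"
        by (simp add: abs_mult mult_left_le)
    qed
  qed
  moreover have "(LINT s|lborel. indicator {a<..<b} s * f s * ?\<phi> n s) = 0" for n
    using z[OF t, of n] by (simp add: set_lebesgue_integral_def mult.assoc)
  ultimately have "(LINT s|lborel. indicator {c<..<d} s * f s) = 0"
    by (simp add: LIMSEQ_const_iff)
  then show ?thesis by (simp add: set_lebesgue_integral_def)
qed

text \<open>
  The fundamental lemma of the calculus of variations. The integrals over all rays vanish, hence the
  positive and the negative part of the function are densities of the same measure.
\<close>

lemma integral_against_tests_zero_imp_AE_zero:
  fixes f :: "real \<Rightarrow> real"
  assumes f: "set_integrable lborel {a<..<b} f"
    and z: "\<And>\<phi>. \<phi> \<in> test_functions {a<..<b} \<Longrightarrow> (LBINT s:{a<..<b}. f s * \<phi> s) = 0"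
  shows "AE s in lborel. s \<in> {a<..<b} \<longrightarrow> f s = 0"
proof -
  let ?g = "\<lambda>s. indicator {a<..<b} s * f s"
  have g: "integrable lborel ?g" using f by (simp add: set_integrable_def)
  then have [measurable]: "?g \<in> borel_measurable borel" by simp
  have ray: "(LINT s|lborel. indicator {x<..} s * ?g s) = 0" for x
  proof -
    have "indicator {x<..} s * ?g s = indicator {max a x<..<b} s * f s" for s
      by (auto simp: indicator_def)
    then have "(LINT s|lborel. indicator {x<..} s * ?g s) = (LINT s|lborel. indicator {max a x<..<b} s * f s)"
      by presburger
    then show ?thesis
      using integral_against_tests_zero_imp_interval_integrals_zero[OF f z, of "max a x" b]
      by (simp add: set_lebesgue_integral_def)
  qed
  \<comment> \<open>The truncation in \<^const>\<open>ennreal\<close> extracts the positive and the negative part.\<close>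
  let ?P = "density lborel (\<lambda>s. ennreal (?g s))" and ?N = "density lborel (\<lambda>s. ennreal (- ?g s))"
  have i: "integrable lborel (\<lambda>s. indicator {x<..} s * ?g s)" for x
    using integrable_mult_indicator[OF _ g, of "{x<..}"] by simp
  have em: "emeasure (density lborel (\<lambda>s. ennreal (k * ?g s))) {x<..} =
        (\<integral>\<^sup>+s. ennreal (k * (indicator {x<..} s * ?g s)) \<partial>lborel)" for k x
    by (auto simp: emeasure_density intro!: nn_integral_cong split: split_indicator)
  have "?P = ?N"
  proof (rule measure_eqI_lessThan)
    fix x
    have P: "emeasure ?P {x<..} = (\<integral>\<^sup>+s. ennreal (indicator {x<..} s * ?g s) \<partial>lborel)"
      using em[of 1 x] by simp
    have N: "emeasure ?N {x<..} = (\<integral>\<^sup>+s. ennreal (- (indicator {x<..} s * ?g s)) \<partial>lborel)"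
      using em[of "-1" x] by simp
    have fin: "(\<integral>\<^sup>+s. ennreal (indicator {x<..} s * ?g s) \<partial>lborel) \<noteq> \<infinity>"
      "(\<integral>\<^sup>+s. ennreal (- (indicator {x<..} s * ?g s)) \<partial>lborel) \<noteq> \<infinity>"
      using i[of x] by (simp_all add: real_integrable_def)
    show "emeasure ?P {x<..} < \<infinity>" using fin P by (simp add: less_top)
    have "enn2real (emeasure ?P {x<..}) = enn2real (emeasure ?N {x<..})"
      using real_lebesgue_integral_def[OF i[of x]] ray[of x] P N by simp
    then show "emeasure ?P {x<..} = emeasure ?N {x<..}"
      using fin P N ennreal_enn2real[of "emeasure ?P {x<..}"] ennreal_enn2real[of "emeasure ?N {x<..}"]
      by (simp only: less_top infinity_ennreal_def)
  qed auto
  then have "AE s in lborel. ennreal (?g s) = ennreal (- ?g s)"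
    by (intro sigma_finite_measure.density_unique[OF sigma_finite_lborel]) auto
  then show ?thesis
  proof eventually_elim
    case (elim s)
    have "?g s = 0"
      using elim by (cases "?g s \<ge> 0") (auto simp: ennreal_neg ennreal_eq_0_iff)
    then show ?case by (auto simp: indicator_def)
  qed
qed


lemma L2_on_imp_set_integrable:
  assumes "L2_on {a<..<b} f"
  shows "set_integrable lborel {a<..<b} f"
proof (rule set_integrable_bound)
  have "set_integrable lborel {a<..<b} (\<lambda>s. 1::real)"
    by (rule set_integrable_subset[OF borel_integrable_atLeastAtMost'[of a b]]) auto
  then show "set_integrable lborel {a<..<b} (\<lambda>s. 1 + (f s)\<^sup>2)"
    using assms by (intro set_integral_add) (auto simp: L2_on_def)
  show "set_borel_measurable lborel {a<..<b} f" using assms by (simp add: L2_on_def)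
  have "\<bar>x\<bar> \<le> 1 + x\<^sup>2" for x :: real
    using zero_le_power2[of "\<bar>x\<bar> - 1/2"] by (simp add: power2_diff field_simps)
  then show "AE s in lborel. s \<in> {a<..<b} \<longrightarrow> norm (f s) \<le> norm (1 + (f s)\<^sup>2)" by simp
qed

lemma continuous_imp_L2_on:
  fixes f :: "real \<Rightarrow> real"
  assumes "continuous_on {a..b} f"
  shows "L2_on {a<..<b} f" "set_integrable lborel {a<..<b} f"
proof -
  have *: "set_integrable lborel {a<..<b} g" if "continuous_on {a..b} g" for g :: "real \<Rightarrow> real"
    by (rule set_integrable_subset[OF borel_integrable_atLeastAtMost'[OF that]]) auto
  show "set_integrable lborel {a<..<b} f" using * assms .
  then show "L2_on {a<..<b} f"
    unfolding L2_on_def set_integrable_def set_borel_measurable_def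
    using *[OF continuous_on_power[OF assms, of 2]] by (auto simp: set_integrable_def)
qed

lemma set_integrable_mult_continuous:
  fixes f g :: "real \<Rightarrow> real"
  assumes f: "set_integrable lborel {a<..<b} f" and g: "continuous_on {a..b} g"
  shows "set_integrable lborel {a<..<b} (\<lambda>s. f s * g s)"
proof -
  obtain K where K: "\<And>s. s \<in> {a..b} \<Longrightarrow> \<bar>g s\<bar> \<le> K"
    using compact_imp_bounded[OF compact_continuous_image[OF g compact_Icc]]
    by (force simp: bounded_iff)
  show ?thesis
  proof (rule set_integrable_bound)
    show "set_integrable lborel {a<..<b} (\<lambda>s. K * f s)" using f by simp
    have "(\<lambda>s. (indicator {a<..<b} s * f s) * (indicator {a<..<b} s * g s)) \<in> borel_measurable lborel"
      using f continuous_imp_L2_on(2)[OF g]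
      by (intro borel_measurable_times[OF borel_measurable_integrable borel_measurable_integrable])
        (auto simp: set_integrable_def)
    moreover have "(\<lambda>s. (indicator {a<..<b} s * f s) * (indicator {a<..<b} s * g s)) = (\<lambda>s. indicator {a<..<b} s *\<^sub>R (f s * g s))"
      by (auto simp: indicator_def)
    ultimately show "set_borel_measurable lborel {a<..<b} (\<lambda>s. f s * g s)"
      by (simp add: set_borel_measurable_def)
    show "AE s in lborel. s \<in> {a<..<b} \<longrightarrow> norm (f s * g s) \<le> norm (K * f s)"
    proof (intro AE_I2 impI)
      fix s assume "s \<in> {a<..<b}"
      then have "\<bar>g s\<bar> \<le> \<bar>K\<bar>" using K[of s] by auto
      then show "norm (f s * g s) \<le> norm (K * f s)"
        using mult_right_mono[of "\<bar>g s\<bar>" "\<bar>K\<bar>" "\<bar>f s\<bar>"] by (simp add: abs_mult mult.commute)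
    qed
  qed
qed

lemma integral_derivative:
  fixes F f :: "real \<Rightarrow> real"
  assumes "a \<le> b" "\<And>s. s \<in> {a..b} \<Longrightarrow> (F has_real_derivative f s) (at s within {a..b})"
    and "continuous_on {a..b} f"
  shows "(LBINT s:{a<..<b}. f s) = F b - F a"
  using integral_FTC_Icc[of a b F f] assms set_integral_Icc_eq_Ioo[of a b f]
  by (simp add: has_real_derivative_iff_has_vector_derivative set_lebesgue_integral_def)

lemma classical_derivative_is_weak:
  assumes ab: "a < b"
    and d: "\<And>s. s \<in> {a..b} \<Longrightarrow> (f has_real_derivative f' s) (at s within {a..b})"
    and c: "continuous_on {a..b} f'"
  shows "has_L2_weak_deriv {a<..<b} f f'" "f \<in> W12_on {a<..<b}"
proof -
  have cf: "continuous_on {a..b} f"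
    using d by (meson DERIV_continuous continuous_on_eq_continuous_within)
  have "(LBINT s:{a<..<b}. f s * deriv \<phi> s) = - (LBINT s:{a<..<b}. f' s * \<phi> s)"
    if \<phi>: "\<phi> \<in> test_functions {a<..<b}" for \<phi>
  proof -
    note \<phi>' = test_function_derivative[OF \<phi>]
    obtain c d where cd: "a < c" "c \<le> d" "d < b" "\<And>s. s \<notin> {c..d} \<Longrightarrow> \<phi> s = 0"
      using test_function_support[OF \<phi> ab] by metis
    have "(LBINT s:{a<..<b}. f s * deriv \<phi> s + f' s * \<phi> s) = f b * \<phi> b - f a * \<phi> a"
    proof (rule integral_derivative)
      fix s assume "s \<in> {a..b}"
      then show "((\<lambda>s. f s * \<phi> s) has_real_derivative f s * deriv \<phi> s + f' s * \<phi> s) (at s within {a..b})"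
        using d[of s] has_field_derivative_at_within[OF \<phi>'(1)[of s], of "{a..b}"]
        by (auto intro!: derivative_eq_intros)
    qed (use ab c cf \<phi>' in \<open>auto intro!: continuous_intros\<close>)
    also have "\<dots> = 0" using cd(1-3) cd(4)[of a] cd(4)[of b] by simp
    also have "(LBINT s:{a<..<b}. f s * deriv \<phi> s + f' s * \<phi> s) =
        (LBINT s:{a<..<b}. f s * deriv \<phi> s) + (LBINT s:{a<..<b}. f' s * \<phi> s)"
      by (intro set_integral_add continuous_imp_L2_on(2) continuous_intros c cf \<phi>')
    finally show ?thesis by simp
  qed
  then show "has_L2_weak_deriv {a<..<b} f f'"
    using continuous_imp_L2_on[OF c] by (simp add: has_L2_weak_deriv_def)
  then show "f \<in> W12_on {a<..<b}"
    using continuous_imp_L2_on[OF cf] by (auto simp: W12_on_def)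
qed

lemma weak_derivative_unique:
  assumes "has_L2_weak_deriv {a<..<b} f g" "has_L2_weak_deriv {a<..<b} f h"
  shows "AE s in lborel. s \<in> {a<..<b} \<longrightarrow> g s = h s"
proof -
  have i: "set_integrable lborel {a<..<b} g" "set_integrable lborel {a<..<b} h"
    using assms L2_on_imp_set_integrable by (auto simp: has_L2_weak_deriv_def)
  have "AE s in lborel. s \<in> {a<..<b} \<longrightarrow> g s - h s = 0"
  proof (rule integral_against_tests_zero_imp_AE_zero)
    fix \<phi> assume \<phi>: "\<phi> \<in> test_functions {a<..<b}"
    note c = test_function_derivative(3)[OF \<phi>, of "{a..b}"]
    have "(LBINT s:{a<..<b}. g s * \<phi> s) = (LBINT s:{a<..<b}. h s * \<phi> s)"
    proof -
      have "- (LBINT s:{a<..<b}. g s * \<phi> s) = - (LBINT s:{a<..<b}. h s * \<phi> s)"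
        using assms(1)[unfolded has_L2_weak_deriv_def, THEN conjunct2, rule_format, OF \<phi>]
          assms(2)[unfolded has_L2_weak_deriv_def, THEN conjunct2, rule_format, OF \<phi>] by (rule trans[OF sym])
      then show ?thesis by simp
    qed
    then show "(LBINT s:{a<..<b}. (g s - h s) * \<phi> s) = 0"
      using set_integral_diff(2)[OF set_integrable_mult_continuous[OF i(1) c] set_integrable_mult_continuous[OF i(2) c]]
      by (simp add: left_diff_distrib)
  qed (use i in auto)
  then show ?thesis by simp
qed

text \<open>
  Every test function \<open>\<psi>\<close> differs from a multiple of one fixed test function \<open>\<omega>\<close> by the derivative
  of a test function: if the multiple is chosen so that the difference has integral zero, then its
  primitive has compact support. So \<open>f\<close> integrates against \<open>\<psi>\<close> like a constant.
\<close>

lemma du_bois_reymond: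
  fixes f :: "real \<Rightarrow> real"
  assumes ab: "a < b" and f: "set_integrable lborel {a<..<b} f"
    and z: "\<And>\<phi>. \<phi> \<in> test_functions {a<..<b} \<Longrightarrow> (LBINT s:{a<..<b}. f s * deriv \<phi> s) = 0"
  shows "\<exists>c. AE s in lborel. s \<in> {a<..<b} \<longrightarrow> f s = c"
proof -
  define c0 d0 where "c0 = a + (b - a) / 3" and "d0 = b - (b - a) / 3"
  have cd0: "a < c0" "c0 < d0" "d0 < b" using ab by (auto simp: c0_def d0_def field_simps)
  define \<omega> where "\<omega> = bump 1 c0 d0"
  have \<omega>: "\<omega> \<in> test_functions {a<..<b}" unfolding \<omega>_def by (rule bump_test) (use cd0 in auto)
  have c\<omega>: "continuous_on S \<omega>" for S using test_function_derivative(3)[OF \<omega>] .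
  define X where "X = (LBINT s:{a<..<b}. \<omega> s)"
  have X: "X \<noteq> 0"
  proof
    assume "X = 0"
    then have "integral {a..b} \<omega> = 0"
      using set_borel_integral_eq_integral(2)[OF borel_integrable_atLeastAtMost'[OF c\<omega>], of a b]
        set_integral_Icc_eq_Ioo[of a b \<omega>] ab by (simp add: X_def)
    then have "\<omega> ((c0 + d0) / 2) = 0"
      using integral_eq_0_iff[of a b \<omega>] ab c\<omega> bump_range(1)[of 1] cd0 by (auto simp: \<omega>_def)
    then show False using cd0 zero_le_power[of "d0 - c0" 4] by (auto simp: \<omega>_def bump_def add_eq_0_iff field_simps)
  qed
  define k where "k = (LBINT s:{a<..<b}. f s * \<omega> s) / X"
  have "AE s in lborel. s \<in> {a<..<b} \<longrightarrow> f s - k = 0"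
  proof (rule integral_against_tests_zero_imp_AE_zero)
    show "set_integrable lborel {a<..<b} (\<lambda>s. f s - k)"
      by (intro set_integral_diff f continuous_imp_L2_on) auto
    fix \<psi> assume \<psi>: "\<psi> \<in> test_functions {a<..<b}"
    have c\<psi>: "continuous_on S \<psi>" for S using test_function_derivative(3)[OF \<psi>] .
    obtain c1 d1 where cd1: "a < c1" "c1 \<le> d1" "d1 < b" "\<And>s. s \<notin> {c1..d1} \<Longrightarrow> \<psi> s = 0"
      using test_function_support[OF \<psi> ab] by metis
    define P where "P = (LBINT s:{a<..<b}. \<psi> s)"
    define h where "h s = \<psi> s - P / X * \<omega> s" for s
    have ch: "continuous_on S h" for S unfolding h_def by (intro continuous_intros c\<psi> c\<omega>)
    have h0: "(LBINT s:{a<..<b}. h s) = 0"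
      unfolding h_def
      by (subst set_integral_diff)
        (use X in \<open>auto simp: X_def[symmetric] P_def[symmetric] intro!: continuous_imp_L2_on continuous_intros c\<psi> c\<omega>\<close>)
    obtain F where F: "\<And>s. (F has_real_derivative h s) (at s)"
      using einterval_antiderivative[of "-\<infinity>" \<infinity> h] ch[of UNIV]
      by (auto simp: continuous_on_eq_continuous_at has_real_derivative_iff_has_vector_derivative)
    define c d where "c = min c0 c1" and "d = max d0 d1"
    have cd: "a < c" "c < d" "d < b" using cd0 cd1 by (auto simp: c_def d_def)
    have hout: "h s = 0" if "s \<notin> {c..d}" for s
      
    proof -
      have "s \<notin> {c1..d1}" "s \<notin> {c0..d0}" using that by (auto simp: c_def d_def)
      then show ?thesis using cd1(4)[of s] bump_outside[of s c0 d0 1] by (simp add: h_def \<omega>_def)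
    qed
    have Fc: "F s = F a" if "s < c" for s
    proof (rule DERIV_zero_connected_constant[of "{..<c}" "{}" F])
      show "continuous_on {..<c} F" using F by (meson DERIV_isCont continuous_at_imp_continuous_on)
      show "\<forall>x\<in>{..<c} - {}. (F has_real_derivative 0) (at x)" using F hout by (metis Diff_empty atLeastAtMost_iff lessThan_iff linorder_not_le)
    qed (use that cd in auto)
    have Fd: "F s = F b" if "s > d" for s
    proof (rule DERIV_zero_connected_constant[of "{d<..}" "{}" F])
      show "continuous_on {d<..} F" using F by (meson DERIV_isCont continuous_at_imp_continuous_on)
      show "\<forall>x\<in>{d<..} - {}. (F has_real_derivative 0) (at x)" using F hout by (metis Diff_empty atLeastAtMost_iff greaterThan_iff linorder_not_le)
    qed (use that cd in auto)
    have Fab: "F b = F a"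
      using integral_derivative[of a b F h] ab F h0 ch by (auto intro: has_field_derivative_at_within)
    have D: "((\<lambda>s. F s - F a) has_real_derivative h s) (at s)" for s
      using F[of s] by (auto intro!: derivative_eq_intros)
    have out: "F s - F a = 0" if "s \<notin> {c..d}" for s
      using Fc[of s] Fd[of s] Fab that by auto
    have sub: "{c..d} \<subseteq> {a<..<b}" using cd by auto
    note t = test_functionsI[where \<phi>="\<lambda>s. F s - F a", OF D ch sub out]
    have "(LBINT s:{a<..<b}. f s * h s) = 0" using z[OF t(1)] t(2) by simp
    moreover have "(LBINT s:{a<..<b}. f s * h s) =
        (LBINT s:{a<..<b}. f s * \<psi> s) - P / X * (LBINT s:{a<..<b}. f s * \<omega> s)"
    proof -
      have "(LBINT s:{a<..<b}. f s * h s) = (LBINT s:{a<..<b}. f s * \<psi> s - P / X * (f s * \<omega> s))"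
        by (simp add: h_def algebra_simps)
      also have "\<dots> = (LBINT s:{a<..<b}. f s * \<psi> s) - (LBINT s:{a<..<b}. P / X * (f s * \<omega> s))"
        by (intro set_integral_diff set_integrable_mult_right set_integrable_mult_continuous f c\<psi> c\<omega>)
      finally show ?thesis by simp
    qed
    ultimately have "(LBINT s:{a<..<b}. f s * \<psi> s) = k * P" by (simp add: k_def)
    moreover have "(LBINT s:{a<..<b}. (f s - k) * \<psi> s) = (LBINT s:{a<..<b}. f s * \<psi> s) - (LBINT s:{a<..<b}. k * \<psi> s)"
      unfolding left_diff_distrib
      by (intro set_integral_diff set_integrable_mult_right set_integrable_mult_continuous f continuous_imp_L2_on c\<psi>)
    ultimately show "(LBINT s:{a<..<b}. (f s - k) * \<psi> s) = 0" by (simp add: P_def)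
  qed
  then show ?thesis by (intro exI[of _ k]) simp
qed

lemma continuous_nonneg_integral_zero:
  fixes f :: "real \<Rightarrow> real"
  assumes "a < b" "continuous_on {a..b} f" "\<And>s. s \<in> {a..b} \<Longrightarrow> 0 \<le> f s"
    and "(LBINT s:{a<..<b}. f s) = 0" "s \<in> {a..b}"
  shows "f s = 0"
proof -
  have "integral {a..b} f = 0"
    using set_borel_integral_eq_integral(2)[OF borel_integrable_atLeastAtMost'[OF assms(2)]]
      set_integral_Icc_eq_Ioo[of a b f] assms by simp
  then show ?thesis using integral_eq_0_iff[of a b f] assms by simp
qed

lemma continuous_AE_zero:
  fixes f :: "real \<Rightarrow> real"
  assumes "a < b" "continuous_on {a..b} f"
    and "AE s in lborel. s \<in> {a<..<b} \<longrightarrow> f s = 0" "s \<in> {a..b}"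
  shows "f s = 0"
proof -
  have c: "continuous_on {a..b} (\<lambda>s. \<bar>f s\<bar>)" using assms by (intro continuous_intros)
  have "(LBINT s:{a<..<b}. \<bar>f s\<bar>) = 0"
    unfolding set_lebesgue_integral_def
    by (rule integral_eq_zero_AE) (use assms(3) in \<open>auto simp: indicator_def\<close>)
  then have "\<bar>f s\<bar> = 0" using continuous_nonneg_integral_zero[OF assms(1) c _ _ assms(4)] by simp
  then show ?thesis by simp
qed

text \<open>
  A weakly differentiable function whose weak derivative agrees almost everywhere with a continuous
  function \<open>h\<close> differs from a primitive of \<open>h\<close> by a constant, by the du Bois-Reymond lemma; continuity
  removes the exceptional null set and includes the endpoints.
\<close>

lemma weak_equation_holds_classically:
  fixes h M :: "real \<Rightarrow> real"
  assumes ab: "a < b" and w: "has_L2_weak_deriv {a<..<b} f g"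
    and M: "continuous_on {a..b} M" "\<And>s. s \<in> {a<..<b} \<Longrightarrow> f s = M s"
    and h: "continuous_on {a..b} h" "AE s in lborel. s \<in> {a<..<b} \<longrightarrow> g s = h s"
    and s: "s \<in> {a..b}"
  shows "(M has_real_derivative h s) (at s within {a..b})"
proof -
  obtain A where A: "\<And>s. s \<in> {a..b} \<Longrightarrow> (A has_real_derivative h s) (at s within {a..b})"
    using antiderivative_continuous[OF h(1)] by (auto simp: has_real_derivative_iff_has_vector_derivative)
  have cA: "continuous_on {a..b} A"
    using A by (meson DERIV_continuous continuous_on_eq_continuous_within)
  have wA: "has_L2_weak_deriv {a<..<b} A h" using classical_derivative_is_weak(1)[OF ab A h(1)] .
  have "\<exists>k. AE s in lborel. s \<in> {a<..<b} \<longrightarrow> M s - A s = k"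
  proof (rule du_bois_reymond[OF ab])
    show "set_integrable lborel {a<..<b} (\<lambda>s. M s - A s)"
      by (intro continuous_imp_L2_on continuous_intros M cA)
    fix \<phi> assume \<phi>: "\<phi> \<in> test_functions {a<..<b}"
    note c = test_function_derivative[OF \<phi>]
    have "(LBINT s:{a<..<b}. M s * deriv \<phi> s) = (LBINT s:{a<..<b}. f s * deriv \<phi> s)"
      using M(2) by (intro set_lebesgue_integral_cong) auto
    also have "\<dots> = - (LBINT s:{a<..<b}. g s * \<phi> s)" using w \<phi> by (simp add: has_L2_weak_deriv_def)
    also have "(LBINT s:{a<..<b}. g s * \<phi> s) = (LBINT s:{a<..<b}. h s * \<phi> s)"
      unfolding set_lebesgue_integral_def
    proof (rule integral_cong_AE)
      have "set_integrable lborel {a<..<b} g" "set_integrable lborel {a<..<b} h"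
        using w wA L2_on_imp_set_integrable by (auto simp: has_L2_weak_deriv_def)
      then show "(\<lambda>s. indicator {a<..<b} s *\<^sub>R (g s * \<phi> s)) \<in> borel_measurable lborel"
        "(\<lambda>s. indicator {a<..<b} s *\<^sub>R (h s * \<phi> s)) \<in> borel_measurable lborel"
        using set_integrable_mult_continuous[OF _ c(3)] by (auto simp: set_integrable_def)
      show "AE s in lborel. indicator {a<..<b} s *\<^sub>R (g s * \<phi> s) = indicator {a<..<b} s *\<^sub>R (h s * \<phi> s)"
        using h(2) by eventually_elim (auto simp: indicator_def)
    qed
    also have "- (LBINT s:{a<..<b}. h s * \<phi> s) = (LBINT s:{a<..<b}. A s * deriv \<phi> s)"
      using wA \<phi> by (simp add: has_L2_weak_deriv_def)
    finally show "(LBINT s:{a<..<b}. (M s - A s) * deriv \<phi> s) = 0"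
      unfolding left_diff_distrib
      by (subst set_integral_diff) (auto intro!: continuous_imp_L2_on continuous_intros M cA c)
  qed
  then obtain k where k: "AE s in lborel. s \<in> {a<..<b} \<longrightarrow> M s - A s - k = 0" by (auto simp: algebra_simps)
  have "M s - A s - k = 0" if "s \<in> {a..b}" for s
    by (rule continuous_AE_zero[OF ab _ k that]) (intro continuous_intros M cA)
  then have eq: "A s + k = M s" if "s \<in> {a..b}" for s using that by fastforce
  have "((\<lambda>s. A s + k) has_real_derivative h s) (at s within {a..b})"
    using A[OF s] by (auto intro!: derivative_eq_intros)
  then show ?thesis
    by (rule has_field_derivative_transform_within[OF _ zero_less_one s]) (rule eq)
qed

text \<open>
  Where \<open>v\<close> is negative, \<open>v' \<ge> K v\<close>. Hence \<open>(max 0 (- v))\<^sup>2 exp (- 2 K t)\<close>, which is differentiable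
  everywhere, is nonincreasing, and it starts at zero.
\<close>

lemma differential_inequality_nonneg:
  fixes v v' :: "real \<Rightarrow> real"
  assumes v: "continuous_on {p..q} v" "\<And>s. s \<in> {p<..<q} \<Longrightarrow> (v has_real_derivative v' s) (at s)"
    and ineq: "\<And>s. s \<in> {p<..<q} \<Longrightarrow> v' s \<ge> - K * \<bar>v s\<bar>"
    and v0: "v p \<ge> 0" and s: "s \<in> {p..q}"
  shows "v s \<ge> 0"
proof -
  define z where "z t = (max 0 (- v t))\<^sup>2 * exp (- (2 * K * t))" for t
  have "z s \<le> z p"
  proof (rule DERIV_nonpos_imp_decreasing_open[of p s z])
    show "p \<le> s" using s by simp
    show "continuous_on {p..s} z"
      unfolding z_def by (intro continuous_intros continuous_on_subset[OF v(1)]) (use s in auto)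
    fix t assume t: "p < t" "t < s"
    then have tt: "t \<in> {p<..<q}" using s by auto
    have "(z has_real_derivative (2 * max 0 (- v t) * - v' t * exp (- (2 * K * t)) +
        - (2 * K) * exp (- (2 * K * t)) * (max 0 (- v t))\<^sup>2)) (at t)"
      unfolding z_def
      by (rule derivative_eq_intros DERIV_chain2[OF has_real_derivative_max_zero_squared] v(2) tt refl | simp)+
    moreover have "2 * max 0 (- v t) * - v' t * exp (- (2 * K * t)) +
        - (2 * K) * exp (- (2 * K * t)) * (max 0 (- v t))\<^sup>2 \<le> 0"
    proof (cases "v t \<ge> 0")
      case False
      then have "- v' t \<le> K * - v t" using ineq[OF tt] by simp
      then have "- v t * - v' t \<le> - v t * (K * - v t)" using False by (intro mult_left_mono) auto
      then have "2 * exp (- (2 * K * t)) * (- v t * - v' t) \<le> 2 * exp (- (2 * K * t)) * (- v t * (K * - v t))"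
        by (rule mult_left_mono) simp
      moreover have "max 0 (- v t) = - v t" using False by simp
      moreover have "2 * - v t * - v' t * exp (- (2 * K * t)) +
          - (2 * K) * exp (- (2 * K * t)) * (- v t)\<^sup>2 =
        2 * exp (- (2 * K * t)) * (- v t * - v' t) - 2 * exp (- (2 * K * t)) * (- v t * (K * - v t))"
        by algebra
      ultimately show ?thesis by (simp only:)
    qed simp
    ultimately show "\<exists>y. (z has_real_derivative y) (at t) \<and> y \<le> 0" by blast
  qed
  also have "z p = 0" using v0 by (simp add: z_def)
  finally have "(max 0 (- v s))\<^sup>2 \<le> 0" by (simp add: z_def mult_le_0_iff)
  then show ?thesis by simp
qed

text \<open>
  Reflecting \<open>t \<mapsto> - v (- t)\<close> preserves the inequality and gives the statement to the left of the zero.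
\<close>

lemma differential_inequality_sign:
  fixes v v' :: "real \<Rightarrow> real"
  assumes v: "continuous_on {a..b} v" "\<And>s. s \<in> {a<..<b} \<Longrightarrow> (v has_real_derivative v' s) (at s)"
    and ineq: "\<And>s. s \<in> {a<..<b} \<Longrightarrow> v' s \<ge> - K * \<bar>v s\<bar>"
    and s0: "s0 \<in> {a..b}" "v s0 = 0"
  shows "s \<in> {s0..b} \<Longrightarrow> v s \<ge> 0" "s \<in> {a..s0} \<Longrightarrow> v s \<le> 0"
proof -
  show "v s \<ge> 0" if "s \<in> {s0..b}"
    by (rule differential_inequality_nonneg[OF continuous_on_subset[OF v(1)] v(2) ineq, of s0 b])
      (use s0 that in auto)
  show "v s \<le> 0" if s: "s \<in> {a..s0}"
  proof -
    have "- v (- (- s)) \<ge> 0"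
    proof (rule differential_inequality_nonneg[where p="- s0" and q="- a" and v="\<lambda>t. - v (- t)" and v'="\<lambda>t. v' (- t)"])
      show "continuous_on {- s0..- a} (\<lambda>t. - v (- t))"
        by (intro continuous_intros continuous_on_compose2[OF v(1)]) (use s0 in auto)
      fix t assume "t \<in> {- s0<..<- a}"
      then have t: "- t \<in> {a<..<b}" using s0 by auto
      show "((\<lambda>t. - v (- t)) has_real_derivative v' (- t)) (at t)"
        by (rule derivative_eq_intros DERIV_chain2[OF v(2)] t refl | simp)+
      show "v' (- t) \<ge> - K * \<bar>- v (- t)\<bar>" using ineq[OF t] by simp
    qed (use s0 s in auto)
    then show ?thesis by simp
  qed
qed

section \<open>Geometry of a network\<close>

locale geometric_network =
  fixes N :: "('d::finite, 'e) network"
  assumes net: "is_network N"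
begin

lemma finite_edges: "finite (edges N)"
  using net unfolding is_network_def by (elim conjE)

lemma finite_verts: "finite (verts N)"
  using net unfolding is_network_def by (elim conjE)

lemma connected_points: "connected (points N)"
  using net unfolding is_network_def by (elim conjE)

lemma verts_on_edge: "j \<in> edges N \<Longrightarrow> verts N \<inter> seg N j = {src N j, tgt N j}"
proof -
  have "\<forall>j\<in>edges N. verts N \<inter> seg N j = {src N j, tgt N j}"
    using net unfolding is_network_def by (elim conjE)
  then show "j \<in> edges N \<Longrightarrow> verts N \<inter> seg N j = {src N j, tgt N j}" by blast
qed

lemma edge_ends_in_pairs: "j \<in> edges N \<Longrightarrow> (src N j, tgt N j) \<in> pairs N \<or> (tgt N j, src N j) \<in> pairs N"
proof -
  have "\<forall>j\<in>edges N. (src N j, tgt N j) \<in> pairs N \<or> (tgt N j, src N j) \<in> pairs N"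
    using net unfolding is_network_def by (elim conjE)
  then show "j \<in> edges N \<Longrightarrow> (src N j, tgt N j) \<in> pairs N \<or> (tgt N j, src N j) \<in> pairs N" by blast
qed

lemma src_vert: "j \<in> edges N \<Longrightarrow> src N j \<in> verts N"
  and tgt_vert: "j \<in> edges N \<Longrightarrow> tgt N j \<in> verts N"
  using verts_on_edge by blast+

lemma src_neq_tgt: "j \<in> edges N \<Longrightarrow> src N j \<noteq> tgt N j"
proof -
  have "\<forall>v. (v, v) \<notin> pairs N" using net unfolding is_network_def by (elim conjE)
  then show "j \<in> edges N \<Longrightarrow> src N j \<noteq> tgt N j" using edge_ends_in_pairs[of j] by auto
qed

lemma len_pos: "j \<in> edges N \<Longrightarrow> 0 < len N j"
  using src_neq_tgt by (simp add: len_def)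

lemma param_0: "param N j 0 = src N j"
  by (simp add: param_def)

lemma param_len: "j \<in> edges N \<Longrightarrow> param N j (len N j) = tgt N j"
  using len_pos[of j] by (simp add: param_def)

lemma continuous_on_param: "continuous_on S (param N j)"
  unfolding param_def by (intro continuous_intros)

lemma seg_eq_param_image: "j \<in> edges N \<Longrightarrow> seg N j = param N j ` {0..len N j}"
proof -
  assume j: "j \<in> edges N"
  have L: "len N j > 0" using len_pos[OF j] .
  have "{0..len N j} = (\<lambda>u. u * len N j) ` {0..1}"
    using L by (auto simp: image_def mult_le_cancel_right1 intro!: bexI[of _ "_ / len N j"])
  moreover have "param N j (u * len N j) = (1 - u) *\<^sub>R src N j + u *\<^sub>R tgt N j" for u
    using L by (simp add: param_def algebra_simps)
  ultimately show ?thesis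
    by (simp add: seg_def closed_segment_image_interval image_image)
qed

lemma param_in_seg: "j \<in> edges N \<Longrightarrow> s \<in> {0..len N j} \<Longrightarrow> param N j s \<in> seg N j"
  by (simp add: seg_eq_param_image)

lemma param_in_points: "j \<in> edges N \<Longrightarrow> s \<in> {0..len N j} \<Longrightarrow> param N j s \<in> points N"
  using param_in_seg by (auto simp: points_def)

definition arc_coord :: "'e \<Rightarrow> real ^ 'd \<Rightarrow> real" where
  "arc_coord j x = (x - src N j) \<bullet> (tgt N j - src N j) / len N j"

lemma arc_coord_param: "j \<in> edges N \<Longrightarrow> arc_coord j (param N j s) = s"
  using len_pos[of j]
  by (simp add: arc_coord_def param_def dot_square_norm len_def dist_norm norm_minus_commute power2_eq_square)

lemma continuous_on_arc_coord: "continuous_on S (arc_coord j)"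
  unfolding arc_coord_def[abs_def] divide_inverse by (intro continuous_intros)

lemma param_in_verts_iff:
  assumes "j \<in> edges N" "s \<in> {0..len N j}"
  shows "param N j s \<in> verts N \<longleftrightarrow> s = 0 \<or> s = len N j"
proof
  assume "param N j s \<in> verts N"
  then have "param N j s \<in> {src N j, tgt N j}" using verts_on_edge param_in_seg assms by blast
  then have "param N j s = param N j 0 \<or> param N j s = param N j (len N j)"
    using param_0 param_len assms by auto
  then show "s = 0 \<or> s = len N j" using arc_coord_param assms(1) by metis
next
  assume "s = 0 \<or> s = len N j"
  then show "param N j s \<in> verts N" using src_vert tgt_vert param_0 param_len assms by auto
qed

lemma param_interior:
  "j \<in> edges N \<Longrightarrow> s \<in> {0<..<len N j} \<Longrightarrow> param N j s \<in> seg N j - verts N"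
  "j \<in> edges N \<Longrightarrow> s \<in> {0<..<len N j} \<Longrightarrow> param N j s \<in> points N - verts N"
  using param_in_verts_iff[of j s] param_in_seg[of j s] param_in_points[of j s] by auto

lemma pointE:
  assumes "x \<in> points N"
  obtains j s where "j \<in> edges N" "s \<in> {0..len N j}" "x = param N j s"
  using assms seg_eq_param_image by (auto simp: points_def)

lemma interior_pointE:
  assumes "x \<in> points N - verts N"
  obtains j s where "j \<in> edges N" "s \<in> {0<..<len N j}" "x = param N j s"
proof -
  obtain j s where *: "j \<in> edges N" "s \<in> {0..len N j}" "x = param N j s"
    using assms pointE by blast
  then show ?thesis using that[of j s] param_in_verts_iff[of j s] assms by force
qed

lemma common_point_is_vertex:
  assumes "j \<in> edges N" "j' \<in> edges N" "j \<noteq> j'" "x \<in> seg N j" "x \<in> seg N j'"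
  shows "x \<in> verts N" "seg N j \<inter> seg N j' = {x}"
proof -
  have *: "(\<forall>v\<in>verts N. v \<in> seg N j \<and> v \<in> seg N j' \<longrightarrow> seg N j \<inter> seg N j' = {v}) \<and>
        ((\<nexists>v. v \<in> verts N \<and> v \<in> seg N j \<and> v \<in> seg N j') \<longrightarrow> seg N j \<inter> seg N j' = {})"
  proof -
    have "\<forall>j\<in>edges N. \<forall>j'\<in>edges N. j \<noteq> j' \<longrightarrow>
        (\<forall>v\<in>verts N. v \<in> seg N j \<and> v \<in> seg N j' \<longrightarrow> seg N j \<inter> seg N j' = {v}) \<and>
        ((\<nexists>v. v \<in> verts N \<and> v \<in> seg N j \<and> v \<in> seg N j') \<longrightarrow> seg N j \<inter> seg N j' = {})"
      using net unfolding is_network_def by (elim conjE)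
    then show ?thesis using assms(1-3) by simp
  qed
  then obtain v where "v \<in> verts N" "v \<in> seg N j" "v \<in> seg N j'" using assms by blast
  then show "x \<in> verts N" "seg N j \<inter> seg N j' = {x}" using * assms by auto
qed

lemma incident_iff: "v \<in> verts N \<Longrightarrow> j \<in> incident N v \<longleftrightarrow> j \<in> edges N \<and> (v = src N j \<or> v = tgt N j)"
  using verts_on_edge by (auto simp: incident_def)

lemma finite_incident: "finite (incident N v)"
  using finite_edges by (auto simp: incident_def)

lemma incident_nonempty: "v \<in> verts N \<Longrightarrow> incident N v \<noteq> {}"
proof -
  assume v: "v \<in> verts N"
  have "\<forall>v\<in>verts N. \<exists>w. (v, w) \<in> pairs N \<or> (w, v) \<in> pairs N"
    using net unfolding is_network_def by (elim conjE)
  then obtain w where w: "(v, w) \<in> pairs N \<or> (w, v) \<in> pairs N" using v by blast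
  have "\<forall>(v, w)\<in>pairs N. \<exists>j\<in>edges N. {src N j, tgt N j} = {v, w}"
    using net unfolding is_network_def by (elim conjE)
  then obtain j where "j \<in> edges N" "v \<in> {src N j, tgt N j}"
    using w by fastforce
  then show ?thesis using incident_iff[OF v] by auto
qed

text \<open>
  Two edges that leave \<open>v\<close> towards the same neighbour would meet in two vertices.
\<close>

lemma boundary_vert_incident_unique:
  assumes v: "v \<in> boundary_verts N" and j: "j \<in> incident N v" and j': "j' \<in> incident N v"
  shows "j = j'"
proof (rule ccontr)
  assume ne: "j \<noteq> j'"
  have vv: "v \<in> verts N" using v by (simp add: boundary_verts_def)
  obtain w where w: "\<And>w'. w' \<in> verts N \<Longrightarrow> (v, w') \<in> pairs N \<or> (w', v) \<in> pairs N \<Longrightarrow> w' = w"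
    using v by (auto simp: boundary_verts_def)
  have other: "w \<in> seg N i \<and> w \<noteq> v" if i: "i \<in> incident N v" for i
  proof -
    have e: "i \<in> edges N" "v = src N i \<or> v = tgt N i" using i incident_iff[OF vv] by auto
    have "(src N i, tgt N i) \<in> pairs N \<or> (tgt N i, src N i) \<in> pairs N"
      using edge_ends_in_pairs[OF e(1)] .
    \<comment> \<open>The far end of every edge at \<open>v\<close> is the only neighbour \<open>w\<close>.\<close>
    then have "w = (if v = src N i then tgt N i else src N i)"
      using e w src_vert[OF e(1)] tgt_vert[OF e(1)] by auto
    then show ?thesis using e src_neq_tgt[OF e(1)] by (auto simp: seg_def)
  qed
  have "j \<in> edges N" "j' \<in> edges N" "v \<in> seg N j" "v \<in> seg N j'" using j j' by (auto simp: incident_def)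
  then show False using common_point_is_vertex(2)[OF _ _ ne, of v] other[OF j] other[OF j'] by blast
qed

definition vertex_value :: "('e \<Rightarrow> real \<Rightarrow> real) \<Rightarrow> 'e \<Rightarrow> real ^ 'd \<Rightarrow> real" where
  "vertex_value f j v = (if v = src N j then f j 0 else f j (len N j))"

lemma sum_over_edge_ends:
  fixes p q :: "'e \<Rightarrow> real"
  shows "(\<Sum>j\<in>edges N. p j + q j) =
    (\<Sum>v\<in>verts N. \<Sum>j\<in>incident N v. if v = src N j then p j else q j)"
proof -
  let ?t = "\<lambda>v j. if v = src N j then p j else q j"
  have "(\<Sum>v\<in>verts N. \<Sum>j\<in>incident N v. ?t v j) =
      (\<Sum>v\<in>verts N. \<Sum>j\<in>edges N. if v \<in> seg N j then ?t v j else 0)"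
    unfolding incident_def using finite_edges by (intro sum.cong refl sum.inter_filter)
  also have "\<dots> = (\<Sum>j\<in>edges N. \<Sum>v\<in>verts N. if v \<in> seg N j then ?t v j else 0)"
    by (rule sum.swap)
  also have "\<dots> = (\<Sum>j\<in>edges N. p j + q j)"
  proof (rule sum.cong[OF refl])
    fix j assume j: "j \<in> edges N"
    have "(\<Sum>v\<in>verts N. if v \<in> seg N j then ?t v j else 0) = (\<Sum>v\<in>verts N \<inter> seg N j. ?t v j)"
      using finite_verts by (simp add: sum.inter_restrict)
    also have "\<dots> = p j + q j" using verts_on_edge[OF j] src_neq_tgt[OF j] by auto
    finally show "(\<Sum>v\<in>verts N. if v \<in> seg N j then ?t v j else 0) = p j + q j" .
  qed
  finally show ?thesis ..
qed

text \<open>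
  The way in which connectedness enters: a nonempty set of edges that is closed under passing to
  an edge with a common vertex contains all edges, since its union and the union of the
  other edges are disjoint closed sets covering the network.
\<close>

lemma edge_propagation:
  assumes A: "A \<subseteq> edges N" "A \<noteq> {}"
    and step: "\<And>j j' v. j \<in> A \<Longrightarrow> v \<in> verts N \<Longrightarrow> j \<in> incident N v \<Longrightarrow> j' \<in> incident N v \<Longrightarrow> j' \<in> A"
  shows "A = edges N"
proof (rule ccontr)
  assume "A \<noteq> edges N"
  then have B: "edges N - A \<noteq> {}" using A by auto
  let ?U = "\<lambda>S. \<Union>j\<in>S. seg N j"
  have closed: "closed (?U S)" if "S \<subseteq> edges N" for S
    using that finite_edges finite_subset by (intro closed_UN) (auto simp: seg_def)
  have sub: "?U A \<union> ?U (edges N - A) = points N" using A by (auto simp: points_def)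
  have ne: "seg N j \<noteq> {}" for j by (simp add: seg_def)
  have "?U A \<inter> ?U (edges N - A) = {}"
  proof (rule ccontr)
    assume "?U A \<inter> ?U (edges N - A) \<noteq> {}"
    then obtain x j j' where *: "j \<in> A" "j' \<in> edges N - A" "x \<in> seg N j" "x \<in> seg N j'" by blast
    then have "x \<in> verts N" using A common_point_is_vertex(1)[of j j' x] by blast
    then show False using step[of j x j'] * A by (auto simp: incident_def)
  qed
  moreover have "?U A \<noteq> {}" "?U (edges N - A) \<noteq> {}" using A B ne by auto
  moreover have "closed (points N)" using closed[of "edges N"] by (simp add: points_def)
  ultimately have "\<exists>X Y. closed X \<and> closed Y \<and> X \<noteq> {} \<and> Y \<noteq> {} \<and> X \<union> Y = points N \<and> X \<inter> Y = {}"
    using closed[OF A(1)] closed[OF Diff_subset] sub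
    by (intro exI[of _ "?U A"] exI[of _ "?U (edges N - A)"] conjI)
  then show False using connected_closed_set[OF \<open>closed (points N)\<close>, THEN iffD1, OF connected_points] by (rule notE[rotated])
qed

lemma glue_edge_functions:
  assumes g: "\<And>j. j \<in> edges N \<Longrightarrow> continuous_on {0..len N j} (g j)"
    and W: "\<And>j. j \<in> edges N \<Longrightarrow> g j 0 = W (src N j)" "\<And>j. j \<in> edges N \<Longrightarrow> g j (len N j) = W (tgt N j)"
  obtains w where "continuous_on (points N) w"
    "\<And>j s. j \<in> edges N \<Longrightarrow> s \<in> {0..len N j} \<Longrightarrow> on_edge N w j s = g j s"
proof -
  define w where "w x = (if x \<in> verts N then W x
    else let j = (SOME j. j \<in> edges N \<and> x \<in> seg N j) in g j (arc_coord j x))" for x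
  have w: "on_edge N w j' s = g j' s" if j': "j' \<in> edges N" and s: "s \<in> {0..len N j'}" for j' s
  proof (cases "param N j' s \<in> verts N")
    case True
    then have "s = 0 \<or> s = len N j'" using param_in_verts_iff j' s by blast
    then show ?thesis using True W[OF j'] param_0 param_len[OF j'] by (auto simp: on_edge_def w_def)
  next
    case False
    let ?x = "param N j' s"
    define j where "j = (SOME j. j \<in> edges N \<and> ?x \<in> seg N j)"
    have "j \<in> edges N \<and> ?x \<in> seg N j"
      unfolding j_def by (rule someI[of _ j']) (use j' s param_in_seg in auto)
    then have "j = j'" using common_point_is_vertex(1)[of j j' ?x] j' s param_in_seg False by blast
    then show ?thesis using False j' by (simp add: on_edge_def w_def j_def[symmetric] arc_coord_param)
  qed
  have "continuous_on (\<Union>j\<in>edges N. seg N j) w"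
  proof (rule continuous_on_closed_Union[OF finite_edges])
    fix j assume j: "j \<in> edges N"
    show "closed (seg N j)" by (simp add: seg_def)
    have "continuous_on (seg N j) (\<lambda>x. g j (arc_coord j x))"
      by (rule continuous_on_compose2[OF g[OF j] continuous_on_arc_coord])
        (auto simp: seg_eq_param_image[OF j] arc_coord_param[OF j])
    then show "continuous_on (seg N j) w"
      by (rule continuous_on_eq)
        (auto simp: seg_eq_param_image[OF j] arc_coord_param[OF j] w[OF j, unfolded on_edge_def])
  qed
  then show ?thesis using that[of w] w by (simp add: points_def)
qed

lemma weak_deriv_AE:
  assumes "has_L2_weak_deriv {0<..<len N j} (on_edge N u j) h"
  shows "AE s in lborel. s \<in> {0<..<len N j} \<longrightarrow> weak_deriv N u j s = h s"
  by (rule weak_derivative_unique[OF someI[of "has_L2_weak_deriv {0<..<len N j} (on_edge N u j)", folded weak_deriv_def, OF assms] assms])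

lemma weak_deriv_W12:
  assumes "u \<in> W12 N" "j \<in> edges N"
  shows "has_L2_weak_deriv {0<..<len N j} (on_edge N u j) (weak_deriv N u j)"
proof -
  obtain h where "has_L2_weak_deriv {0<..<len N j} (on_edge N u j) h"
    using assms by (auto simp: W12_def W12_on_def)
  then show ?thesis
    unfolding weak_deriv_def by (rule someI[of "has_L2_weak_deriv {0<..<len N j} (on_edge N u j)" h])
qed

text \<open>
  Elements of \<^const>\<open>V12\<close> are functions on the network, whereas the arguments below prescribe test
  functions edge by edge; matching vertex values are all that is needed to pass from one to the
  other.
\<close>

lemma glue_C1_edge_functions:
  assumes g: "\<And>j s. j \<in> edges N \<Longrightarrow> s \<in> {0..len N j} \<Longrightarrow>
      (g j has_real_derivative g' j s) (at s within {0..len N j})"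
    "\<And>j. j \<in> edges N \<Longrightarrow> continuous_on {0..len N j} (g' j)"
    and W: "\<And>j. j \<in> edges N \<Longrightarrow> g j 0 = W (src N j)" "\<And>j. j \<in> edges N \<Longrightarrow> g j (len N j) = W (tgt N j)"
  obtains w where "w \<in> V12 N"
    "\<And>j. j \<in> edges N \<Longrightarrow> AE s in lborel. s \<in> {0<..<len N j} \<longrightarrow> weak_deriv N w j s = g' j s"
proof -
  have "continuous_on {0..len N j} (g j)" if "j \<in> edges N" for j
    using g(1)[OF that] by (meson DERIV_continuous continuous_on_eq_continuous_within)
  from glue_edge_functions[OF this W] obtain w where w: "continuous_on (points N) w"
    "\<And>j s. j \<in> edges N \<Longrightarrow> s \<in> {0..len N j} \<Longrightarrow> on_edge N w j s = g j s" by blast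
  have d: "(on_edge N w j has_real_derivative g' j s) (at s within {0..len N j})"
    if "j \<in> edges N" "s \<in> {0..len N j}" for j s
    using g(1)[OF that] by (rule has_field_derivative_transform_within[OF _ zero_less_one])
      (use w(2)[OF that(1)] that in auto)
  note c = classical_derivative_is_weak[OF len_pos d g(2)]
  have "w \<in> V12 N" using w(1) c(2) by (auto simp: V12_def W12_def)
  then show ?thesis using that[of w] c(1) weak_deriv_AE by blast
qed

lemma trace_continuous_extension:
  assumes j: "j \<in> edges N" and M: "continuous_on {0..len N j} (M j)"
    and eq: "\<And>s. s \<in> {0<..<len N j} \<Longrightarrow> on_edge N u j s = M j s"
  shows "trace N u j v = vertex_value M j v"
proof -
  have L: "len N j > 0" using len_pos[OF j] .
  have "(M j \<longlongrightarrow> M j 0) (at_right 0)" "(M j \<longlongrightarrow> M j (len N j)) (at_left (len N j))"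
    using M L by (auto simp: continuous_on_Icc_at_rightD continuous_on_Icc_at_leftD)
  moreover have "\<forall>\<^sub>F s in at_right 0. on_edge N u j s = M j s"
    using eventually_at_right_real[OF L] by eventually_elim (rule eq)
  moreover have "\<forall>\<^sub>F s in at_left (len N j). on_edge N u j s = M j s"
    using eventually_at_left_real[OF L] by eventually_elim (rule eq)
  ultimately have "(on_edge N u j \<longlongrightarrow> M j 0) (at_right 0)"
    "(on_edge N u j \<longlongrightarrow> M j (len N j)) (at_left (len N j))"
    by (simp_all add: tendsto_cong)
  then show ?thesis
    by (simp add: trace_def vertex_value_def tendsto_Lim)
qed

lemma continuous_extension_Icc:
  fixes f :: "real \<Rightarrow> real"
  assumes ab: "a < b" and l: "(f \<longlongrightarrow> l) (at_right a)" and r: "(f \<longlongrightarrow> r) (at_left b)"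
    and c: "continuous_on {a<..<b} f"
  obtains g where "continuous_on {a..b} g" "\<And>s. s \<in> {a<..<b} \<Longrightarrow> f s = g s"
proof -
  define g where "g s = (if s = a then l else if s = b then r else f s)" for s
  have g: "f s = g s" if "s \<in> {a<..<b}" for s using that by (simp add: g_def)
  have "continuous_on {a..b} g"
  proof (rule continuous_on_IccI)
    have "\<forall>\<^sub>F s in at_right a. f s = g s"
      using eventually_at_right_real[OF ab] by eventually_elim (rule g)
    moreover have "g a = l" by (simp add: g_def)
    ultimately show "(g \<longlongrightarrow> g a) (at_right a)" using l tendsto_cong by metis
    have "\<forall>\<^sub>F s in at_left b. f s = g s"
      using eventually_at_left_real[OF ab] by eventually_elim (rule g)
    moreover have "g b = r" using ab by (simp add: g_def)
    ultimately show "(g \<longlongrightarrow> g b) (at_left b)" using r tendsto_cong by metis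
    fix x assume x: "a < x" "x < b"
    have "\<forall>\<^sub>F s in at x. f s = g s"
      using eventually_at_in_open[of "{a<..<b}" x] x by (auto elim!: eventually_mono simp: g)
    moreover have "f \<midarrow>x\<rightarrow> f x" using c x by (simp add: continuous_on_eq_continuous_at isContD)
    ultimately show "g \<midarrow>x\<rightarrow> g x" using x g[of x] by (simp add: tendsto_cong)
  qed (rule ab)
  then show ?thesis using that g by blast
qed

lemma PC_family_extension:
  assumes "f \<in> PC_family N"
  obtains M where "\<And>j. j \<in> edges N \<Longrightarrow> continuous_on {0..len N j} (M j)"
    "\<And>j s. j \<in> edges N \<Longrightarrow> s \<in> {0<..<len N j} \<Longrightarrow> f j s = M j s"
proof -
  have "\<exists>M. continuous_on {0..len N j} M \<and> (\<forall>s\<in>{0<..<len N j}. f j s = M s)" if j: "j \<in> edges N" for j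
  proof -
    obtain l r where "(f j \<longlongrightarrow> l) (at_right 0)" "(f j \<longlongrightarrow> r) (at_left (len N j))"
      and "continuous_on {0<..<len N j} (f j)"
      using assms j by (auto simp: PC_family_def)
    then show ?thesis using continuous_extension_Icc[OF len_pos[OF j]] by metis
  qed
  then show ?thesis using that by metis
qed

end

section \<open>Measures on a network\<close>

text \<open>
  Both \<^const>\<open>length_measure\<close> and \<^const>\<open>net_measure\<close> are given by a set function; it has to be
  recognized as countably additive before anything can be computed. In both cases it is a finite sum
  of measures.
\<close>

lemma emeasure_sum_of_measures:
  fixes A :: "'i \<Rightarrow> 'a measure"
  assumes sets: "\<And>i. i \<in> I \<Longrightarrow> sets (A i) = sets R"
    and \<mu>: "\<And>S. S \<in> sets R \<Longrightarrow> \<mu> S = (\<Sum>i\<in>I. emeasure (A i) S)"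
    and S: "S \<in> sets R"
  shows "emeasure (measure_of (space R) (sets R) \<mu>) S = (\<Sum>i\<in>I. emeasure (A i) S)"
proof -
  have "emeasure (measure_of (space R) (sets R) \<mu>) S = \<mu> S"
  proof (rule emeasure_measure_of_sigma)
    show "sigma_algebra (space R) (sets R)" by (rule sets.sigma_algebra_axioms)
    show "positive (sets R) \<mu>" using \<mu> by (simp add: positive_def)
    show "countably_additive (sets R) \<mu>"
    proof (rule countably_additiveI)
      fix X :: "nat \<Rightarrow> 'a set"
      assume X: "range X \<subseteq> sets R" "disjoint_family X" "\<Union> (range X) \<in> sets R"
      have "(\<Sum>n. \<mu> (X n)) = (\<Sum>n. \<Sum>i\<in>I. emeasure (A i) (X n))"
        using X \<mu> by (intro suminf_cong) auto
      also have "\<dots> = (\<Sum>i\<in>I. \<Sum>n. emeasure (A i) (X n))" by (rule suminf_sum) simp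
      also have "\<dots> = (\<Sum>i\<in>I. emeasure (A i) (\<Union> (range X)))"
        using X sets by (intro sum.cong refl suminf_emeasure) auto
      finally show "(\<Sum>n. \<mu> (X n)) = \<mu> (\<Union> (range X))" using \<mu> X by simp
    qed
  qed (rule S)
  then show ?thesis using \<mu>[OF S] by simp
qed

lemma nn_integral_sum_of_measures:
  fixes A :: "'i \<Rightarrow> 'a measure"
  assumes sets: "\<And>i. i \<in> I \<Longrightarrow> sets (A i) = sets M"
    and em: "\<And>S. S \<in> sets M \<Longrightarrow> emeasure M S = (\<Sum>i\<in>I. emeasure (A i) S)"
    and f: "f \<in> borel_measurable M"
  shows "nn_integral M f = (\<Sum>i\<in>I. nn_integral (A i) f)"
proof -
  have bm: "h \<in> borel_measurable (A i)" if "h \<in> borel_measurable M" "i \<in> I" for h i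
    using that by (simp add: measurable_cong_sets[OF sets refl])
  show ?thesis using f
  proof (induction rule: borel_measurable_induct)
    case (cong f g)
    moreover have "nn_integral (A i) f = nn_integral (A i) g" if "i \<in> I" for i
      using cong(3) sets_eq_imp_space_eq[OF sets[OF that]] by (intro nn_integral_cong) auto
    moreover have "nn_integral M f = nn_integral M g" using cong(3) by (intro nn_integral_cong) auto
    ultimately show ?case by simp
  next
    case (set S)
    then show ?case using em sets by simp
  next
    case (mult u c)
    then show ?case by (simp add: nn_integral_cmult sum_distrib_left bm)
  next
    case (add u v)
    then show ?case by (simp add: nn_integral_add sum.distrib bm)
  next
    case (seq U)
    have m: "U n \<in> borel_measurable (A i)" if "i \<in> I" for i n
      using bm seq.hyps(1) that by blast
    have inc: "incseq U" using seq.hyps by blast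
    have "nn_integral M (Sup (range U)) = (SUP n. nn_integral M (U n))"
      using nn_integral_monotone_convergence_SUP[OF inc, of M] seq.hyps(1) by (simp add: image_image SUP_apply[abs_def])
    also have "\<dots> = (SUP n. \<Sum>i\<in>I. nn_integral (A i) (U n))" using seq.IH by simp
    also have "\<dots> = (\<Sum>i\<in>I. SUP n. nn_integral (A i) (U n))"
      using inc by (intro ennreal_SUP_sum) (auto simp: incseq_def le_fun_def intro!: nn_integral_mono)
    also have "\<dots> = (\<Sum>i\<in>I. nn_integral (A i) (Sup (range U)))"
      using nn_integral_monotone_convergence_SUP[OF inc] m
      by (intro sum.cong refl) (simp add: image_image SUP_apply[abs_def])
    finally show ?case .
  qed
qed

lemma integral_sum_of_measures:
  fixes A :: "'i \<Rightarrow> 'a measure" and f :: "'a \<Rightarrow> real"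
  assumes I: "finite I" and sets: "\<And>i. i \<in> I \<Longrightarrow> sets (A i) = sets M"
    and em: "\<And>S. S \<in> sets M \<Longrightarrow> emeasure M S = (\<Sum>i\<in>I. emeasure (A i) S)"
    and f: "f \<in> borel_measurable M" and int: "\<And>i. i \<in> I \<Longrightarrow> integrable (A i) f"
  shows "integrable M f" "integral\<^sup>L M f = (\<Sum>i\<in>I. integral\<^sup>L (A i) f)"
proof -
  have P: "(\<integral>\<^sup>+x. ennreal (f x) \<partial>M) = (\<Sum>i\<in>I. \<integral>\<^sup>+x. ennreal (f x) \<partial>A i)"
    and N: "(\<integral>\<^sup>+x. ennreal (- f x) \<partial>M) = (\<Sum>i\<in>I. \<integral>\<^sup>+x. ennreal (- f x) \<partial>A i)"
    using f by (auto intro!: nn_integral_sum_of_measures[OF sets em])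
  have fin: "(\<integral>\<^sup>+x. ennreal (f x) \<partial>A i) < \<infinity>" "(\<integral>\<^sup>+x. ennreal (- f x) \<partial>A i) < \<infinity>" if "i \<in> I" for i
    using int[OF that] by (auto simp: real_integrable_def less_top)
  then show i: "integrable M f"
    unfolding real_integrable_def P N using f
    by (simp add: less_top[symmetric] I)
  show "integral\<^sup>L M f = (\<Sum>i\<in>I. integral\<^sup>L (A i) f)"
    using fin int by (simp add: real_lebesgue_integral_def i P N enn2real_sum sum_subtractf)
qed

context geometric_network
begin

text \<open>
  A function of class \<^const>\<open>PC\<close> is handled through the continuous extensions \<open>g j\<close> of its
  restrictions to the closed parameter intervals; its values at the vertices are arbitrary.
\<close>

definition extends :: "('e \<Rightarrow> real \<Rightarrow> real) \<Rightarrow> (real ^ 'd \<Rightarrow> real) \<Rightarrow> bool" where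
  "extends g f \<longleftrightarrow> (\<forall>j\<in>edges N. continuous_on {0..len N j} (g j) \<and>
     (\<forall>s\<in>{0<..<len N j}. on_edge N f j s = g j s))"

lemma compact_points: "compact (points N)"
  unfolding points_def using finite_edges by (intro compact_UN) (auto simp: seg_def)

abbreviation borel_points :: "(real ^ 'd) measure" where
  "borel_points \<equiv> restrict_space borel (points N)"

lemma space_borel_points: "space borel_points = points N"
  by (simp add: space_restrict_space)

lemma param_measurable:
  "j \<in> edges N \<Longrightarrow> param N j \<in> measurable (restrict_space lborel {0..len N j}) borel_points"
proof (rule measurable_restrict_space2)
  assume j: "j \<in> edges N"
  show "param N j \<in> space (restrict_space lborel {0..len N j}) \<rightarrow> points N"
    using param_in_points[OF j] by (auto simp: space_restrict_space)
  show "param N j \<in> borel_measurable (restrict_space lborel {0..len N j})"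
    by (intro measurable_restrict_space1) (simp add: borel_measurable_continuous_onI continuous_on_param)
qed

lemma extends_borel_measurable:
  assumes "extends g f"
  shows "f \<in> borel_measurable borel_points"
proof (rule measurable_piecewise_restrict)
  let ?C = "insert (verts N) ((\<lambda>j. seg N j - verts N) ` edges N)"
  show "countable ?C" using finite_edges by (simp add: countable_finite)
  have vb: "verts N \<in> sets borel" using finite_verts by (simp add: borel_closed finite_imp_closed)
  have sb: "seg N j \<in> sets borel" for j by (simp add: seg_def borel_closed)
  show "\<Omega> \<inter> space borel_points \<in> sets borel_points" if "\<Omega> \<in> ?C" for \<Omega>
    using that vb sb by (auto simp: sets_restrict_space space_restrict_space)
  show "space borel_points \<subseteq> \<Union>?C" by (auto simp: space_restrict_space points_def)
  fix \<Omega> assume \<Omega>: "\<Omega> \<in> ?C"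
  have "continuous_on \<Omega> f"
  proof (cases "\<Omega> = verts N")
    case True
    then show ?thesis using finite_verts by (simp add: continuous_on_finite)
  next
    case False
    then obtain j where j: "j \<in> edges N" "\<Omega> = seg N j - verts N" using \<Omega> by auto
    have c: "continuous_on {0..len N j} (g j)" and eq: "\<And>s. s \<in> {0<..<len N j} \<Longrightarrow> f (param N j s) = g j s"
      using assms j by (auto simp: extends_def on_edge_def)
    have *: "arc_coord j x \<in> {0..len N j} \<and> g j (arc_coord j x) = f x" if "x \<in> \<Omega>" for x
    proof -
      have "x \<in> param N j ` {0..len N j}" using that j(2) seg_eq_param_image[OF j(1)] by simp
      then obtain s where s: "s \<in> {0..len N j}" "x = param N j s" by (rule imageE)
      have "param N j s \<notin> verts N" using that unfolding j(2) s(2) by simp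
      then have "s \<noteq> 0" "s \<noteq> len N j" using param_in_verts_iff[OF j(1) s(1)] by simp_all
      then have "s \<in> {0<..<len N j}" using s(1) by simp
      then show ?thesis using s eq[of s] unfolding s(2) arc_coord_param[OF j(1)] by simp
    qed
    have "continuous_on \<Omega> (\<lambda>x. g j (arc_coord j x))"
      by (rule continuous_on_compose2[OF c continuous_on_arc_coord]) (use * in blast)
    then show ?thesis by (rule continuous_on_eq) (use * in blast)
  qed
  then have "continuous_on (points N \<inter> \<Omega>) f" by (rule continuous_on_subset) simp
  then have "f \<in> borel_measurable (restrict_space borel (points N \<inter> \<Omega>))"
    by (rule borel_measurable_continuous_on_restrict)
  then show "f \<in> borel_measurable (restrict_space borel_points \<Omega>)"
    using compact_points \<Omega> vb sb by (subst restrict_restrict_space) (auto simp: borel_compact)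
qed

definition edge_length_measure :: "'e \<Rightarrow> (real ^ 'd) measure" where
  "edge_length_measure j = distr (restrict_space lborel {0..len N j}) borel_points (param N j)"

lemma sets_edge_length_measure: "sets (edge_length_measure j) = sets borel_points"
  by (simp add: edge_length_measure_def)

lemma sets_length_measure: "sets (length_measure N) = sets borel_points"
  unfolding length_measure_def
  using sets.sigma_sets_eq[of borel_points] sets.space_closed[of borel_points]
  by (simp add: space_borel_points)

lemma emeasure_length_measure:
  assumes "S \<in> sets borel_points"
  shows "emeasure (length_measure N) S = (\<Sum>j\<in>edges N. emeasure (edge_length_measure j) S)"
  unfolding length_measure_def
proof (rule emeasure_sum_of_measures[OF sets_edge_length_measure _ assms, unfolded space_borel_points])
  fix S assume S: "S \<in> sets borel_points"
  show "(\<Sum>j\<in>edges N. emeasure lborel (param N j -` S \<inter> {0..len N j})) =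
      (\<Sum>j\<in>edges N. emeasure (edge_length_measure j) S)"
  proof (rule sum.cong[OF refl])
    fix j assume j: "j \<in> edges N"
    show "emeasure lborel (param N j -` S \<inter> {0..len N j}) = emeasure (edge_length_measure j) S"
      unfolding edge_length_measure_def
      by (subst emeasure_distr[OF param_measurable[OF j] S])
        (auto simp: space_restrict_space emeasure_restrict_space)
  qed
qed

lemma integral_edge_length_measure:
  assumes j: "j \<in> edges N" and f: "extends g f"
  shows "integrable (edge_length_measure j) f"
    "integral\<^sup>L (edge_length_measure j) f = (LBINT s:{0<..<len N j}. g j s)"
proof -
  note m = extends_borel_measurable[OF f]
  have g: "continuous_on {0..len N j} (g j)" "\<And>s. s \<in> {0<..<len N j} \<Longrightarrow> f (param N j s) = g j s"
    using f j by (auto simp: extends_def on_edge_def)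
  have L: "len N j > 0" using len_pos[OF j] .
  have "set_integrable lborel {0<..<len N j} (\<lambda>s. f (param N j s)) \<longleftrightarrow> set_integrable lborel {0<..<len N j} (g j)"
    using g(2) by (intro set_integrable_cong) auto
  then have "set_integrable lborel {0<..<len N j} (\<lambda>s. f (param N j s))"
    using continuous_imp_L2_on(2)[OF g(1)] by simp
  moreover have "set_integrable lborel {0<..<len N j} (\<lambda>s. f (param N j s)) \<longleftrightarrow> set_integrable lborel {0..len N j} (\<lambda>s. f (param N j s))"
    by (rule set_integrable_discrete_difference[where X="{0, len N j}"]) auto
  ultimately show "integrable (edge_length_measure j) f"
    unfolding edge_length_measure_def integrable_distr_eq[OF param_measurable[OF j] m]
    by (simp add: integrable_restrict_space set_integrable_def)
  have "integral\<^sup>L (edge_length_measure j) f = (LBINT s:{0..len N j}. f (param N j s))"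
    unfolding edge_length_measure_def integral_distr[OF param_measurable[OF j] m]
    by (simp add: integral_restrict_space set_lebesgue_integral_def)
  also have "\<dots> = (LBINT s:{0<..<len N j}. f (param N j s))"
    using set_integral_Icc_eq_Ioo[of 0 "len N j"] L by simp
  also have "\<dots> = (LBINT s:{0<..<len N j}. g j s)"
    using g(2) by (intro set_lebesgue_integral_cong) auto
  finally show "integral\<^sup>L (edge_length_measure j) f = (LBINT s:{0<..<len N j}. g j s)" .
qed

lemma integral_length_measure:
  assumes f: "extends g f"
  shows "integrable (length_measure N) f"
    "integral\<^sup>L (length_measure N) f = (\<Sum>j\<in>edges N. LBINT s:{0<..<len N j}. g j s)"
proof -
  have m: "f \<in> borel_measurable (length_measure N)"
    using extends_borel_measurable[OF f] measurable_cong_sets[OF sets_length_measure refl] by blast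
  note * = integral_sum_of_measures[where I="edges N" and A=edge_length_measure, OF finite_edges _ _ m integral_edge_length_measure(1)[OF _ f]]
  show "integrable (length_measure N) f"
    by (rule *(1)) (auto simp: sets_edge_length_measure sets_length_measure emeasure_length_measure)
  have "integral\<^sup>L (length_measure N) f = (\<Sum>j\<in>edges N. integral\<^sup>L (edge_length_measure j) f)"
    by (rule *(2)) (auto simp: sets_edge_length_measure sets_length_measure emeasure_length_measure)
  then show "integral\<^sup>L (length_measure N) f = (\<Sum>j\<in>edges N. LBINT s:{0<..<len N j}. g j s)"
    using integral_edge_length_measure(2)[OF _ f] by simp
qed

lemma sets_net_measure: "sets (net_measure N \<gamma> \<eta> m) = sets borel_points"
  unfolding net_measure_def
  using sets.sigma_sets_eq[of borel_points] sets.space_closed[of borel_points]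
  by (simp add: space_borel_points)

lemma vert_in_points: "v \<in> verts N \<Longrightarrow> v \<in> points N"
  using incident_nonempty by (auto simp: incident_def points_def)

text \<open>
  The density part and the atoms are the summands of a finite sum of measures indexed by an option
  type, with \<open>None\<close> for the density part.
\<close>

lemma integral_net_measure:
  assumes m: "extends M m" "\<And>j s. j \<in> edges N \<Longrightarrow> s \<in> {0<..<len N j} \<Longrightarrow> 0 \<le> M j s"
    and T: "\<And>v. v \<in> inner_verts N \<Longrightarrow> 0 \<le> \<eta> v * common_value N \<gamma> v m"
    and f: "extends g f"
  shows "integrable (net_measure N \<gamma> \<eta> m) f"
    and "integral\<^sup>L (net_measure N \<gamma> \<eta> m) f = (\<Sum>j\<in>edges N. LBINT s:{0<..<len N j}. M j s * g j s) +
           (\<Sum>v\<in>inner_verts N. \<eta> v * common_value N \<gamma> v m * f v)"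
proof -
  let ?c = "\<lambda>v. \<eta> v * common_value N \<gamma> v m"
  let ?D = "density (length_measure N) (\<lambda>x. ennreal (m x))"
  define A where "A i = (case i of None \<Rightarrow> ?D | Some v \<Rightarrow> density (return borel_points v) (\<lambda>_. ennreal (?c v)))" for i
  let ?I = "insert None (Some ` inner_verts N)"
  have finv: "finite (inner_verts N)" using finite_verts by (simp add: inner_verts_def)
  have inp: "v \<in> points N" if "v \<in> inner_verts N" for v
    using that vert_in_points by (auto simp: inner_verts_def)
  have sumI: "(\<Sum>i\<in>?I. h i) = h None + (\<Sum>v\<in>inner_verts N. h (Some v))" for h :: "(real ^ 'd) option \<Rightarrow> 'z::comm_monoid_add"
    using finv by (simp add: sum.reindex)
  have sA: "sets (A i) = sets borel_points" for i
    by (cases i) (auto simp: A_def sets_length_measure)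
  have em: "emeasure (net_measure N \<gamma> \<eta> m) S = (\<Sum>i\<in>?I. emeasure (A i) S)" if "S \<in> sets borel_points" for S
    unfolding net_measure_def
  proof (rule emeasure_sum_of_measures[OF sA _ that, unfolded space_borel_points])
    fix S assume S: "S \<in> sets borel_points"
    show "emeasure ?D S + (\<Sum>v\<in>inner_verts N. ennreal (?c v) * indicator S v) = (\<Sum>i\<in>?I. emeasure (A i) S)"
      unfolding sumI using S by (simp add: A_def emeasure_density_const)
  qed
  have mm: "m \<in> borel_measurable (length_measure N)" and fm: "f \<in> borel_measurable (length_measure N)"
    "f \<in> borel_measurable (net_measure N \<gamma> \<eta> m)"
    and fm': "f \<in> borel_measurable borel_points"
    using extends_borel_measurable[OF m(1)] extends_borel_measurable[OF f]
      measurable_cong_sets[OF sets_length_measure refl] measurable_cong_sets[OF sets_net_measure refl] by blast+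
  \<comment> \<open>The density may be negative at the vertices; truncating it leaves the measure unchanged.\<close>
  have D: "?D = density (length_measure N) (\<lambda>x. ennreal (max 0 (m x)))"
    by (rule arg_cong2[where f=density]) (auto simp: max_def ennreal_neg)
  have ext: "extends (\<lambda>j s. M j s * g j s) (\<lambda>x. max 0 (m x) *\<^sub>R f x)"
    unfolding extends_def
  proof (intro ballI conjI)
    fix j assume j: "j \<in> edges N"
    show "continuous_on {0..len N j} (\<lambda>s. M j s * g j s)"
      using m f j by (intro continuous_intros) (auto simp: extends_def)
    fix s assume "s \<in> {0<..<len N j}"
    then show "on_edge N (\<lambda>x. max 0 (m x) *\<^sub>R f x) j s = M j s * g j s"
      using m(1) f j m(2)[OF j, of s] by (simp add: extends_def on_edge_def)
  qed
  have int: "integrable (A i) f \<and> integral\<^sup>L (A i) f =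
      (case i of None \<Rightarrow> \<Sum>j\<in>edges N. LBINT s:{0<..<len N j}. M j s * g j s | Some v \<Rightarrow> ?c v * f v)" if i: "i \<in> ?I" for i
  proof (cases i)
    case None
    have "integrable ?D f \<and> integral\<^sup>L ?D f = (\<Sum>j\<in>edges N. LBINT s:{0<..<len N j}. M j s * g j s)"
      unfolding D using integral_length_measure[OF ext] mm fm
      by (subst integrable_density integral_density; (subst integral_density)?; simp)
    then show ?thesis using None by (simp add: A_def)
  next
    case (Some v)
    then have v: "v \<in> inner_verts N" using i by auto
    let ?R = "return borel_points v"
    have mr: "h \<in> borel_measurable ?R" if "h \<in> borel_measurable borel_points" for h :: "real ^ 'd \<Rightarrow> real"
      using that by (simp add: measurable_cong_sets[OF sets_return refl])
    have vs: "v \<in> space borel_points" using inp[OF v] by (simp add: space_borel_points)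
    have I: "integrable ?R (\<lambda>x. ?c v *\<^sub>R f x)"
    proof -
      have h: "(\<lambda>x. ?c v *\<^sub>R f x) \<in> borel_measurable borel_points" using fm' by simp
      have "(\<integral>\<^sup>+x. ennreal (norm (?c v *\<^sub>R f x)) \<partial>?R) = ennreal (norm (?c v *\<^sub>R f v))"
        by (rule nn_integral_return[OF vs]) (use h in measurable)
      then have "(\<integral>\<^sup>+x. ennreal (norm (?c v *\<^sub>R f x)) \<partial>?R) < \<infinity>" by (simp only: infinity_ennreal_def ennreal_less_top)
      then show ?thesis using mr[OF h] by (intro integrableI_bounded)
    qed
    have "integrable (A i) f"
      unfolding Some A_def option.case
      by (subst integrable_density) (use mr[OF fm'] I T[OF v] in auto)
    moreover have "integral\<^sup>L (A i) f = integral\<^sup>L ?R (\<lambda>x. ?c v *\<^sub>R f x)"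
      unfolding Some A_def option.case
      by (subst integral_density) (use mr[OF fm'] T[OF v] in auto)
    moreover have "\<dots> = ?c v * f v"
      using integral_return[OF vs, of "\<lambda>x. ?c v *\<^sub>R f x"] fm' by simp
    ultimately show ?thesis using Some by simp
  qed
  have "integrable (net_measure N \<gamma> \<eta> m) f \<and>
    integral\<^sup>L (net_measure N \<gamma> \<eta> m) f = (\<Sum>i\<in>?I. integral\<^sup>L (A i) f)"
    using integral_sum_of_measures[where I="?I" and A=A and M="net_measure N \<gamma> \<eta> m" and f=f] em int fm finv
    by (simp add: sA sets_net_measure)
  moreover have "(\<Sum>i\<in>?I. integral\<^sup>L (A i) f) = (\<Sum>j\<in>edges N. LBINT s:{0<..<len N j}. M j s * g j s) +
      (\<Sum>v\<in>inner_verts N. ?c v * f v)"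
    unfolding sumI using int by simp
  ultimately show "integrable (net_measure N \<gamma> \<eta> m) f"
    and "integral\<^sup>L (net_measure N \<gamma> \<eta> m) f = (\<Sum>j\<in>edges N. LBINT s:{0<..<len N j}. M j s * g j s) +
           (\<Sum>v\<in>inner_verts N. ?c v * f v)" by simp_all
qed

lemma net_measure_prob:
  assumes m: "extends M m" "\<And>j s. j \<in> edges N \<Longrightarrow> s \<in> {0<..<len N j} \<Longrightarrow> 0 \<le> M j s"
    and T: "\<And>v. v \<in> inner_verts N \<Longrightarrow> 0 \<le> \<eta> v * common_value N \<gamma> v m"
    and one: "(\<Sum>j\<in>edges N. LBINT s:{0<..<len N j}. M j s) + (\<Sum>v\<in>inner_verts N. \<eta> v * common_value N \<gamma> v m) = 1"
  shows "net_measure N \<gamma> \<eta> m \<in> prob_measures N"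
proof -
  let ?M = "net_measure N \<gamma> \<eta> m"
  have ext: "extends (\<lambda>_ _. 1) (\<lambda>_. 1)" by (simp add: extends_def on_edge_def)
  have i: "integrable ?M (\<lambda>_. 1::real)" and v: "integral\<^sup>L ?M (\<lambda>_. 1::real) = 1"
    using integral_net_measure[OF m T ext] one by auto
  have "emeasure ?M (space ?M) = (\<integral>\<^sup>+x. ennreal 1 \<partial>?M)" by simp
  also have "\<dots> = ennreal (integral\<^sup>L ?M (\<lambda>_. 1::real))" by (rule nn_integral_eq_integral[OF i]) simp
  finally have "prob_space ?M" using v by (intro prob_spaceI) simp
  then show ?thesis using sets_net_measure by (simp add: prob_measures_def)
qed

end

section \<open>Regularity, propagation of zeros and the maximum principle\<close>

lemma set_integral_cong_AE_on:
  fixes f g :: "real \<Rightarrow> real"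
  assumes "set_borel_measurable lborel I f" "set_borel_measurable lborel I g"
    and "AE s in lborel. s \<in> I \<longrightarrow> f s = g s"
  shows "(LBINT s:I. f s) = (LBINT s:I. g s)"
  unfolding set_lebesgue_integral_def
proof (rule integral_cong_AE)
  show "AE s in lborel. indicator I s *\<^sub>R f s = indicator I s *\<^sub>R g s"
    using assms(3) by eventually_elim (auto simp: indicator_def)
qed (use assms in \<open>auto simp: set_borel_measurable_def\<close>)

lemma set_borel_measurable_mult:
  fixes f g :: "real \<Rightarrow> real"
  assumes "set_borel_measurable lborel I f" "set_borel_measurable lborel I g"
  shows "set_borel_measurable lborel I (\<lambda>s. f s * g s)"
proof -
  have "(\<lambda>s. (indicator I s *\<^sub>R f s) * (indicator I s *\<^sub>R g s)) \<in> borel_measurable lborel"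
    using assms unfolding set_borel_measurable_def by (rule borel_measurable_times)
  moreover have "(\<lambda>s. (indicator I s *\<^sub>R f s) * (indicator I s *\<^sub>R g s)) = (\<lambda>s. indicator I s *\<^sub>R (f s * g s))"
    by (auto simp: indicator_def)
  ultimately show ?thesis by (simp add: set_borel_measurable_def)
qed

lemma set_integrable_imp_measurable:
  "set_integrable lborel I f \<Longrightarrow> set_borel_measurable lborel I f"
  by (auto simp: set_integrable_def set_borel_measurable_def)

lemma derivative_at_left_end_nonneg:
  fixes g :: "real \<Rightarrow> real"
  assumes "(g has_real_derivative D) (at a within {a..b})" "a < b"
    and "\<And>s. s \<in> {a..b} \<Longrightarrow> g a \<le> g s"
  shows "0 \<le> D"
proof (rule ccontr)
  assume "\<not> 0 \<le> D"
  then obtain d where d: "d > 0" "\<And>h. h > 0 \<Longrightarrow> a + h \<in> {a..b} \<Longrightarrow> h < d \<Longrightarrow> g (a + h) < g a"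
    using has_real_derivative_neg_dec_right[OF assms(1)] by auto
  define h where "h = min (d / 2) (b - a)"
  have "h > 0" "a + h \<in> {a..b}" "h < d" using d assms(2) by (auto simp: h_def min_def)
  then show False using d(2)[of h] assms(3)[of "a + h"] by simp
qed

lemma derivative_at_right_end_nonpos:
  fixes g :: "real \<Rightarrow> real"
  assumes "(g has_real_derivative D) (at b within {a..b})" "a < b"
    and "\<And>s. s \<in> {a..b} \<Longrightarrow> g b \<le> g s"
  shows "D \<le> 0"
proof (rule ccontr)
  assume "\<not> D \<le> 0"
  then obtain d where d: "d > 0" "\<And>h. h > 0 \<Longrightarrow> b - h \<in> {a..b} \<Longrightarrow> h < d \<Longrightarrow> g (b - h) < g b"
    using has_real_derivative_pos_inc_left[OF assms(1)] by auto
  define h where "h = min (d / 2) (b - a)"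
  have "h > 0" "b - h \<in> {a..b}" "h < d" using d assms(2) by (auto simp: h_def min_def)
  then show False using d(2)[of h] assms(3)[of "b - h"] by simp
qed

lemma derivative_at_interior_min:
  fixes g :: "real \<Rightarrow> real"
  assumes "(g has_real_derivative D) (at s within {a..b})" "s \<in> {a<..<b}"
    and "\<And>t. t \<in> {a..b} \<Longrightarrow> g s \<le> g t"
  shows "D = 0"
proof -
  have "(g has_real_derivative D) (at s)"
    using assms(1,2) at_within_Icc_at[of a s b] by simp
  moreover have "0 < min (s - a) (b - s)" using assms(2) by simp
  moreover have "\<forall>t. \<bar>s - t\<bar> < min (s - a) (b - s) \<longrightarrow> g s \<le> g t"
    using assms(3) by (auto simp: abs_less_iff)
  ultimately show ?thesis by (rule DERIV_local_min)
qed

lemma linear_equation_zero: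
  fixes f B :: "real \<Rightarrow> real"
  assumes f: "\<And>s. s \<in> {a..b} \<Longrightarrow> (f has_real_derivative (- B s * f s) / \<mu>) (at s within {a..b})"
    and B: "continuous_on {a..b} B" and nonneg: "\<And>s. s \<in> {a..b} \<Longrightarrow> 0 \<le> f s"
    and s0: "s0 \<in> {a..b}" "f s0 = 0" and s: "s \<in> {a..b}"
  shows "f s = 0"
proof -
  have "bounded ((\<lambda>s. B s / \<mu>) ` {a..b})"
    unfolding divide_inverse by (intro compact_imp_bounded compact_continuous_image continuous_intros B compact_Icc)
  then obtain K where "\<forall>y\<in>(\<lambda>s. B s / \<mu>) ` {a..b}. norm y \<le> K" unfolding bounded_iff by blast
  then have K: "\<bar>B s / \<mu>\<bar> \<le> K" if "s \<in> {a..b}" for s using that by simp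
  have cf: "continuous_on {a..b} f" using f by (meson DERIV_continuous continuous_on_eq_continuous_within)
  have d: "(f has_real_derivative (- B s * f s) / \<mu>) (at s)" if "s \<in> {a<..<b}" for s
    using f[of s] that at_within_Icc_at[of a s b] by simp
  have "\<bar>(- B s * f s) / \<mu>\<bar> \<le> K * \<bar>f s\<bar>" if "s \<in> {a<..<b}" for s
    using mult_right_mono[OF K[of s], of "\<bar>f s\<bar>"] that by (simp add: abs_mult)
  then have bnd: "(- B s * f s) / \<mu> \<ge> - K * \<bar>f s\<bar> \<and> - ((- B s * f s) / \<mu>) \<ge> - K * \<bar>- f s\<bar>" if "s \<in> {a<..<b}" for s
    using that unfolding abs_le_iff abs_minus_cancel by force
  show ?thesis
  proof (cases "s \<ge> s0")
    case True
    have "- f s \<ge> 0"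
      by (rule differential_inequality_sign(1)[where v="\<lambda>s. - f s" and a=a and b=b and K=K and ?s0.0=s0
            and v'="\<lambda>s. - ((- B s * f s) / \<mu>)"])
        (use cf DERIV_minus[OF d] bnd s0 s True in \<open>auto intro!: continuous_intros\<close>)
    then show ?thesis using nonneg[OF s] by simp
  next
    case False
    have "f s \<le> 0"
      by (rule differential_inequality_sign(2)[where v=f and a=a and b=b and K=K and ?s0.0=s0
            and v'="\<lambda>s. (- B s * f s) / \<mu>"])
        (use cf d bnd s0 s False in auto)
    then show ?thesis using nonneg[OF s] by simp
  qed
qed

context geometric_network
begin

text \<open>
  The value at the endpoint \<open>v\<close> of an edge, with the sign that the outward direction has there:
  the outward derivative if \<open>f\<close> is a derivative, the outgoing flux if \<open>f\<close> is a constant flux.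
\<close>

definition outflow :: "('e \<Rightarrow> real \<Rightarrow> real) \<Rightarrow> 'e \<Rightarrow> real ^ 'd \<Rightarrow> real" where
  "outflow f j v = (if v = src N j then - f j 0 else f j (len N j))"

lemma sum_of_vertex_differences:
  "(\<Sum>j\<in>edges N. f j (len N j) - f j 0) = (\<Sum>v\<in>verts N. \<Sum>j\<in>incident N v. outflow f j v)"
  using sum_over_edge_ends[of "\<lambda>j. - f j 0" "\<lambda>j. f j (len N j)"] by (simp add: outflow_def)

lemma kirchhoff_at_vertices:
  assumes K: "\<And>W. (\<Sum>j\<in>edges N. c j * (W (tgt N j) - W (src N j))) = (0::real)" and v: "v \<in> verts N"
  shows "(\<Sum>j\<in>incident N v. outflow (\<lambda>j s. c j) j v) = 0"
proof -
  have "(\<Sum>j\<in>incident N v. outflow (\<lambda>j s. c j) j v) =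
      (\<Sum>j\<in>edges N. if v \<in> seg N j then outflow (\<lambda>j s. c j) j v else 0)"
    unfolding incident_def using finite_edges by (rule sum.inter_filter)
  also have "\<dots> = (\<Sum>j\<in>edges N. c j * (indicator {v} (tgt N j) - indicator {v} (src N j)))"
  proof (rule sum.cong[OF refl])
    fix j assume j: "j \<in> edges N"
    have "v \<in> seg N j \<longleftrightarrow> v = src N j \<or> v = tgt N j" using verts_on_edge[OF j] v by blast
    then show "(if v \<in> seg N j then outflow (\<lambda>j s. c j) j v else 0) = c j * (indicator {v} (tgt N j) - indicator {v} (src N j))"
      using src_neq_tgt[OF j] by (auto simp: outflow_def indicator_def)
  qed
  also have "\<dots> = 0" by (rule K)
  finally show ?thesis .
qed

text \<open>
  The function \<open>f\<close> satisfies \<open>\<mu> f' + B f = c\<close>. A zero inside an edge is a minimum, so \<open>f' = 0\<close> and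
  hence \<open>c = 0\<close> there; the equation is then homogeneous and \<open>f\<close> vanishes on the edge. A zero at a
  vertex is shared by all incident edges because of the compatibility condition
  (a boundary vertex has only one edge); as \<open>f \<ge> 0\<close>, all outgoing
  fluxes are nonpositive, and being balanced they vanish.
\<close>

lemma nonneg_solution_zero_propagates:
  fixes f B :: "'e \<Rightarrow> real \<Rightarrow> real"
  assumes f: "\<And>j s. j \<in> edges N \<Longrightarrow> s \<in> {0..len N j} \<Longrightarrow>
      (f j has_real_derivative (c j - B j s * f j s) / \<mu> j) (at s within {0..len N j})"
    and B: "\<And>j. j \<in> edges N \<Longrightarrow> continuous_on {0..len N j} (B j)"
    and \<mu>: "\<And>j. j \<in> edges N \<Longrightarrow> 0 < \<mu> j"
    and nonneg: "\<And>j s. j \<in> edges N \<Longrightarrow> s \<in> {0..len N j} \<Longrightarrow> 0 \<le> f j s"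
    and K: "\<And>v. v \<in> verts N \<Longrightarrow> (\<Sum>j\<in>incident N v. outflow (\<lambda>j s. c j) j v) = 0"
    and \<gamma>: "\<And>v j. v \<in> inner_verts N \<Longrightarrow> j \<in> incident N v \<Longrightarrow> 0 < \<gamma> v j"
    and comp: "\<And>v j j'. v \<in> inner_verts N \<Longrightarrow> j \<in> incident N v \<Longrightarrow> j' \<in> incident N v \<Longrightarrow>
      vertex_value f j v / \<gamma> v j = vertex_value f j' v / \<gamma> v j'"
    and zero: "j\<^sub>0 \<in> edges N" "s\<^sub>0 \<in> {0..len N j\<^sub>0}" "f j\<^sub>0 s\<^sub>0 = 0"
    and j: "j \<in> edges N" and s: "s \<in> {0..len N j}"
  shows "f j s = 0"
proof -
  have edge: "f j t = 0" if "j \<in> edges N" "c j = 0" "s \<in> {0..len N j}" "f j s = 0" "t \<in> {0..len N j}" for j s t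
    by (rule linear_equation_zero[where f="f j" and B="B j" and \<mu>="\<mu> j" and a=0 and b="len N j", OF _ B nonneg that(3,4,5)])
      (use f[OF that(1)] that(1,2) in auto)
  define A where "A = {j \<in> edges N. \<forall>s\<in>{0..len N j}. f j s = 0}"
  have vertex: "j' \<in> A" if v: "v \<in> verts N" and j: "j \<in> incident N v" "vertex_value f j v = 0" and j': "j' \<in> incident N v" for v j j'
  proof -
    have z: "vertex_value f i v = 0" if i: "i \<in> incident N v" for i
    proof (cases "v \<in> boundary_verts N")
      case True
      then show ?thesis using boundary_vert_incident_unique[OF True j(1) i] j(2) by simp
    next
      case False
      then have "v \<in> inner_verts N" using v by (simp add: inner_verts_def)
      then show ?thesis using comp[of v j i] j i \<gamma>[of v i] by simp
    qed
    have sgn: "0 \<le> - outflow (\<lambda>j s. c j) i v" if i: "i \<in> incident N v" for i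
    proof -
      have e: "i \<in> edges N" "v = src N i \<or> v = tgt N i" using i incident_iff[OF v] by auto
      have L: "0 < len N i" using len_pos[OF e(1)] .
      show ?thesis
      proof (cases "v = src N i")
        case True
        then have f0: "f i 0 = 0" using z[OF i] by (simp add: vertex_value_def)
        have "0 \<le> (c i - B i 0 * f i 0) / \<mu> i"
          by (rule derivative_at_left_end_nonneg[OF f]) (use e L f0 nonneg in auto)
        then show ?thesis using True f0 \<mu>[OF e(1)] by (simp add: outflow_def zero_le_divide_iff)
      next
        case False
        then have f0: "f i (len N i) = 0" using z[OF i] by (simp add: vertex_value_def)
        have "(c i - B i (len N i) * f i (len N i)) / \<mu> i \<le> 0"
          by (rule derivative_at_right_end_nonpos[OF f]) (use e L f0 nonneg in auto)
        then show ?thesis using False f0 \<mu>[OF e(1)] by (simp add: outflow_def divide_le_0_iff)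
      qed
    qed
    have "(\<Sum>j\<in>incident N v. - outflow (\<lambda>j s. c j) j v) = 0" using K[OF v] by (simp add: sum_negf)
    then have "- outflow (\<lambda>j s. c j) j' v = 0"
      using sum_nonneg_eq_0_iff[OF finite_incident, of v "\<lambda>j. - outflow (\<lambda>j s. c j) j v"] sgn j' by blast
    then have c0: "c j' = 0" by (simp add: outflow_def split: if_splits)
    have j'e: "j' \<in> edges N" using j' by (simp add: incident_def)
    obtain t where "t \<in> {0..len N j'}" "f j' t = 0"
    proof (cases "v = src N j'")
      case True
      then show ?thesis using that[of 0] z[OF j'] len_pos[OF j'e] by (simp add: vertex_value_def)
    next
      case False
      then show ?thesis using that[of "len N j'"] z[OF j'] len_pos[OF j'e] by (simp add: vertex_value_def)
    qed
    then have "\<forall>s\<in>{0..len N j'}. f j' s = 0" using edge[OF j'e c0] by blast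
    then show ?thesis using j'e by (simp add: A_def)
  qed
  have "j\<^sub>0 \<in> A"
  proof -
    consider "s\<^sub>0 = 0" | "s\<^sub>0 = len N j\<^sub>0" | "s\<^sub>0 \<in> {0<..<len N j\<^sub>0}" using zero(2) by force
    then show ?thesis
    proof cases
      case 1
      then show ?thesis using vertex[of "src N j\<^sub>0" j\<^sub>0 j\<^sub>0] zero src_vert incident_iff by (auto simp: vertex_value_def)
    next
      case 2
      then show ?thesis using vertex[of "tgt N j\<^sub>0" j\<^sub>0 j\<^sub>0] zero tgt_vert incident_iff src_neq_tgt[of j\<^sub>0] by (auto simp: vertex_value_def)
    next
      case 3
      have "(c j\<^sub>0 - B j\<^sub>0 s\<^sub>0 * f j\<^sub>0 s\<^sub>0) / \<mu> j\<^sub>0 = 0"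
        by (rule derivative_at_interior_min[OF f 3]) (use zero nonneg in auto)
      then have "c j\<^sub>0 = 0" using zero \<mu>[OF zero(1)] by simp
      then show ?thesis using edge[OF zero(1) _ zero(2,3)] zero(1) by (auto simp: A_def)
    qed
  qed
  moreover have "A \<subseteq> edges N" by (auto simp: A_def)
  moreover have "j' \<in> A" if "j \<in> A" "v \<in> verts N" "j \<in> incident N v" "j' \<in> incident N v" for j j' v
  proof (rule vertex[OF that(2,3) _ that(4)])
    show "vertex_value f j v = 0" using that(1) len_pos[of j] by (auto simp: A_def vertex_value_def)
  qed
  ultimately have "A = edges N" by (intro edge_propagation) auto
  then have "j \<in> A" using j by simp
  then show ?thesis using s unfolding A_def by blast
qed

text \<open>
  At a maximum inside an edge \<open>w' = 0\<close>. At a maximum in a vertex all outward derivatives are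
  nonnegative, and the flux condition forces them to vanish. From such a point the inequality
  \<open>w'' \<ge> - K \<bar>w'\<bar>\<close> makes \<open>w\<close> nondecreasing when moving away, so that \<open>w\<close> is maximal on the whole edge;
  on an edge where \<open>w\<close> is constant the inequality leaves no room for \<open>r > 0\<close>.
\<close>

lemma strong_maximum_principle:
  fixes w w' w'' :: "'e \<Rightarrow> real \<Rightarrow> real"
  assumes ne: "edges N \<noteq> {}"
    and w: "\<And>j s. j \<in> edges N \<Longrightarrow> s \<in> {0..len N j} \<Longrightarrow>
      (w j has_real_derivative w' j s) (at s within {0..len N j})"
    and w': "\<And>j s. j \<in> edges N \<Longrightarrow> s \<in> {0..len N j} \<Longrightarrow>
      (w' j has_real_derivative w'' j s) (at s within {0..len N j})"
    and ineq: "\<And>j s. j \<in> edges N \<Longrightarrow> s \<in> {0<..<len N j} \<Longrightarrow> w'' j s \<ge> - K j * \<bar>w' j s\<bar> + r j"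
    and r: "\<And>j. j \<in> edges N \<Longrightarrow> 0 \<le> r j"
    and W: "\<And>j. j \<in> edges N \<Longrightarrow> w j 0 = W (src N j)" "\<And>j. j \<in> edges N \<Longrightarrow> w j (len N j) = W (tgt N j)"
    and k: "\<And>v j. v \<in> verts N \<Longrightarrow> j \<in> incident N v \<Longrightarrow> 0 < k v j"
    and flux: "\<And>v. v \<in> verts N \<Longrightarrow> (\<Sum>j\<in>incident N v. k v j * outflow w' j v) \<le> 0"
  shows "\<exists>X. \<forall>j\<in>edges N. \<forall>s\<in>{0..len N j}. w j s = X" and "j \<in> edges N \<Longrightarrow> r j = 0"
proof -
  have cw: "continuous_on {0..len N j} (w j)" and cw': "continuous_on {0..len N j} (w' j)" if "j \<in> edges N" for j
    using w[OF that] w'[OF that] by (meson DERIV_continuous continuous_on_eq_continuous_within)+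
  have "\<exists>s\<in>{0..len N j}. \<forall>t\<in>{0..len N j}. w j t \<le> w j s" if "j \<in> edges N" for j
    using continuous_attains_sup[OF compact_Icc _ cw[OF that]] len_pos[OF that] by simp
  then obtain p where p: "\<And>j. j \<in> edges N \<Longrightarrow> p j \<in> {0..len N j}"
    "\<And>j t. j \<in> edges N \<Longrightarrow> t \<in> {0..len N j} \<Longrightarrow> w j t \<le> w j (p j)" by metis
  define X where "X = Max ((\<lambda>j. w j (p j)) ` edges N)"
  have X: "w j s \<le> X" if "j \<in> edges N" "s \<in> {0..len N j}" for j s
  proof (rule order_trans[OF p(2)[OF that]])
    show "w j (p j) \<le> X" unfolding X_def by (rule Max_ge) (use finite_edges that in auto)
  qed
  have "X \<in> (\<lambda>j. w j (p j)) ` edges N" unfolding X_def using ne finite_edges by (intro Max_in) auto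
  then obtain j\<^sub>0 where j\<^sub>0: "j\<^sub>0 \<in> edges N" "w j\<^sub>0 (p j\<^sub>0) = X" by auto
  define A where "A = {j \<in> edges N. \<forall>s\<in>{0..len N j}. w j s = X}"
  have edge: "j \<in> A" if j: "j \<in> edges N" and s: "s \<in> {0..len N j}" "w j s = X" "w' j s = 0" for j s
  proof -
    have d: "(w j has_real_derivative w' j t) (at t)" "(w' j has_real_derivative w'' j t) (at t)" if "t \<in> {0<..<len N j}" for t
      using w[OF j, of t] w'[OF j, of t] that at_within_Icc_at[of 0 t "len N j"] by auto
    have i: "w'' j t \<ge> - K j * \<bar>w' j t\<bar>" if "t \<in> {0<..<len N j}" for t
      using ineq[OF j that] r[OF j] by simp
    note sgn = differential_inequality_sign[OF cw'[OF j] d(2) i s(1,3)]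
    have "w j t = X" if t: "t \<in> {0..len N j}" for t
    proof (rule antisym[OF X[OF j t]])
      show "X \<le> w j t"
      proof (cases "s \<le> t")
        case True
        have "w j s \<le> w j t"
        proof (rule DERIV_nonneg_imp_increasing_open[OF True])
          fix x assume "s < x" "x < t"
          then show "\<exists>y. (w j has_real_derivative y) (at x) \<and> 0 \<le> y"
            using d(1)[of x] sgn(1)[of x] s(1) t by auto
        qed (rule continuous_on_subset[OF cw[OF j]], use s(1) t in auto)
        then show ?thesis using s by simp
      next
        case False
        then have le: "t \<le> s" by simp
        have "w j s \<le> w j t"
        proof (rule DERIV_nonpos_imp_decreasing_open[OF le])
          fix x assume "t < x" "x < s"
          then show "\<exists>y. (w j has_real_derivative y) (at x) \<and> y \<le> 0"
            using d(1)[of x] sgn(2)[of x] s(1) t by auto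
        qed (rule continuous_on_subset[OF cw[OF j]], use s(1) t in auto)
        then show ?thesis using s by simp
      qed
    qed
    then show ?thesis using j by (simp add: A_def)
  qed
  have max': "(\<lambda>t. - w j t) s \<le> - w j t" if "j \<in> edges N" "w j s = X" "t \<in> {0..len N j}" for j s t
    using X that by simp
  have neg: "((\<lambda>t. - w j t) has_real_derivative - w' j s) (at s within {0..len N j})"
    if "j \<in> edges N" "s \<in> {0..len N j}" for j s
    using w[OF that] by (rule DERIV_minus)
  have vertex: "j' \<in> A" if v: "v \<in> verts N" and j: "W v = X" and j': "j' \<in> incident N v" for v j'
  proof -
    have sgn: "0 \<le> k v i * outflow w' i v" if i: "i \<in> incident N v" for i
    proof -
      have e: "i \<in> edges N" "v = src N i \<or> v = tgt N i" using i incident_iff[OF v] by auto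
      have L: "0 < len N i" using len_pos[OF e(1)] .
      have "0 \<le> outflow w' i v"
      proof (cases "v = src N i")
        case True
        have "0 \<le> - w' i 0"
          by (rule derivative_at_left_end_nonneg[OF neg]) (use e L max'[OF e(1), of 0] W j True in auto)
        then show ?thesis using True by (simp add: outflow_def)
      next
        case False
        have "- w' i (len N i) \<le> 0"
          by (rule derivative_at_right_end_nonpos[OF neg]) (use e L max'[OF e(1), of "len N i"] W j False in auto)
        then show ?thesis using False by (simp add: outflow_def)
      qed
      then show ?thesis using k[OF v i] by simp
    qed
    have "(\<Sum>j\<in>incident N v. k v j * outflow w' j v) = 0"
      using flux[OF v] sum_nonneg[of "incident N v" "\<lambda>j. k v j * outflow w' j v"] sgn by simp
    then have "k v j' * outflow w' j' v = 0"
      using sum_nonneg_eq_0_iff[OF finite_incident, of v "\<lambda>j. k v j * outflow w' j v"] sgn j' by blast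
    then have o0: "outflow w' j' v = 0" using k[OF v j'] by simp
    have e: "j' \<in> edges N" "v = src N j' \<or> v = tgt N j'" using j' incident_iff[OF v] by auto
    show ?thesis
    proof (cases "v = src N j'")
      case True
      then show ?thesis using edge[OF e(1), of 0] o0 W(1)[OF e(1)] j len_pos[OF e(1)] by (simp add: outflow_def)
    next
      case False
      then show ?thesis using edge[OF e(1), of "len N j'"] o0 W(2)[OF e(1)] j len_pos[OF e(1)] e(2) by (simp add: outflow_def)
    qed
  qed
  have "j\<^sub>0 \<in> A"
  proof -
    consider "p j\<^sub>0 = 0" | "p j\<^sub>0 = len N j\<^sub>0" | "p j\<^sub>0 \<in> {0<..<len N j\<^sub>0}" using p(1)[OF j\<^sub>0(1)] by force
    then show ?thesis
    proof cases
      case 1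
      then show ?thesis using vertex[of "src N j\<^sub>0" j\<^sub>0] j\<^sub>0 W src_vert incident_iff by simp
    next
      case 2
      then show ?thesis using vertex[of "tgt N j\<^sub>0" j\<^sub>0] j\<^sub>0 W tgt_vert incident_iff by simp
    next
      case 3
      have "- w' j\<^sub>0 (p j\<^sub>0) = 0"
        by (rule derivative_at_interior_min[OF neg 3]) (use j\<^sub>0 p(1) max' in auto)
      then show ?thesis using edge[OF j\<^sub>0(1) p(1)[OF j\<^sub>0(1)] j\<^sub>0(2)] by simp
    qed
  qed
  moreover have "A \<subseteq> edges N" by (auto simp: A_def)
  moreover have "j' \<in> A" if "j \<in> A" "v \<in> verts N" "j \<in> incident N v" "j' \<in> incident N v" for j j' v
  proof (rule vertex[OF that(2) _ that(4)])
    show "W v = X"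
      using that(1,3) W[of j] incident_iff[OF that(2)] len_pos[of j] by (force simp: A_def)
  qed
  ultimately have A: "A = edges N" by (intro edge_propagation) auto
  then show "\<exists>X. \<forall>j\<in>edges N. \<forall>s\<in>{0..len N j}. w j s = X" by (auto simp: A_def)
  assume j: "j \<in> edges N"
  then have "j \<in> A" using A by simp
  then have const: "w j s = X" if "s \<in> {0..len N j}" for s using that unfolding A_def by blast
  have z1: "w' j s = 0" if s: "s \<in> {0<..<len N j}" for s
    by (rule derivative_at_interior_min[OF w s]) (use j s const in auto)
  define s where "s = len N j / 2"
  have s: "s \<in> {0<..<len N j}" using len_pos[OF j] by (simp add: s_def)
  have "(w' j has_real_derivative w'' j s) (at s)"
    using w'[OF j, of s] s at_within_Icc_at[of 0 s "len N j"] by auto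
  then have "((\<lambda>_. 0) has_real_derivative w'' j s) (at s)"
    by (rule has_field_derivative_transform_within_open[where S="{0<..<len N j}"]) (use s z1 in auto)
  then have "w'' j s = 0" by (metis DERIV_const DERIV_unique)
  then show "r j = 0" using ineq[OF j s] r[OF j] z1[OF s] by simp
qed

text \<open>
  Testing with functions supported in one edge gives a constant flux \<open>c j\<close> by the du Bois-Reymond
  lemma. Testing with the function that is affine on every edge and has prescribed vertex values
  \<open>W\<close> then gives the balance of fluxes at the vertices, summed against \<open>W\<close>.
\<close>

lemma weak_FP_solution_is_classical:
  assumes FP: "FP_weak_solution N \<mu> \<gamma> \<eta> b m"
    and \<mu>: "\<And>j. j \<in> edges N \<Longrightarrow> 0 < \<mu> j"
    and B: "\<And>j. j \<in> edges N \<Longrightarrow> continuous_on {0..len N j} (B j)"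
      "\<And>j s. j \<in> edges N \<Longrightarrow> s \<in> {0<..<len N j} \<Longrightarrow> b j s = B j s"
  obtains M c where "extends M m"
    "\<And>j s. j \<in> edges N \<Longrightarrow> s \<in> {0..len N j} \<Longrightarrow>
      (M j has_real_derivative (c j - B j s * M j s) / \<mu> j) (at s within {0..len N j})"
    "\<And>W. (\<Sum>j\<in>edges N. c j * (W (tgt N j) - W (src N j))) = 0"
proof -
  have mV: "m \<in> W12 N" "m \<in> PC N" using FP by (auto simp: FP_weak_solution_def V12_gamma_def)
  obtain M where M: "\<And>j. j \<in> edges N \<Longrightarrow> continuous_on {0..len N j} (M j)"
    "\<And>j s. j \<in> edges N \<Longrightarrow> s \<in> {0<..<len N j} \<Longrightarrow> on_edge N m j s = M j s"
    using PC_family_extension[of "on_edge N m"] mV(2) by (auto simp: PC_def)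
  define D where "D j = weak_deriv N m j" for j
  have D: "has_L2_weak_deriv {0<..<len N j} (on_edge N m j) (D j)" if "j \<in> edges N" for j
    unfolding D_def by (rule weak_deriv_W12[OF mV(1) that])
  define h where "h j s = \<mu> j * D j s + B j s * M j s" for j s
  have Di: "set_integrable lborel {0<..<len N j} (D j)" if "j \<in> edges N" for j
    using D[OF that] L2_on_imp_set_integrable by (auto simp: has_L2_weak_deriv_def)
  have hi: "set_integrable lborel {0<..<len N j} (h j)" if "j \<in> edges N" for j
    unfolding h_def
    by (intro set_integral_add set_integrable_mult_right continuous_imp_L2_on continuous_intros Di B M that)
  have key: "(\<Sum>j\<in>edges N. LBINT s:{0<..<len N j}. h j s * g' j s) = 0"
    if g: "\<And>j s. j \<in> edges N \<Longrightarrow> s \<in> {0..len N j} \<Longrightarrow> (g j has_real_derivative g' j s) (at s within {0..len N j})"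
      "\<And>j. j \<in> edges N \<Longrightarrow> continuous_on {0..len N j} (g' j)"
      "\<And>j. j \<in> edges N \<Longrightarrow> g j 0 = W (src N j)" "\<And>j. j \<in> edges N \<Longrightarrow> g j (len N j) = W (tgt N j)" for g g' W
  proof -
    obtain w where w: "w \<in> V12 N"
      "\<And>j. j \<in> edges N \<Longrightarrow> AE s in lborel. s \<in> {0<..<len N j} \<longrightarrow> weak_deriv N w j s = g' j s"
      by (rule glue_C1_edge_functions[where g=g and g'=g' and W=W, OF g]) (assumption | rule that)+
    have w12: "w \<in> W12 N" using w(1) by (simp add: V12_def)
    have "(LBINT s:{0<..<len N j}. \<mu> j * weak_deriv N m j s * weak_deriv N w j s +
        b j s * on_edge N m j s * weak_deriv N w j s) = (LBINT s:{0<..<len N j}. h j s * g' j s)"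
      if j: "j \<in> edges N" for j
    proof -
      have "(LBINT s:{0<..<len N j}. \<mu> j * weak_deriv N m j s * weak_deriv N w j s +
          b j s * on_edge N m j s * weak_deriv N w j s) = (LBINT s:{0<..<len N j}. h j s * weak_deriv N w j s)"
        using M(2)[OF j] B(2)[OF j] by (intro set_lebesgue_integral_cong) (auto simp: h_def D_def algebra_simps)
      also have "\<dots> = (LBINT s:{0<..<len N j}. h j s * g' j s)"
      proof (rule set_integral_cong_AE_on)
        have "set_borel_measurable lborel {0<..<len N j} (weak_deriv N w j)"
          using weak_deriv_W12[OF w12 j] by (simp add: has_L2_weak_deriv_def L2_on_def)
        then show "set_borel_measurable lborel {0<..<len N j} (\<lambda>s. h j s * weak_deriv N w j s)"
          by (intro set_borel_measurable_mult set_integrable_imp_measurable[OF hi[OF j]])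
        show "set_borel_measurable lborel {0<..<len N j} (\<lambda>s. h j s * g' j s)"
          by (rule set_integrable_imp_measurable[OF set_integrable_mult_continuous[OF hi[OF j] g(2)[OF j]]])
        show "AE s in lborel. s \<in> {0<..<len N j} \<longrightarrow> h j s * weak_deriv N w j s = h j s * g' j s"
          using w(2)[OF j] by eventually_elim auto
      qed
      finally show ?thesis .
    qed
    note eq = this
    have "\<forall>w\<in>V12 N. net_integral N (\<lambda>j s. \<mu> j * weak_deriv N m j s * weak_deriv N w j s +
        b j s * on_edge N m j s * weak_deriv N w j s) = 0"
      using FP unfolding FP_weak_solution_def by (elim conjE)
    then have "(\<Sum>j\<in>edges N. LBINT s:{0<..<len N j}. \<mu> j * weak_deriv N m j s * weak_deriv N w j s +
        b j s * on_edge N m j s * weak_deriv N w j s) = 0"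
      using w(1) unfolding net_integral_def by blast
    moreover have "(\<Sum>j\<in>edges N. LBINT s:{0<..<len N j}. h j s * g' j s) =
        (\<Sum>j\<in>edges N. LBINT s:{0<..<len N j}. \<mu> j * weak_deriv N m j s * weak_deriv N w j s +
        b j s * on_edge N m j s * weak_deriv N w j s)"
      by (rule sum.cong[OF refl]) (rule eq[symmetric])
    ultimately show ?thesis by simp
  qed
  have "\<exists>c. AE s in lborel. s \<in> {0<..<len N j} \<longrightarrow> h j s = c" if j: "j \<in> edges N" for j
  proof (rule du_bois_reymond[OF len_pos[OF j] hi[OF j]])
    fix \<phi> assume \<phi>: "\<phi> \<in> test_functions {0<..<len N j}"
    obtain p q where pq: "0 < p" "p \<le> q" "q < len N j" "\<And>s. s \<notin> {p..q} \<Longrightarrow> \<phi> s = 0"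
      using test_function_support[OF \<phi> len_pos[OF j]] by metis
    have ends: "\<phi> 0 = 0" "\<phi> (len N j) = 0" using pq(1-3) pq(4)[of 0] pq(4)[of "len N j"] by auto
    have "(\<Sum>j'\<in>edges N. LBINT s:{0<..<len N j'}. h j' s * (if j' = j then deriv \<phi> s else 0)) = 0"
    proof (rule key[where g="\<lambda>j' s. if j' = j then \<phi> s else 0" and W="\<lambda>_. 0"])
      fix j' s
      show "((\<lambda>s. if j' = j then \<phi> s else 0) has_real_derivative (if j' = j then deriv \<phi> s else 0)) (at s within {0..len N j'})"
        using has_field_derivative_at_within[OF test_function_derivative(1)[OF \<phi>]] by simp
      show "continuous_on {0..len N j'} (\<lambda>s. if j' = j then deriv \<phi> s else 0)"
        using test_function_derivative(2)[OF \<phi>] by (cases "j' = j") simp_all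
    qed (use ends in auto)
    moreover have "(\<Sum>j'\<in>edges N. LBINT s:{0<..<len N j'}. h j' s * (if j' = j then deriv \<phi> s else 0)) =
       (\<Sum>j'\<in>edges N. if j' = j then LBINT s:{0<..<len N j}. h j s * deriv \<phi> s else 0)"
      by (intro sum.cong) auto
    ultimately show "(LBINT s:{0<..<len N j}. h j s * deriv \<phi> s) = 0"
      using j finite_edges by simp
  qed
  then obtain c where c: "\<And>j. j \<in> edges N \<Longrightarrow> AE s in lborel. s \<in> {0<..<len N j} \<longrightarrow> h j s = c j" by metis
  show ?thesis
  proof (rule that[of M c])
    show "extends M m" using M by (simp add: extends_def)
    show "(M j has_real_derivative (c j - B j s * M j s) / \<mu> j) (at s within {0..len N j})"
      if j: "j \<in> edges N" and s: "s \<in> {0..len N j}" for j s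
    proof (rule weak_equation_holds_classically[OF len_pos[OF j] D[OF j] M(1)[OF j] M(2)[OF j] _ _ s])
      show "continuous_on {0..len N j} (\<lambda>s. (c j - B j s * M j s) / \<mu> j)"
        using \<mu>[OF j] by (intro continuous_intros B M j) auto
      show "AE s in lborel. s \<in> {0<..<len N j} \<longrightarrow> D j s = (c j - B j s * M j s) / \<mu> j"
        using c[OF j] by eventually_elim (use \<mu>[OF j] in \<open>auto simp: h_def field_simps\<close>)
    qed
    show "(\<Sum>j\<in>edges N. c j * (W (tgt N j) - W (src N j))) = 0" for W
    proof -
      let ?k = "\<lambda>j. (W (tgt N j) - W (src N j)) / len N j"
      have "(\<Sum>j\<in>edges N. LBINT s:{0<..<len N j}. h j s * ?k j) = 0"
      proof (rule key[where g="\<lambda>j s. W (src N j) + s * ?k j" and W=W])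
        fix j assume j: "j \<in> edges N"
        show "W (src N j) + len N j * ?k j = W (tgt N j)" using len_pos[OF j] by simp
      qed (auto intro!: derivative_eq_intros dest: len_pos)
      moreover have "(LBINT s:{0<..<len N j}. h j s * ?k j) = c j * (W (tgt N j) - W (src N j))" if j: "j \<in> edges N" for j
      proof -
        have "(LBINT s:{0<..<len N j}. h j s) = (LBINT s:{0<..<len N j}. c j)"
          using c[OF j] by (intro set_integral_cong_AE_on set_integrable_imp_measurable hi[OF j] continuous_imp_L2_on(2)) auto
        also have "\<dots> = c j * len N j - c j * 0"
          using len_pos[OF j] by (intro integral_derivative) (auto intro!: derivative_eq_intros)
        finally show ?thesis using len_pos[OF j] by simp
      qed
      ultimately show ?thesis by simp
    qed
  qed
qed

end

section \<open>Classical solutions of the Fokker--Planck problem\<close>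

lemma continuous_nonneg_on_closure:
  fixes f :: "real \<Rightarrow> real"
  assumes "a < b" "continuous_on {a..b} f" "\<And>s. s \<in> {a<..<b} \<Longrightarrow> 0 \<le> f s" "s \<in> {a..b}"
  shows "0 \<le> f s"
  using continuous_ge_on_closure[of "{a<..<b}" f s 0] assms by (simp add: closure_greaterThanLessThan)

context geometric_network
begin

lemma verts_cases: "verts N = inner_verts N \<union> boundary_verts N" "inner_verts N \<inter> boundary_verts N = {}"
  by (auto simp: inner_verts_def boundary_verts_def)

lemma sum_verts:
  "(\<Sum>v\<in>verts N. g v) = (\<Sum>v\<in>inner_verts N. g v) + (\<Sum>v\<in>boundary_verts N. g v)" for g :: "_ \<Rightarrow> real"
  using finite_verts unfolding verts_cases(1) by (intro sum.union_disjoint verts_cases(2)) auto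

text \<open>
  What remains of a weak solution after regularity: \<open>M\<close> extends \<open>m\<close> to the closed edges, and \<open>c j\<close> is
  the constant flux along the edge \<open>j\<close>.
\<close>

definition classical_FP where
  "classical_FP \<mu> \<gamma> \<eta> B m M c \<longleftrightarrow>
     extends M m \<and>
     (\<forall>j\<in>edges N. \<forall>s\<in>{0..len N j}.
        (M j has_real_derivative (c j - B j s * M j s) / \<mu> j) (at s within {0..len N j}) \<and> 0 \<le> M j s) \<and>
     (\<forall>W. (\<Sum>j\<in>edges N. c j * (W (tgt N j) - W (src N j))) = 0) \<and>
     (\<forall>v\<in>inner_verts N. 0 \<le> common_value N \<gamma> v m \<and>
        (\<forall>j\<in>incident N v. vertex_value M j v = \<gamma> v j * common_value N \<gamma> v m)) \<and>
     (\<Sum>j\<in>edges N. LBINT s:{0<..<len N j}. M j s) + (\<Sum>v\<in>inner_verts N. \<eta> v * common_value N \<gamma> v m) = 1"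

lemma classical_FPD:
  assumes "classical_FP \<mu> \<gamma> \<eta> B m M c"
  shows "extends M m"
    and "\<And>j s. j \<in> edges N \<Longrightarrow> s \<in> {0..len N j} \<Longrightarrow>
        (M j has_real_derivative (c j - B j s * M j s) / \<mu> j) (at s within {0..len N j})"
    and "\<And>j s. j \<in> edges N \<Longrightarrow> s \<in> {0..len N j} \<Longrightarrow> 0 \<le> M j s"
    and "\<And>W. (\<Sum>j\<in>edges N. c j * (W (tgt N j) - W (src N j))) = 0"
    and "\<And>v. v \<in> inner_verts N \<Longrightarrow> 0 \<le> common_value N \<gamma> v m"
    and "\<And>v j. v \<in> inner_verts N \<Longrightarrow> j \<in> incident N v \<Longrightarrow> vertex_value M j v = \<gamma> v j * common_value N \<gamma> v m"
    and "(\<Sum>j\<in>edges N. LBINT s:{0<..<len N j}. M j s) + (\<Sum>v\<in>inner_verts N. \<eta> v * common_value N \<gamma> v m) = 1"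
    and "\<And>j. j \<in> edges N \<Longrightarrow> continuous_on {0..len N j} (M j)"
  using assms unfolding classical_FP_def extends_def by blast+

lemma H1D:
  assumes "H1 N \<mu> \<gamma> \<eta>"
  shows "\<And>v j. v \<in> inner_verts N \<Longrightarrow> j \<in> incident N v \<Longrightarrow> 0 < \<gamma> v j"
    and "\<And>v. v \<in> inner_verts N \<Longrightarrow> 0 \<le> \<eta> v"
    and "\<And>j. j \<in> edges N \<Longrightarrow> 0 < \<mu> j"
  using assms unfolding H1_def by blast+

lemma common_value_eq:
  assumes v: "v \<in> inner_verts N" and m: "compatible N \<gamma> m" "extends M m"
    and \<gamma>: "\<And>j. j \<in> incident N v \<Longrightarrow> 0 < \<gamma> v j" and j: "j \<in> incident N v"
  shows "vertex_value M j v = \<gamma> v j * common_value N \<gamma> v m"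
proof -
  have tr: "trace N m j' v = vertex_value M j' v" if "j' \<in> incident N v" for j'
    using that m(2) trace_continuous_extension[of j' M m v] by (auto simp: incident_def extends_def)
  have "common_value N \<gamma> v m = trace N m j v / \<gamma> v j"
    unfolding common_value_def
  proof (rule the_equality)
    show "\<forall>j'\<in>incident N v. trace N m j' v / \<gamma> v j' = trace N m j v / \<gamma> v j"
      using m(1) v j unfolding compatible_def by blast
  qed (use j in auto)
  then show ?thesis using tr[OF j] \<gamma>[OF j] by simp
qed

lemma FP_weak_solution_imp_classical_FP:
  assumes H1: "H1 N \<mu> \<gamma> \<eta>" and FP: "FP_weak_solution N \<mu> \<gamma> \<eta> b m"
    and B: "\<And>j. j \<in> edges N \<Longrightarrow> continuous_on {0..len N j} (B j)"
      "\<And>j s. j \<in> edges N \<Longrightarrow> s \<in> {0<..<len N j} \<Longrightarrow> b j s = B j s"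
  obtains M c where "classical_FP \<mu> \<gamma> \<eta> B m M c"
proof -
  note H = H1D[OF H1]
  obtain M c where Mc: "extends M m"
    "\<And>j s. j \<in> edges N \<Longrightarrow> s \<in> {0..len N j} \<Longrightarrow>
      (M j has_real_derivative (c j - B j s * M j s) / \<mu> j) (at s within {0..len N j})"
    "\<And>W. (\<Sum>j\<in>edges N. c j * (W (tgt N j) - W (src N j))) = 0"
    by (rule weak_FP_solution_is_classical[OF FP H(3) B]) (assumption | rule that)+
  have comp: "compatible N \<gamma> m" using FP by (simp add: FP_weak_solution_def V12_gamma_def)
  have cM: "continuous_on {0..len N j} (M j)" and eM: "\<And>s. s \<in> {0<..<len N j} \<Longrightarrow> on_edge N m j s = M j s"
    if "j \<in> edges N" for j
    using Mc(1) that by (auto simp: extends_def)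
  have "\<forall>x\<in>points N - verts N. 0 \<le> m x"
    using FP unfolding FP_weak_solution_def by (elim conjE)
  then have int: "0 \<le> M j s" if "j \<in> edges N" "s \<in> {0<..<len N j}" for j s
    unfolding eM[OF that, symmetric] on_edge_def using param_interior(2)[OF that] by blast
  have nonneg: "0 \<le> M j s" if "j \<in> edges N" "s \<in> {0..len N j}" for j s
    by (rule continuous_nonneg_on_closure[OF len_pos[OF that(1)] cM[OF that(1)] int[OF that(1)] that(2)])
  have T: "vertex_value M j v = \<gamma> v j * common_value N \<gamma> v m" if "v \<in> inner_verts N" "j \<in> incident N v" for v j
    by (rule common_value_eq[OF that(1) comp Mc(1) H(1)[OF that(1)] that(2)])
  have T0: "0 \<le> common_value N \<gamma> v m" if v: "v \<in> inner_verts N" for v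
  proof -
    obtain j where j: "j \<in> incident N v" using incident_nonempty[of v] v by (auto simp: inner_verts_def)
    then have "j \<in> edges N" by (simp add: incident_def)
    then have "0 \<le> vertex_value M j v" using nonneg[of j] len_pos[of j] by (simp add: vertex_value_def)
    then show ?thesis using T[OF v j] H(1)[OF v j] by (simp add: zero_le_mult_iff)
  qed
  have "net_integral N (on_edge N m) = 1 - (\<Sum>v\<in>inner_verts N. \<eta> v * common_value N \<gamma> v m)"
    using FP unfolding FP_weak_solution_def by (elim conjE)
  moreover have "net_integral N (on_edge N m) = (\<Sum>j\<in>edges N. LBINT s:{0<..<len N j}. M j s)"
    unfolding net_integral_def
    by (intro sum.cong refl set_lebesgue_integral_cong) (auto simp: eM)
  ultimately have "(\<Sum>j\<in>edges N. LBINT s:{0<..<len N j}. M j s) + (\<Sum>v\<in>inner_verts N. \<eta> v * common_value N \<gamma> v m) = 1"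
    by simp
  then show ?thesis using that[of M c] Mc nonneg T T0 unfolding classical_FP_def by blast
qed

text \<open>
  On an empty network the total mass would be zero.
\<close>

lemma edges_nonempty:
  assumes "classical_FP \<mu> \<gamma> \<eta> B m M c"
  shows "edges N \<noteq> {}"
proof
  assume e: "edges N = {}"
  then have "verts N = {}" using incident_nonempty by (auto simp: incident_def)
  then show False using classical_FPD(7)[OF assms] e by (simp add: inner_verts_def)
qed

text \<open>
  A zero would spread over the network and contradict the total mass one.
\<close>

lemma classical_FP_positive:
  assumes H1: "H1 N \<mu> \<gamma> \<eta>" and FP: "classical_FP \<mu> \<gamma> \<eta> B m M c"
    and B: "\<And>j. j \<in> edges N \<Longrightarrow> continuous_on {0..len N j} (B j)"
    and j: "j \<in> edges N" and s: "s \<in> {0..len N j}"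
  shows "0 < M j s"
proof (rule ccontr)
  note H = H1D[OF H1] and D = classical_FPD[OF FP]
  assume "\<not> 0 < M j s"
  then have z: "M j s = 0" using D(3)[OF j s] by simp
  have zero: "M j' t = 0" if "j' \<in> edges N" "t \<in> {0..len N j'}" for j' t
    by (rule nonneg_solution_zero_propagates[OF D(2) B H(3) D(3) kirchhoff_at_vertices[OF D(4)] H(1) _ j s z that])
      (use D(6) H(1) in \<open>force\<close>)+
  have "(LBINT s:{0<..<len N j'}. M j' s) = (LBINT s:{0<..<len N j'}. 0)" if "j' \<in> edges N" for j'
    using zero[OF that] by (intro set_lebesgue_integral_cong) auto
  then have "(\<Sum>j\<in>edges N. LBINT s:{0<..<len N j}. M j s) = 0" by simp
  moreover have "common_value N \<gamma> v m = 0" if v: "v \<in> inner_verts N" for v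
  proof -
    obtain j' where j': "j' \<in> incident N v" using incident_nonempty[of v] v by (auto simp: inner_verts_def)
    then have "j' \<in> edges N" by (simp add: incident_def)
    then have "vertex_value M j' v = 0" using zero[of j'] len_pos[of j'] by (simp add: vertex_value_def)
    then show ?thesis using D(6)[OF v j'] H(1)[OF v j'] by simp
  qed
  ultimately show False using D(7) by simp
qed

text \<open>
  Let \<open>\<tau>\<close> be the minimum of the quotient \<open>M\<^sub>1 / M\<^sub>2\<close> over the closed edges. Then \<open>M\<^sub>1 - \<tau> M\<^sub>2\<close> is a nonnegative
  solution with a zero, so it vanishes identically; the total masses give \<open>\<tau> = 1\<close>.
\<close>

lemma classical_FP_unique:
  assumes H1: "H1 N \<mu> \<gamma> \<eta>"
    and FP1: "classical_FP \<mu> \<gamma> \<eta> B m\<^sub>1 M\<^sub>1 c\<^sub>1" and FP2: "classical_FP \<mu> \<gamma> \<eta> B m\<^sub>2 M\<^sub>2 c\<^sub>2"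
    and B: "\<And>j. j \<in> edges N \<Longrightarrow> continuous_on {0..len N j} (B j)"
    and j: "j \<in> edges N" and s: "s \<in> {0..len N j}"
  shows "M\<^sub>1 j s = M\<^sub>2 j s"
proof -
  note H = H1D[OF H1] and D1 = classical_FPD[OF FP1] and D2 = classical_FPD[OF FP2]
  have pos: "0 < M\<^sub>2 j s" if "j \<in> edges N" "s \<in> {0..len N j}" for j s
    by (rule classical_FP_positive[OF H1 FP2 B that])
  define q where "q j s = M\<^sub>1 j s / M\<^sub>2 j s" for j s
  have "\<exists>s\<in>{0..len N j}. \<forall>t\<in>{0..len N j}. q j s \<le> q j t" if j: "j \<in> edges N" for j
  proof (rule continuous_attains_inf[OF compact_Icc])
    show "{0..len N j} \<noteq> {}" using len_pos[OF j] by simp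
    show "continuous_on {0..len N j} (q j)"
      unfolding q_def by (intro continuous_on_divide D1(8) D2(8) j) (use pos[OF j] in force)
  qed
  then obtain p where p: "\<And>j. j \<in> edges N \<Longrightarrow> p j \<in> {0..len N j}"
    "\<And>j t. j \<in> edges N \<Longrightarrow> t \<in> {0..len N j} \<Longrightarrow> q j (p j) \<le> q j t" by metis
  define \<tau> where "\<tau> = Min ((\<lambda>j. q j (p j)) ` edges N)"
  have "\<tau> \<in> (\<lambda>j. q j (p j)) ` edges N"
    unfolding \<tau>_def using edges_nonempty[OF FP1] finite_edges by (intro Min_in) auto
  then obtain j\<^sub>0 where j\<^sub>0: "j\<^sub>0 \<in> edges N" "q j\<^sub>0 (p j\<^sub>0) = \<tau>" by auto
  have le: "\<tau> \<le> q j t" if "j \<in> edges N" "t \<in> {0..len N j}" for j t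
  proof (rule order_trans[OF _ p(2)[OF that]])
    show "\<tau> \<le> q j (p j)" unfolding \<tau>_def by (rule Min_le) (use finite_edges that in auto)
  qed
  define f where "f j s = M\<^sub>1 j s - \<tau> * M\<^sub>2 j s" for j s
  have vv: "vertex_value f j v = \<gamma> v j * (common_value N \<gamma> v m\<^sub>1 - \<tau> * common_value N \<gamma> v m\<^sub>2)"
    if "v \<in> inner_verts N" "j \<in> incident N v" for v j
  proof -
    have "vertex_value f j v = vertex_value M\<^sub>1 j v - \<tau> * vertex_value M\<^sub>2 j v"
      by (simp add: vertex_value_def f_def)
    then show ?thesis using D1(6)[OF that] D2(6)[OF that] by (simp add: algebra_simps)
  qed
  have zero: "f j s = 0" if j: "j \<in> edges N" and s: "s \<in> {0..len N j}" for j s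
  proof (rule nonneg_solution_zero_propagates[where c="\<lambda>j. c\<^sub>1 j - \<tau> * c\<^sub>2 j", OF _ B H(3) _ _ H(1) _ j\<^sub>0(1) p(1)[OF j\<^sub>0(1)] _ j s])
    fix j s assume as: "j \<in> edges N" "s \<in> {0..len N j}"
    have "((\<lambda>s. M\<^sub>1 j s - \<tau> * M\<^sub>2 j s) has_real_derivative (c\<^sub>1 j - B j s * M\<^sub>1 j s) / \<mu> j -
        \<tau> * ((c\<^sub>2 j - B j s * M\<^sub>2 j s) / \<mu> j)) (at s within {0..len N j})"
      by (intro DERIV_diff DERIV_cmult D1(2) D2(2) as)
    moreover have "(c\<^sub>1 j - B j s * M\<^sub>1 j s) / \<mu> j - \<tau> * ((c\<^sub>2 j - B j s * M\<^sub>2 j s) / \<mu> j) =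
        (c\<^sub>1 j - \<tau> * c\<^sub>2 j - B j s * f j s) / \<mu> j"
      using H(3)[OF as(1)] by (simp add: f_def field_simps)
    ultimately show "(f j has_real_derivative (c\<^sub>1 j - \<tau> * c\<^sub>2 j - B j s * f j s) / \<mu> j) (at s within {0..len N j})"
      by (simp add: f_def[abs_def])
    show "0 \<le> f j s" using le[OF as] pos[OF as] by (simp add: f_def q_def field_simps)
  next
    fix v assume v: "v \<in> verts N"
    have "outflow (\<lambda>j s. c\<^sub>1 j - \<tau> * c\<^sub>2 j) j v = outflow (\<lambda>j s. c\<^sub>1 j) j v - \<tau> * outflow (\<lambda>j s. c\<^sub>2 j) j v" for j
      by (simp add: outflow_def)
    then show "(\<Sum>j\<in>incident N v. outflow (\<lambda>j s. c\<^sub>1 j - \<tau> * c\<^sub>2 j) j v) = 0"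
      using kirchhoff_at_vertices[OF D1(4) v] kirchhoff_at_vertices[OF D2(4) v]
      by (simp add: sum_subtractf sum_distrib_left[symmetric])
  next
    show "f j\<^sub>0 (p j\<^sub>0) = 0"
      using j\<^sub>0 pos[OF j\<^sub>0(1) p(1)[OF j\<^sub>0(1)]] by (simp add: f_def q_def field_simps)
  next
    fix v j j' assume v: "v \<in> inner_verts N" and *: "j \<in> incident N v" "j' \<in> incident N v"
    show "vertex_value f j v / \<gamma> v j = vertex_value f j' v / \<gamma> v j'"
      using vv[OF v *(1)] vv[OF v *(2)] H(1)[OF v *(1)] H(1)[OF v *(2)] by simp
  qed
  then have eq: "M\<^sub>1 j s = \<tau> * M\<^sub>2 j s" if "j \<in> edges N" "s \<in> {0..len N j}" for j s
    using that by (fastforce simp: f_def)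
  have "common_value N \<gamma> v m\<^sub>1 = \<tau> * common_value N \<gamma> v m\<^sub>2" if v: "v \<in> inner_verts N" for v
  proof -
    obtain j' where j': "j' \<in> incident N v" using incident_nonempty[of v] v by (auto simp: inner_verts_def)
    then have "j' \<in> edges N" by (simp add: incident_def)
    then have "vertex_value f j' v = 0" using zero[of j'] len_pos[of j'] by (simp add: vertex_value_def)
    then show ?thesis using vv[OF v j'] H(1)[OF v j'] by simp
  qed
  then have "(\<Sum>v\<in>inner_verts N. \<eta> v * common_value N \<gamma> v m\<^sub>1) = \<tau> * (\<Sum>v\<in>inner_verts N. \<eta> v * common_value N \<gamma> v m\<^sub>2)"
    by (simp add: sum_distrib_left mult.left_commute)
  moreover have "(LBINT s:{0<..<len N j}. M\<^sub>1 j s) = \<tau> * (LBINT s:{0<..<len N j}. M\<^sub>2 j s)" if "j \<in> edges N" for j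
  proof -
    have "(LBINT s:{0<..<len N j}. M\<^sub>1 j s) = (LBINT s:{0<..<len N j}. \<tau> * M\<^sub>2 j s)"
      using eq[OF that] by (intro set_lebesgue_integral_cong) auto
    then show ?thesis by simp
  qed
  then have "(\<Sum>j\<in>edges N. LBINT s:{0<..<len N j}. M\<^sub>1 j s) = \<tau> * (\<Sum>j\<in>edges N. LBINT s:{0<..<len N j}. M\<^sub>2 j s)"
    by (simp add: sum_distrib_left)
  ultimately have "1 = \<tau> * ((\<Sum>j\<in>edges N. LBINT s:{0<..<len N j}. M\<^sub>2 j s) +
      (\<Sum>v\<in>inner_verts N. \<eta> v * common_value N \<gamma> v m\<^sub>2))"
    using D1(7) by (simp only: distrib_left)
  then have "1 = \<tau> * 1" by (simp only: D2(7))
  then show ?thesis using eq[OF j s] by simp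
qed

lemma classical_FP_net_measure:
  assumes H1: "H1 N \<mu> \<gamma> \<eta>" and FP: "classical_FP \<mu> \<gamma> \<eta> B m M c"
  shows "net_measure N \<gamma> \<eta> m \<in> prob_measures N"
    and "extends g f \<Longrightarrow> integral\<^sup>L (net_measure N \<gamma> \<eta> m) f =
      (\<Sum>j\<in>edges N. LBINT s:{0<..<len N j}. M j s * g j s) + (\<Sum>v\<in>inner_verts N. \<eta> v * common_value N \<gamma> v m * f v)"
proof -
  note H = H1D[OF H1] and D = classical_FPD[OF FP]
  have n: "0 \<le> M j s" if "j \<in> edges N" "s \<in> {0<..<len N j}" for j s
    using D(3)[OF that(1), of s] that by simp
  have T: "0 \<le> \<eta> v * common_value N \<gamma> v m" if "v \<in> inner_verts N" for v
    using H(2)[OF that] D(5)[OF that] by simp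
  show "net_measure N \<gamma> \<eta> m \<in> prob_measures N" by (rule net_measure_prob[where M=M and m=m, OF D(1) n T D(7)])
  show "extends g f \<Longrightarrow> integral\<^sup>L (net_measure N \<gamma> \<eta> m) f =
      (\<Sum>j\<in>edges N. LBINT s:{0<..<len N j}. M j s * g j s) + (\<Sum>v\<in>inner_verts N. \<eta> v * common_value N \<gamma> v m * f v)"
    by (rule integral_net_measure(2)[where M=M and m=m, OF D(1) n T])
qed

text \<open>
  Integrating \<open>m\<^sub>1 - m\<^sub>2\<close>, set to zero at the vertices so that the atoms are not seen, against both
  measures yields \<open>\<integral> (m\<^sub>1 - m\<^sub>2)\<^sup>2 = 0\<close>.
\<close>

lemma net_measure_eq_imp_density_eq:
  assumes H1: "H1 N \<mu> \<gamma> \<eta>"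
    and FP1: "classical_FP \<mu> \<gamma> \<eta> B\<^sub>1 m\<^sub>1 M\<^sub>1 c\<^sub>1" and FP2: "classical_FP \<mu> \<gamma> \<eta> B\<^sub>2 m\<^sub>2 M\<^sub>2 c\<^sub>2"
    and eq: "net_measure N \<gamma> \<eta> m\<^sub>1 = net_measure N \<gamma> \<eta> m\<^sub>2"
    and j: "j \<in> edges N" and s: "s \<in> {0..len N j}"
  shows "M\<^sub>1 j s = M\<^sub>2 j s"
proof -
  note D1 = classical_FPD[OF FP1] and D2 = classical_FPD[OF FP2]
  let ?g = "\<lambda>j s. M\<^sub>1 j s - M\<^sub>2 j s" and ?f = "\<lambda>x. if x \<in> verts N then 0 else m\<^sub>1 x - m\<^sub>2 x"
  have c: "continuous_on {0..len N j} (?g j)" if "j \<in> edges N" for j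
    by (intro continuous_intros D1(8) D2(8) that)
  have ext: "extends ?g ?f"
    unfolding extends_def
  proof (intro ballI conjI c)
    fix j s assume *: "j \<in> edges N" "s \<in> {0<..<len N j}"
    then have "on_edge N m\<^sub>1 j s = M\<^sub>1 j s" "on_edge N m\<^sub>2 j s = M\<^sub>2 j s"
      using D1(1) D2(1) by (auto simp: extends_def)
    then show "on_edge N ?f j s = ?g j s" using param_interior(2)[OF *] by (simp add: on_edge_def)
  qed
  have v0: "(\<Sum>v\<in>inner_verts N. h v * ?f v) = 0" for h :: "real ^ 'd \<Rightarrow> real"
    by (intro sum.neutral) (auto simp: inner_verts_def)
  have "(\<Sum>j\<in>edges N. LBINT s:{0<..<len N j}. M\<^sub>1 j s * ?g j s) = (\<Sum>j\<in>edges N. LBINT s:{0<..<len N j}. M\<^sub>2 j s * ?g j s)"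
    using classical_FP_net_measure(2)[OF H1 FP1 ext] classical_FP_net_measure(2)[OF H1 FP2 ext] eq v0 by simp
  moreover have "(LBINT s:{0<..<len N j}. (?g j s)\<^sup>2) =
      (LBINT s:{0<..<len N j}. M\<^sub>1 j s * ?g j s) - (LBINT s:{0<..<len N j}. M\<^sub>2 j s * ?g j s)" if "j \<in> edges N" for j
  proof -
    have "(LBINT s:{0<..<len N j}. (?g j s)\<^sup>2) = (LBINT s:{0<..<len N j}. M\<^sub>1 j s * ?g j s - M\<^sub>2 j s * ?g j s)"
      by (intro set_lebesgue_integral_cong) (auto simp: power2_eq_square algebra_simps)
    also have "\<dots> = (LBINT s:{0<..<len N j}. M\<^sub>1 j s * ?g j s) - (LBINT s:{0<..<len N j}. M\<^sub>2 j s * ?g j s)"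
      by (intro set_integral_diff continuous_imp_L2_on continuous_intros D1(8) D2(8) that)
    finally show ?thesis .
  qed
  ultimately have "(\<Sum>j\<in>edges N. LBINT s:{0<..<len N j}. (?g j s)\<^sup>2) = 0" by (simp add: sum_subtractf)
  moreover have "0 \<le> (LBINT s:{0<..<len N j}. (?g j s)\<^sup>2)" for j
    unfolding set_lebesgue_integral_def by (intro integral_nonneg_AE) auto
  ultimately have "(LBINT s:{0<..<len N j}. (?g j s)\<^sup>2) = 0"
    using sum_nonneg_eq_0_iff[OF finite_edges, of "\<lambda>j. LBINT s:{0<..<len N j}. (?g j s)\<^sup>2"] j by blast
  then have "(?g j s)\<^sup>2 = 0"
    using continuous_nonneg_integral_zero[OF len_pos[OF j], of "\<lambda>s. (?g j s)\<^sup>2" s] s c[OF j]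
    by (simp add: continuous_on_power)
  then show ?thesis by simp
qed

text \<open>
  The values of the densities at the vertices may differ, but vertices have length zero.
\<close>

lemma density_eq_imp_net_measure_eq:
  assumes H1: "H1 N \<mu> \<gamma> \<eta>"
    and FP1: "classical_FP \<mu> \<gamma> \<eta> B\<^sub>1 m\<^sub>1 M\<^sub>1 c\<^sub>1" and FP2: "classical_FP \<mu> \<gamma> \<eta> B\<^sub>2 m\<^sub>2 M\<^sub>2 c\<^sub>2"
    and eq: "\<And>j s. j \<in> edges N \<Longrightarrow> s \<in> {0..len N j} \<Longrightarrow> M\<^sub>1 j s = M\<^sub>2 j s"
  shows "net_measure N \<gamma> \<eta> m\<^sub>1 = net_measure N \<gamma> \<eta> m\<^sub>2"
proof -
  note H = H1D[OF H1] and D1 = classical_FPD[OF FP1] and D2 = classical_FPD[OF FP2]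
  have off: "m\<^sub>1 x = m\<^sub>2 x" if "x \<in> points N - verts N" for x
    using that
  proof (rule interior_pointE)
    fix j s assume *: "j \<in> edges N" "s \<in> {0<..<len N j}" "x = param N j s"
    then have "on_edge N m\<^sub>1 j s = M\<^sub>1 j s" "on_edge N m\<^sub>2 j s = M\<^sub>2 j s"
      using D1(1) D2(1) by (auto simp: extends_def)
    then show ?thesis using eq[of j s] * by (simp add: on_edge_def)
  qed
  have vm: "verts N \<in> sets borel_points"
    using finite_verts vert_in_points by (auto simp: sets_restrict_space intro!: image_eqI[of _ _ "verts N"] borel_closed finite_imp_closed)
  have "emeasure (length_measure N) (verts N) = 0"
  proof -
    have "emeasure (edge_length_measure j) (verts N) = 0" if j: "j \<in> edges N" for j
    proof -
      have "emeasure (edge_length_measure j) (verts N) = emeasure lborel (param N j -` verts N \<inter> {0..len N j})"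
        unfolding edge_length_measure_def
        by (subst emeasure_distr[OF param_measurable[OF j] vm])
          (auto simp: space_restrict_space emeasure_restrict_space)
      also have "param N j -` verts N \<inter> {0..len N j} \<subseteq> {0, len N j}"
        using param_in_verts_iff[OF j] by blast
      then have "finite (param N j -` verts N \<inter> {0..len N j})" by (rule finite_subset) simp
      then have "emeasure lborel (param N j -` verts N \<inter> {0..len N j}) = 0" by (intro emeasure_lborel_countable countable_finite)
      finally show ?thesis .
    qed
    then show ?thesis by (simp add: emeasure_length_measure[OF vm])
  qed
  then have "verts N \<in> null_sets (length_measure N)" using vm by (simp add: null_sets_def sets_length_measure)
  then have "AE x in length_measure N. x \<notin> verts N" by (rule AE_not_in)
  moreover have "AE x in length_measure N. x \<in> points N"
    using sets_eq_imp_space_eq[OF sets_length_measure] by (intro AE_I2) (simp add: space_borel_points)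
  ultimately have "AE x in length_measure N. ennreal (m\<^sub>1 x) = ennreal (m\<^sub>2 x)"
    by eventually_elim (simp add: off)
  moreover have "m\<^sub>1 \<in> borel_measurable (length_measure N)" "m\<^sub>2 \<in> borel_measurable (length_measure N)"
    using extends_borel_measurable[OF D1(1)] extends_borel_measurable[OF D2(1)]
      measurable_cong_sets[OF sets_length_measure refl] by blast+
  ultimately have "density (length_measure N) (\<lambda>x. ennreal (m\<^sub>1 x)) = density (length_measure N) (\<lambda>x. ennreal (m\<^sub>2 x))"
    by (intro density_cong) auto
  moreover have T: "common_value N \<gamma> v m\<^sub>1 = common_value N \<gamma> v m\<^sub>2" if v: "v \<in> inner_verts N" for v
  proof -
    obtain j' where j': "j' \<in> incident N v" using incident_nonempty[of v] v by (auto simp: inner_verts_def)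
    then have "j' \<in> edges N" by (simp add: incident_def)
    then have "vertex_value M\<^sub>1 j' v = vertex_value M\<^sub>2 j' v" using eq[of j'] len_pos[of j'] by (simp add: vertex_value_def)
    then show ?thesis using D1(6)[OF v j'] D2(6)[OF v j'] H(1)[OF v j'] by simp
  qed
  ultimately show ?thesis unfolding net_measure_def by (simp cong: sum.cong)
qed

end

section \<open>The duality identity and the difference of two value functions\<close>

context geometric_network
begin

lemma net_C2_derivatives:
  assumes u: "u \<in> net_Ck_holder N 2 \<sigma>" and j: "j \<in> edges N"
  shows "s \<in> {0..len N j} \<Longrightarrow>
      (on_edge N u j has_real_derivative edge_deriv N 1 u j s) (at s within {0..len N j})"
    and "s \<in> {0..len N j} \<Longrightarrow>
      (edge_deriv N 1 u j has_real_derivative edge_deriv N 2 u j s) (at s within {0..len N j})"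
    and "continuous_on {0..len N j} (edge_deriv N 2 u j)"
proof -
  let ?I = "{0..len N j}"
  have C: "Ck_on 2 ?I (on_edge N u j)"
    using u j by (auto simp: net_Ck_holder_def net_Ck_def)
  have d: "iter_deriv ?I 0 (on_edge N u j) differentiable (at s within ?I)"
    "iter_deriv ?I 1 (on_edge N u j) differentiable (at s within ?I)" if "s \<in> ?I" for s
    using C[unfolded Ck_on_def, THEN conjunct1, rule_format, OF _ that, of 0]
      C[unfolded Ck_on_def, THEN conjunct1, rule_format, OF _ that, of 1] by simp_all
  have i1: "iter_deriv ?I 1 f = (\<lambda>s. vector_derivative f (at s within ?I))"
    and i2: "iter_deriv ?I 2 f = (\<lambda>s. vector_derivative (iter_deriv ?I 1 f) (at s within ?I))" for f :: "real \<Rightarrow> real"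
    by (simp_all add: numeral_2_eq_2)
  show "(on_edge N u j has_real_derivative edge_deriv N 1 u j s) (at s within ?I)" if "s \<in> ?I"
    using d(1)[OF that]
    by (simp add: edge_deriv_def has_real_derivative_iff_has_vector_derivative vector_derivative_works)
  show "(edge_deriv N 1 u j has_real_derivative edge_deriv N 2 u j s) (at s within ?I)" if "s \<in> ?I"
    using d(2)[OF that] unfolding vector_derivative_works
    by (simp only: edge_deriv_def has_real_derivative_iff_has_vector_derivative i2)
  show "continuous_on ?I (edge_deriv N 2 u j)" using C by (simp add: Ck_on_def edge_deriv_def)
qed

text \<open>
  The form in which the hypotheses on the Hamiltonian are used: \<open>h\<close> and \<open>G\<close> are the Hamiltonian and its
  derivative in arc-length coordinates, continuous up to the endpoints, and the bound on the
  derivative makes the Hamiltonian Lipschitz in \<open>p\<close> on bounded sets, uniformly on the network.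
\<close>

lemma hamiltonian_on_edges:
  assumes "H2 N H"
  obtains h G where
    "\<And>j q. j \<in> edges N \<Longrightarrow> continuous_on {0..len N j} q \<Longrightarrow> continuous_on {0..len N j} (\<lambda>s. h j s (q s))"
    "\<And>j q. j \<in> edges N \<Longrightarrow> continuous_on {0..len N j} q \<Longrightarrow> continuous_on {0..len N j} (\<lambda>s. G j s (q s))"
    "\<And>j s. j \<in> edges N \<Longrightarrow> s \<in> {0<..<len N j} \<Longrightarrow> h j s = H (param N j s)"
    "\<And>j s p. j \<in> edges N \<Longrightarrow> s \<in> {0<..<len N j} \<Longrightarrow> (H (param N j s) has_real_derivative G j s p) (at p)"
    "\<And>R. \<exists>K. \<forall>j\<in>edges N. \<forall>s\<in>{0<..<len N j}. \<forall>p p'. \<bar>p\<bar> \<le> R \<longrightarrow> \<bar>p'\<bar> \<le> R \<longrightarrow>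
        \<bar>H (param N j s) p - H (param N j s) p'\<bar> \<le> K * \<bar>p - p'\<bar>"
proof -
  note H = assms[unfolded H2_def]
  have hc: "continuous_on (seg N j \<times> UNIV) (\<lambda>(x, p). edge_ham N H j x p)"
    and hd: "\<And>x p. x \<in> seg N j - verts N \<Longrightarrow> edge_ham N H j x differentiable (at p)" if "j \<in> edges N" for j
    using H[THEN conjunct1, rule_format, OF that] by blast+
  obtain G where "(\<forall>j\<in>edges N.
             continuous_on (seg N j \<times> UNIV) (\<lambda>(x, p). G j x p) \<and>
             (\<forall>x\<in>seg N j - verts N. \<forall>p. G j x p = deriv (edge_ham N H j x) p)) \<and>
          (\<exists>C q. 0 < C \<and> 1 < q \<and> q \<le> 2 \<and>
             (\<forall>j\<in>edges N. \<forall>x\<in>seg N j. \<forall>p.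
                \<bar>edge_ham N H j x p\<bar> \<le> C * (1 + \<bar>p\<bar> powr q) \<and>
                \<bar>G j x p\<bar> \<le> C * (1 + \<bar>p\<bar> powr (q - 1)) \<and>
                edge_ham N H j x p \<ge> inverse C * \<bar>p\<bar> powr q - C))"
    using H[THEN conjunct2] by (rule exE)
  note G0 = this
  have Gc: "continuous_on (seg N j \<times> UNIV) (\<lambda>(x, p). G j x p)"
    and Gd: "\<And>x p. x \<in> seg N j - verts N \<Longrightarrow> G j x p = deriv (edge_ham N H j x) p" if "j \<in> edges N" for j
    using G0[THEN conjunct1, rule_format, OF that] by blast+
  obtain C q where Cq: "0 < C" "1 < q"
    and Gb: "\<And>j x p. j \<in> edges N \<Longrightarrow> x \<in> seg N j \<Longrightarrow> \<bar>G j x p\<bar> \<le> C * (1 + \<bar>p\<bar> powr (q - 1))"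
    using G0[THEN conjunct2] by blast
  have ham: "edge_ham N H j (param N j s) = H (param N j s)" if "j \<in> edges N" "s \<in> {0<..<len N j}" for j s
    using param_interior(2)[OF that] by (auto simp: edge_ham_def fun_eq_iff)
  have comp: "continuous_on {0..len N j} (\<lambda>s. f (param N j s) (q s))"
    if "j \<in> edges N" "continuous_on (seg N j \<times> UNIV) (\<lambda>(x, p). f x p)" "continuous_on {0..len N j} q"
    for j and f :: "real ^ 'd \<Rightarrow> real \<Rightarrow> real" and q
  proof -
    have "continuous_on {0..len N j} (\<lambda>s. (\<lambda>(x, p). f x p) (param N j s, q s))"
      by (rule continuous_on_compose2[OF that(2)])
        (use that param_in_seg in \<open>auto intro!: continuous_intros continuous_on_param\<close>)
    then show ?thesis by simp
  qed
  have der: "(H (param N j s) has_real_derivative G j (param N j s) p) (at p)"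
    if j: "j \<in> edges N" and s: "s \<in> {0<..<len N j}" for j s p
    using hd[OF j param_interior(1)[OF j s], of p] Gd[OF j param_interior(1)[OF j s], of p]
    unfolding ham[OF j s] DERIV_deriv_iff_real_differentiable[symmetric] by simp
  show ?thesis
  proof (rule that[of "\<lambda>j s. edge_ham N H j (param N j s)" "\<lambda>j s. G j (param N j s)"])
    fix R :: real
    let ?K = "C * (1 + \<bar>R\<bar> powr (q - 1))"
    have "\<bar>H (param N j s) p - H (param N j s) p'\<bar> \<le> ?K * \<bar>p - p'\<bar>"
      if j: "j \<in> edges N" and s: "s \<in> {0<..<len N j}" and p: "\<bar>p\<bar> \<le> R" "\<bar>p'\<bar> \<le> R" for j s p p'
    proof -
      have "norm (H (param N j s) p - H (param N j s) p') \<le> ?K * norm (p - p')"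
      proof (rule field_differentiable_bound[of "{-R..R}"])
        fix z assume z: "z \<in> {-R..R}"
        show "(H (param N j s) has_field_derivative G j (param N j s) z) (at z within {-R..R})"
          using der[OF j s] by (rule has_field_derivative_at_within)
        have "\<bar>z\<bar> powr (q - 1) \<le> \<bar>R\<bar> powr (q - 1)"
          using z Cq by (intro powr_mono2) auto
        then have "C * (1 + \<bar>z\<bar> powr (q - 1)) \<le> ?K" using Cq by simp
        then show "norm (G j (param N j s) z) \<le> ?K"
          using Gb[OF j, of "param N j s" z] param_interior(1)[OF j s] by simp
      qed (use p in \<open>auto simp: abs_le_iff\<close>)
      then show ?thesis by simp
    qed
    then show "\<exists>K. \<forall>j\<in>edges N. \<forall>s\<in>{0<..<len N j}. \<forall>p p'. \<bar>p\<bar> \<le> R \<longrightarrow> \<bar>p'\<bar> \<le> R \<longrightarrow>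
        \<bar>H (param N j s) p - H (param N j s) p'\<bar> \<le> K * \<bar>p - p'\<bar>" by blast
  qed (use comp hc Gc ham der in auto)
qed

text \<open>
  Here \<open>w = u\<^sub>1 - u\<^sub>2\<close> with derivatives \<open>v\<close> and \<open>a\<close>, \<open>D\<close> is the difference of the Hamiltonian terms, and
  \<open>D + r - \<mu> a\<close> is the difference \<open>\<phi>\<close> of the couplings on the edges. The identity is the fundamental
  theorem of calculus for \<open>P = \<mu> v (M\<^sub>1 - M\<^sub>2) - (c\<^sub>1 - c\<^sub>2) w\<close>, summed over the edges: the first term produces the
  vertex contributions, the second telescopes by the balance of fluxes.
\<close>

lemma duality_identity:
  assumes H1: "H1 N \<mu> \<gamma> \<eta>"
    and FP1: "classical_FP \<mu> \<gamma> \<eta> B\<^sub>1 m\<^sub>1 M\<^sub>1 c\<^sub>1" and FP2: "classical_FP \<mu> \<gamma> \<eta> B\<^sub>2 m\<^sub>2 M\<^sub>2 c\<^sub>2"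
    and B: "\<And>j. j \<in> edges N \<Longrightarrow> continuous_on {0..len N j} (B\<^sub>1 j)"
      "\<And>j. j \<in> edges N \<Longrightarrow> continuous_on {0..len N j} (B\<^sub>2 j)"
    and w: "\<And>j s. j \<in> edges N \<Longrightarrow> s \<in> {0..len N j} \<Longrightarrow> (w j has_real_derivative v j s) (at s within {0..len N j})"
    and v: "\<And>j s. j \<in> edges N \<Longrightarrow> s \<in> {0..len N j} \<Longrightarrow> (v j has_real_derivative a j s) (at s within {0..len N j})"
    and a: "\<And>j. j \<in> edges N \<Longrightarrow> continuous_on {0..len N j} (a j)"
    and W: "\<And>j. j \<in> edges N \<Longrightarrow> w j 0 = W (src N j)" "\<And>j. j \<in> edges N \<Longrightarrow> w j (len N j) = W (tgt N j)"
    and D: "\<And>j. j \<in> edges N \<Longrightarrow> continuous_on {0..len N j} (D j)"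
    and inner: "\<And>x. x \<in> inner_verts N \<Longrightarrow> (\<Sum>j\<in>incident N x. \<mu> j * \<gamma> x j * outflow v j x) = \<eta> x * (\<phi> x - r)"
    and bdry: "\<And>x j. x \<in> boundary_verts N \<Longrightarrow> j \<in> incident N x \<Longrightarrow> outflow v j x = 0"
  shows "(\<Sum>j\<in>edges N. LBINT s:{0<..<len N j}.
           M\<^sub>1 j s * (D j s - B\<^sub>1 j s * v j s) - M\<^sub>2 j s * (D j s - B\<^sub>2 j s * v j s)) =
         ((\<Sum>j\<in>edges N. LBINT s:{0<..<len N j}. M\<^sub>1 j s * (D j s + r - \<mu> j * a j s)) +
            (\<Sum>x\<in>inner_verts N. \<eta> x * common_value N \<gamma> x m\<^sub>1 * \<phi> x)) -
         ((\<Sum>j\<in>edges N. LBINT s:{0<..<len N j}. M\<^sub>2 j s * (D j s + r - \<mu> j * a j s)) +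
            (\<Sum>x\<in>inner_verts N. \<eta> x * common_value N \<gamma> x m\<^sub>2 * \<phi> x))"
    (is "?E = (?I1 + ?S1) - (?I2 + ?S2)")
proof -
  note H = H1D[OF H1] and D1 = classical_FPD[OF FP1] and D2 = classical_FPD[OF FP2]
  have cv: "continuous_on {0..len N j} (v j)" if "j \<in> edges N" for j
    using v[OF that] by (meson DERIV_continuous continuous_on_eq_continuous_within)
  let ?e = "\<lambda>j s. M\<^sub>1 j s * (D j s - B\<^sub>1 j s * v j s) - M\<^sub>2 j s * (D j s - B\<^sub>2 j s * v j s)"
  let ?f = "\<lambda>j s. D j s + r - \<mu> j * a j s"
  let ?i = "\<lambda>g j. LBINT s:{0<..<len N j}. g j s"
  let ?T1 = "\<lambda>x. common_value N \<gamma> x m\<^sub>1" and ?T2 = "\<lambda>x. common_value N \<gamma> x m\<^sub>2"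
  define P where "P j s = \<mu> j * (v j s * (M\<^sub>1 j s - M\<^sub>2 j s)) - (c\<^sub>1 j - c\<^sub>2 j) * w j s" for j s
  have parts: "P j (len N j) - P j 0 = ?i ?e j + r * (?i M\<^sub>1 j - ?i M\<^sub>2 j) -
      (?i (\<lambda>j s. M\<^sub>1 j s * ?f j s) j - ?i (\<lambda>j s. M\<^sub>2 j s * ?f j s) j)" if j: "j \<in> edges N" for j
  proof -
    note cs = D1(8)[OF j] D2(8)[OF j] B(1)[OF j] B(2)[OF j] a[OF j] D[OF j] cv[OF j]
    let ?g = "\<lambda>s. ?e j s + r * (M\<^sub>1 j s - M\<^sub>2 j s) - (M\<^sub>1 j s * ?f j s - M\<^sub>2 j s * ?f j s)"
    have "(LBINT s:{0<..<len N j}. ?g s) = P j (len N j) - P j 0"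
    proof (rule integral_derivative)
      fix s assume s: "s \<in> {0..len N j}"
      have "(P j has_real_derivative \<mu> j * (v j s * ((c\<^sub>1 j - B\<^sub>1 j s * M\<^sub>1 j s) / \<mu> j - (c\<^sub>2 j - B\<^sub>2 j s * M\<^sub>2 j s) / \<mu> j) +
          a j s * (M\<^sub>1 j s - M\<^sub>2 j s)) - (c\<^sub>1 j - c\<^sub>2 j) * v j s) (at s within {0..len N j})"
        unfolding P_def
        by (intro DERIV_diff DERIV_cmult DERIV_mult' D1(2) D2(2) v w j s)
      moreover have "\<mu> j * (v j s * ((c\<^sub>1 j - B\<^sub>1 j s * M\<^sub>1 j s) / \<mu> j - (c\<^sub>2 j - B\<^sub>2 j s * M\<^sub>2 j s) / \<mu> j) +
          a j s * (M\<^sub>1 j s - M\<^sub>2 j s)) - (c\<^sub>1 j - c\<^sub>2 j) * v j s = ?g s"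
      proof -
        have "\<mu> j * (v j s * ((c\<^sub>1 j - B\<^sub>1 j s * M\<^sub>1 j s) / \<mu> j - (c\<^sub>2 j - B\<^sub>2 j s * M\<^sub>2 j s) / \<mu> j)) =
            v j s * ((c\<^sub>1 j - B\<^sub>1 j s * M\<^sub>1 j s) - (c\<^sub>2 j - B\<^sub>2 j s * M\<^sub>2 j s))"
          using H(3)[OF j] by (simp add: field_simps)
        then show ?thesis by (simp add: algebra_simps)
      qed
      ultimately show "(P j has_real_derivative ?g s) (at s within {0..len N j})" by simp
    qed (use len_pos[OF j] in \<open>auto intro!: continuous_intros cs\<close>)
    moreover have "(LBINT s:{0<..<len N j}. ?g s) = (LBINT s:{0<..<len N j}. ?e j s + r * (M\<^sub>1 j s - M\<^sub>2 j s)) -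
        (LBINT s:{0<..<len N j}. M\<^sub>1 j s * ?f j s - M\<^sub>2 j s * ?f j s)"
      by (intro set_integral_diff continuous_imp_L2_on continuous_intros cs)
    moreover have "(LBINT s:{0<..<len N j}. ?e j s + r * (M\<^sub>1 j s - M\<^sub>2 j s)) =
        ?i ?e j + (LBINT s:{0<..<len N j}. r * (M\<^sub>1 j s - M\<^sub>2 j s))"
      by (intro set_integral_add continuous_imp_L2_on continuous_intros cs)
    moreover have "(LBINT s:{0<..<len N j}. r * (M\<^sub>1 j s - M\<^sub>2 j s)) = r * (?i M\<^sub>1 j - ?i M\<^sub>2 j)"
      by (simp add: set_integral_diff(2) continuous_imp_L2_on(2) cs)
    moreover have "(LBINT s:{0<..<len N j}. M\<^sub>1 j s * ?f j s - M\<^sub>2 j s * ?f j s) =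
        ?i (\<lambda>j s. M\<^sub>1 j s * ?f j s) j - ?i (\<lambda>j s. M\<^sub>2 j s * ?f j s) j"
      by (intro set_integral_diff continuous_imp_L2_on continuous_intros cs)
    ultimately show ?thesis by linarith
  qed
  have "(\<Sum>j\<in>edges N. P j (len N j) - P j 0) = (\<Sum>x\<in>inner_verts N. (?T1 x - ?T2 x) * (\<eta> x * (\<phi> x - r)))"
  proof -
    let ?Q = "\<lambda>j s. \<mu> j * (v j s * (M\<^sub>1 j s - M\<^sub>2 j s))"
    have "(\<Sum>j\<in>edges N. P j (len N j) - P j 0) = (\<Sum>j\<in>edges N. (?Q j (len N j) - ?Q j 0) -
        (c\<^sub>1 j * (W (tgt N j) - W (src N j)) - c\<^sub>2 j * (W (tgt N j) - W (src N j))))"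
      by (intro sum.cong refl) (simp add: P_def W algebra_simps)
    also have "\<dots> = (\<Sum>j\<in>edges N. ?Q j (len N j) - ?Q j 0)"
      unfolding sum_subtractf[of "\<lambda>j. ?Q j (len N j) - ?Q j 0"]
        sum_subtractf[of "\<lambda>j. c\<^sub>1 j * (W (tgt N j) - W (src N j))"]
      by (simp only: D1(4) D2(4) diff_zero)
    also have "\<dots> = (\<Sum>x\<in>verts N. \<Sum>j\<in>incident N x. outflow ?Q j x)"
      by (rule sum_of_vertex_differences)
    also have "\<dots> = (\<Sum>x\<in>inner_verts N. \<Sum>j\<in>incident N x. outflow ?Q j x)"
    proof -
      have "outflow ?Q j x = 0" if "x \<in> boundary_verts N" "j \<in> incident N x" for x j
        using bdry[OF that] by (auto simp: outflow_def split: if_splits)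
      then show ?thesis by (simp add: sum_verts)
    qed
    also have "\<dots> = (\<Sum>x\<in>inner_verts N. (?T1 x - ?T2 x) * (\<eta> x * (\<phi> x - r)))"
    proof (rule sum.cong[OF refl])
      fix x assume x: "x \<in> inner_verts N"
      have "outflow ?Q j x = (?T1 x - ?T2 x) * (\<mu> j * \<gamma> x j * outflow v j x)" if j: "j \<in> incident N x" for j
      proof -
        have "outflow ?Q j x = \<mu> j * outflow v j x * (vertex_value M\<^sub>1 j x - vertex_value M\<^sub>2 j x)"
          by (simp add: outflow_def vertex_value_def)
        then show ?thesis using D1(6)[OF x j] D2(6)[OF x j] by (simp add: algebra_simps)
      qed
      then show "(\<Sum>j\<in>incident N x. outflow ?Q j x) = (?T1 x - ?T2 x) * (\<eta> x * (\<phi> x - r))"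
        using inner[OF x] by (simp add: sum_distrib_left[symmetric])
    qed
    finally show ?thesis .
  qed
  moreover have "(\<Sum>x\<in>inner_verts N. (?T1 x - ?T2 x) * (\<eta> x * (\<phi> x - r))) =
      ?S1 - ?S2 - r * ((\<Sum>x\<in>inner_verts N. \<eta> x * ?T1 x) - (\<Sum>x\<in>inner_verts N. \<eta> x * ?T2 x))"
    by (simp add: sum_subtractf[symmetric] sum_distrib_left algebra_simps)
  moreover have "(\<Sum>j\<in>edges N. P j (len N j) - P j 0) =
      ?E + r * ((\<Sum>j\<in>edges N. ?i M\<^sub>1 j) - (\<Sum>j\<in>edges N. ?i M\<^sub>2 j)) - (?I1 - ?I2)"
    by (simp add: parts sum.distrib sum_subtractf sum_distrib_left[symmetric])
  \<comment> \<open>Both solutions have total mass one, so the difference of the masses on the edges is compensated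
      by the atoms.\<close>
  moreover have "r * ((\<Sum>j\<in>edges N. ?i M\<^sub>1 j) - (\<Sum>j\<in>edges N. ?i M\<^sub>2 j)) =
      - (r * ((\<Sum>x\<in>inner_verts N. \<eta> x * ?T1 x) - (\<Sum>x\<in>inner_verts N. \<eta> x * ?T2 x)))"
  proof -
    have "(\<Sum>j\<in>edges N. ?i M\<^sub>1 j) - (\<Sum>j\<in>edges N. ?i M\<^sub>2 j) =
        - ((\<Sum>x\<in>inner_verts N. \<eta> x * ?T1 x) - (\<Sum>x\<in>inner_verts N. \<eta> x * ?T2 x))"
      using D1(7) D2(7) by linarith
    then show ?thesis by (simp only: mult_minus_right)
  qed
  ultimately show ?thesis by linarith
qed

text \<open>
  The hypotheses are invariant under a change of sign of \<open>w\<close>, \<open>D\<close> and \<open>r\<close>, so \<open>r \<ge> 0\<close> may be assumed; then the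
  flux condition at the inner vertices has the sign that the maximum principle requires.
\<close>

lemma HJ_difference_constant:
  assumes H1: "H1 N \<mu> \<gamma> \<eta>" and ne: "edges N \<noteq> {}"
    and w: "\<And>j s. j \<in> edges N \<Longrightarrow> s \<in> {0..len N j} \<Longrightarrow> (w j has_real_derivative v j s) (at s within {0..len N j})"
    and v: "\<And>j s. j \<in> edges N \<Longrightarrow> s \<in> {0..len N j} \<Longrightarrow> (v j has_real_derivative a j s) (at s within {0..len N j})"
    and W: "\<And>j. j \<in> edges N \<Longrightarrow> w j 0 = W (src N j)" "\<And>j. j \<in> edges N \<Longrightarrow> w j (len N j) = W (tgt N j)"
    and eq: "\<And>j s. j \<in> edges N \<Longrightarrow> s \<in> {0<..<len N j} \<Longrightarrow> \<mu> j * a j s = D j s + r"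
    and lip: "\<And>j s. j \<in> edges N \<Longrightarrow> s \<in> {0<..<len N j} \<Longrightarrow> \<bar>D j s\<bar> \<le> K * \<bar>v j s\<bar>"
    and inner: "\<And>x. x \<in> inner_verts N \<Longrightarrow> (\<Sum>j\<in>incident N x. \<mu> j * \<gamma> x j * outflow v j x) = - (\<eta> x * r)"
    and bdry: "\<And>x j. x \<in> boundary_verts N \<Longrightarrow> j \<in> incident N x \<Longrightarrow> outflow v j x = 0"
  shows "r = 0" "\<exists>X. \<forall>j\<in>edges N. \<forall>s\<in>{0..len N j}. w j s = X"
proof -
  note H = H1D[OF H1]
  have main: "r = 0 \<and> (\<exists>X. \<forall>j\<in>edges N. \<forall>s\<in>{0..len N j}. w j s = X)"
    if r: "0 \<le> r"
    and w: "\<And>j s. j \<in> edges N \<Longrightarrow> s \<in> {0..len N j} \<Longrightarrow> (w j has_real_derivative v j s) (at s within {0..len N j})"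
    and v: "\<And>j s. j \<in> edges N \<Longrightarrow> s \<in> {0..len N j} \<Longrightarrow> (v j has_real_derivative a j s) (at s within {0..len N j})"
    and W: "\<And>j. j \<in> edges N \<Longrightarrow> w j 0 = W (src N j)" "\<And>j. j \<in> edges N \<Longrightarrow> w j (len N j) = W (tgt N j)"
    and eq: "\<And>j s. j \<in> edges N \<Longrightarrow> s \<in> {0<..<len N j} \<Longrightarrow> \<mu> j * a j s = D j s + r"
    and lip: "\<And>j s. j \<in> edges N \<Longrightarrow> s \<in> {0<..<len N j} \<Longrightarrow> \<bar>D j s\<bar> \<le> K * \<bar>v j s\<bar>"
    and inner: "\<And>x. x \<in> inner_verts N \<Longrightarrow> (\<Sum>j\<in>incident N x. \<mu> j * \<gamma> x j * outflow v j x) = - (\<eta> x * r)"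
    and bdry: "\<And>x j. x \<in> boundary_verts N \<Longrightarrow> j \<in> incident N x \<Longrightarrow> outflow v j x = 0"
    for w v a D :: "'e \<Rightarrow> real \<Rightarrow> real" and W :: "real ^ 'd \<Rightarrow> real" and r :: real
  proof -
    define k where "k x j = (if x \<in> inner_verts N then \<mu> j * \<gamma> x j else 1)" for x j
    have ineq: "a j s \<ge> - (K / \<mu> j) * \<bar>v j s\<bar> + r / \<mu> j" if "j \<in> edges N" "s \<in> {0<..<len N j}" for j s
    proof -
      have "\<mu> j * a j s \<ge> - K * \<bar>v j s\<bar> + r" using eq[OF that] lip[OF that] by simp
      then have "a j s \<ge> (- K * \<bar>v j s\<bar> + r) / \<mu> j"
        using H(3)[OF that(1)] by (simp add: pos_divide_le_eq mult.commute)
      then show ?thesis by (simp add: diff_divide_distrib)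
    qed
    have r': "0 \<le> r / \<mu> j" if "j \<in> edges N" for j using r H(3)[OF that] by simp
    have k: "0 < k x j" if "x \<in> verts N" "j \<in> incident N x" for x j
      using H(1)[of x j] H(3)[of j] that by (auto simp: k_def incident_def)
    have flux: "(\<Sum>j\<in>incident N x. k x j * outflow v j x) \<le> 0" if x: "x \<in> verts N" for x
    proof (cases "x \<in> inner_verts N")
      case True
      then show ?thesis using inner[OF True] H(2)[OF True] r by (simp add: k_def)
    next
      case False
      then have "x \<in> boundary_verts N" using x verts_cases(1) by blast
      then show ?thesis using bdry by simp
    qed
    note M = strong_maximum_principle[of w v a "\<lambda>j. K / \<mu> j" "\<lambda>j. r / \<mu> j" W k, OF ne w v ineq r' W k flux]
    obtain j where j: "j \<in> edges N" using ne by blast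
    have "r / \<mu> j = 0" by (rule M(2)) (assumption | rule j)+
    then have "r = 0" using H(3)[OF j] by simp
    moreover have "\<exists>X. \<forall>j\<in>edges N. \<forall>s\<in>{0..len N j}. w j s = X" by (rule M(1))
    ultimately show ?thesis by blast
  qed
  have "r = 0 \<and> (\<exists>X. \<forall>j\<in>edges N. \<forall>s\<in>{0..len N j}. w j s = X)"
  proof (cases "0 \<le> r")
    case True
    show ?thesis by (rule main[OF True w v W eq lip inner bdry])
  next
    case False
    have o: "outflow (\<lambda>j s. - v j s) j x = - outflow v j x" for j x by (simp add: outflow_def)
    have "- r = 0 \<and> (\<exists>X. \<forall>j\<in>edges N. \<forall>s\<in>{0..len N j}. - w j s = X)"
    proof (rule main[where w="\<lambda>j s. - w j s" and v="\<lambda>j s. - v j s" and a="\<lambda>j s. - a j s" and D="\<lambda>j s. - D j s" and W="\<lambda>x. - W x"])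
      show "0 \<le> - r" using False by simp
      fix j s assume "j \<in> edges N" "s \<in> {0<..<len N j}"
      then show "\<mu> j * - a j s = - D j s + - r" "\<bar>- D j s\<bar> \<le> K * \<bar>- v j s\<bar>"
        using eq[of j s] lip[of j s] by auto
    qed (auto intro!: DERIV_minus w v simp: W o inner bdry sum_negf)
    then show ?thesis using False by simp
  qed
  then show "r = 0" "\<exists>X. \<forall>j\<in>edges N. \<forall>s\<in>{0..len N j}. w j s = X" by blast+
qed

end

lemma convex_below_tangent_gap:
  assumes "convex_on UNIV f" "(f has_real_derivative f') (at p)"
  shows "f p - f q - f' * (p - q) \<le> (0::real)"
  using convex_on_imp_above_tangent[OF assms(1) _ _ _ assms(2), of q] by (simp add: algebra_simps)

lemma strictly_convex_on_imp_convex_on: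
  assumes "strictly_convex_on UNIV f"
  shows "convex_on UNIV f"
proof (rule convex_onI)
  fix t x y :: real assume t: "0 < t" "t < 1"
  show "f ((1 - t) *\<^sub>R x + t *\<^sub>R y) \<le> (1 - t) * f x + t * f y"
  proof (cases "x = y")
    case True
    then show ?thesis by (simp add: algebra_simps)
  next
    case False
    then show ?thesis using assms t unfolding strictly_convex_on_def by (simp add: less_imp_le)
  qed
qed simp

text \<open>
  If the tangent at \<open>p\<close> met the graph again at \<open>q\<close>, strict convexity would put the graph below the
  tangent at the midpoint.
\<close>

lemma strictly_convex_tangent_gap:
  assumes f: "strictly_convex_on UNIV f" and d: "(f has_real_derivative f') (at p)"
    and z: "f p - f q - f' * (p - q) = (0::real)"
  shows "p = q"
proof (rule ccontr)
  assume ne: "p \<noteq> q"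
  have "f ((1 - 1/2) * p + 1/2 * q) < (1 - 1/2) * f p + 1/2 * f q"
    using f ne unfolding strictly_convex_on_def by (elim conjE allE[of _ "1/2"]) auto
  moreover have "f p - f ((1 - 1/2) * p + 1/2 * q) - f' * (p - ((1 - 1/2) * p + 1/2 * q)) \<le> 0"
    by (rule convex_below_tangent_gap[OF strictly_convex_on_imp_convex_on[OF f] d])
  ultimately show False using z by (simp add: algebra_simps)
qed

section \<open>Uniqueness for the mean field game system\<close>

context geometric_network
begin

lemma MFG_solutionD:
  assumes "MFG_solution N \<mu> \<gamma> \<eta> \<theta> H F \<sigma> u \<rho> m"
  shows "u \<in> net_Ck_holder N 2 \<sigma>"
    and "\<And>j s. j \<in> edges N \<Longrightarrow> s \<in> {0<..<len N j} \<Longrightarrow>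
        - \<mu> j * edge_deriv N 2 u j s + H (param N j s) (edge_deriv N 1 u j s) + \<rho> = F (net_measure N \<gamma> \<eta> m) (param N j s)"
    and "\<And>v. v \<in> inner_verts N \<Longrightarrow>
        (\<Sum>j\<in>incident N v. \<mu> j * \<gamma> v j * outflow (edge_deriv N 1 u) j v) = \<eta> v * (\<theta> v + F (net_measure N \<gamma> \<eta> m) v - \<rho>)"
    and "\<And>v j. v \<in> boundary_verts N \<Longrightarrow> j \<in> incident N v \<Longrightarrow> outflow (edge_deriv N 1 u) j v = 0"
    and "net_integral N (on_edge N u) = 0"
    and "FP_weak_solution N \<mu> \<gamma> \<eta> (\<lambda>j s. deriv (H (param N j s)) (edge_deriv N 1 u j s)) m"
proof -
  have o: "outflow (edge_deriv N 1 u) j v = outward_deriv N u j v" for j v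
    by (simp add: outflow_def outward_deriv_def)
  note S = assms[unfolded MFG_solution_def Let_def]
  show "u \<in> net_Ck_holder N 2 \<sigma>" "net_integral N (on_edge N u) = 0"
    "FP_weak_solution N \<mu> \<gamma> \<eta> (\<lambda>j s. deriv (H (param N j s)) (edge_deriv N 1 u j s)) m"
    using S by blast+
  show "- \<mu> j * edge_deriv N 2 u j s + H (param N j s) (edge_deriv N 1 u j s) + \<rho> = F (net_measure N \<gamma> \<eta> m) (param N j s)"
    if "j \<in> edges N" "s \<in> {0<..<len N j}" for j s
    using S that by blast
  show "(\<Sum>j\<in>incident N v. \<mu> j * \<gamma> v j * outflow (edge_deriv N 1 u) j v) = \<eta> v * (\<theta> v + F (net_measure N \<gamma> \<eta> m) v - \<rho>)"
    if "v \<in> inner_verts N" for v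
    unfolding o using S that by blast
  show "outflow (edge_deriv N 1 u) j v = 0" if "v \<in> boundary_verts N" "j \<in> incident N v" for v j
    unfolding o using S that by blast
qed

lemma zero_mean_difference_constant:
  assumes ne: "edges N \<noteq> {}"
    and c: "\<And>j. j \<in> edges N \<Longrightarrow> continuous_on {0..len N j} (on_edge N u\<^sub>1 j)"
      "\<And>j. j \<in> edges N \<Longrightarrow> continuous_on {0..len N j} (on_edge N u\<^sub>2 j)"
    and z: "net_integral N (on_edge N u\<^sub>1) = 0" "net_integral N (on_edge N u\<^sub>2) = 0"
    and X: "\<And>j s. j \<in> edges N \<Longrightarrow> s \<in> {0..len N j} \<Longrightarrow> on_edge N u\<^sub>1 j s - on_edge N u\<^sub>2 j s = X"
  shows "X = 0"
proof -
  have "(LBINT s:{0<..<len N j}. on_edge N u\<^sub>1 j s) - (LBINT s:{0<..<len N j}. on_edge N u\<^sub>2 j s) = X * len N j"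
    if j: "j \<in> edges N" for j
  proof -
    have "(LBINT s:{0<..<len N j}. on_edge N u\<^sub>1 j s) - (LBINT s:{0<..<len N j}. on_edge N u\<^sub>2 j s) =
        (LBINT s:{0<..<len N j}. on_edge N u\<^sub>1 j s - on_edge N u\<^sub>2 j s)"
      by (intro set_integral_diff(2)[symmetric] continuous_imp_L2_on c j)
    also have "\<dots> = (LBINT s:{0<..<len N j}. X)"
      using X[OF j] by (intro set_lebesgue_integral_cong) auto
    also have "\<dots> = X * len N j - X * 0"
      using len_pos[OF j] by (intro integral_derivative) (auto intro!: derivative_eq_intros)
    finally show ?thesis by simp
  qed
  then have "(\<Sum>j\<in>edges N. X * len N j) =
      (\<Sum>j\<in>edges N. (LBINT s:{0<..<len N j}. on_edge N u\<^sub>1 j s) - (LBINT s:{0<..<len N j}. on_edge N u\<^sub>2 j s))"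
    by (intro sum.cong refl) simp
  also have "\<dots> = 0" using z by (simp add: net_integral_def sum_subtractf)
  finally have "(\<Sum>j\<in>edges N. X * len N j) = 0" .
  then have "X * (\<Sum>j\<in>edges N. len N j) = 0" by (simp add: sum_distrib_left)
  moreover have "0 < (\<Sum>j\<in>edges N. len N j)" using len_pos by (intro sum_pos finite_edges ne)
  ultimately show ?thesis by simp
qed

end

theorem theorem5p2:
  fixes N :: "('d::finite, 'e) network"
    and \<mu> :: "'e \<Rightarrow> real"
    and \<gamma> :: "real ^ 'd \<Rightarrow> 'e \<Rightarrow> real"
    and \<eta> \<theta> :: "real ^ 'd \<Rightarrow> real"
    and H :: "real ^ 'd \<Rightarrow> real \<Rightarrow> real"
    and F :: "(real ^ 'd) measure \<Rightarrow> real ^ 'd \<Rightarrow> real"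
    and \<sigma> :: real
  assumes "is_network N"
    and "H1 N \<mu> \<gamma> \<eta>"
    and "H2 N H"
    and "0 < \<sigma>" and "\<sigma> < 1"
    and "\<And>M. M \<in> prob_measures N \<Longrightarrow> F M \<in> PC_holder N \<sigma>"
    and "((\<forall>x\<in>points N - verts N. convex_on UNIV (H x)) \<and>
            strictly_monotone_coupling N \<gamma> \<eta> F) \<or>
         ((\<forall>x\<in>points N - verts N. strictly_convex_on UNIV (H x)) \<and>
            monotone_coupling N \<gamma> \<eta> F)"
    and "MFG_solution N \<mu> \<gamma> \<eta> \<theta> H F \<sigma> u\<^sub>1 \<rho>\<^sub>1 m\<^sub>1"
    and "MFG_solution N \<mu> \<gamma> \<eta> \<theta> H F \<sigma> u\<^sub>2 \<rho>\<^sub>2 m\<^sub>2"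
  shows "(\<forall>x\<in>points N. u\<^sub>1 x = u\<^sub>2 x) \<and> \<rho>\<^sub>1 = \<rho>\<^sub>2 \<and> (\<forall>x\<in>points N - verts N. m\<^sub>1 x = m\<^sub>2 x)"
proof -
  interpret geometric_network N by unfold_locales (rule assms(1))
  note H1 = assms(2)
  obtain h G where
    hc: "\<And>j q. j \<in> edges N \<Longrightarrow> continuous_on {0..len N j} q \<Longrightarrow> continuous_on {0..len N j} (\<lambda>s. h j s (q s))"
    and Gc: "\<And>j q. j \<in> edges N \<Longrightarrow> continuous_on {0..len N j} q \<Longrightarrow> continuous_on {0..len N j} (\<lambda>s. G j s (q s))"
    and hH: "\<And>j s. j \<in> edges N \<Longrightarrow> s \<in> {0<..<len N j} \<Longrightarrow> h j s = H (param N j s)"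
    and GH: "\<And>j s p. j \<in> edges N \<Longrightarrow> s \<in> {0<..<len N j} \<Longrightarrow> (H (param N j s) has_real_derivative G j s p) (at p)"
    and lip: "\<And>R. \<exists>K. \<forall>j\<in>edges N. \<forall>s\<in>{0<..<len N j}. \<forall>p p'. \<bar>p\<bar> \<le> R \<longrightarrow> \<bar>p'\<bar> \<le> R \<longrightarrow>
        \<bar>H (param N j s) p - H (param N j s) p'\<bar> \<le> K * \<bar>p - p'\<bar>"
    by (rule hamiltonian_on_edges[OF assms(3)]) (assumption | rule that)+
  let ?\<mm>1 = "net_measure N \<gamma> \<eta> m\<^sub>1" and ?\<mm>2 = "net_measure N \<gamma> \<eta> m\<^sub>2"
  let ?V1 = "edge_deriv N 1 u\<^sub>1" and ?V2 = "edge_deriv N 1 u\<^sub>2"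
  let ?A1 = "edge_deriv N 2 u\<^sub>1" and ?A2 = "edge_deriv N 2 u\<^sub>2"
  note S1 = MFG_solutionD[OF assms(8)] and S2 = MFG_solutionD[OF assms(9)]
  note d1 = net_C2_derivatives[OF S1(1)] and d2 = net_C2_derivatives[OF S2(1)]
  have cU: "continuous_on {0..len N j} (on_edge N u\<^sub>1 j)" "continuous_on {0..len N j} (on_edge N u\<^sub>2 j)"
    and cV1: "continuous_on {0..len N j} (?V1 j)" and cV2: "continuous_on {0..len N j} (?V2 j)" if "j \<in> edges N" for j
    using d1(1,2)[OF that] d2(1,2)[OF that] by (meson DERIV_continuous continuous_on_eq_continuous_within)+
  define B\<^sub>1 B\<^sub>2 where "B\<^sub>1 j s = G j s (?V1 j s)" and "B\<^sub>2 j s = G j s (?V2 j s)" for j s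
  have cB1: "continuous_on {0..len N j} (B\<^sub>1 j)" and cB2: "continuous_on {0..len N j} (B\<^sub>2 j)" if "j \<in> edges N" for j
    unfolding B\<^sub>1_def B\<^sub>2_def by (intro Gc cV1 cV2 that)+
  have b1: "deriv (H (param N j s)) (?V1 j s) = B\<^sub>1 j s" and b2: "deriv (H (param N j s)) (?V2 j s) = B\<^sub>2 j s"
    if "j \<in> edges N" "s \<in> {0<..<len N j}" for j s
    unfolding B\<^sub>1_def B\<^sub>2_def by (intro DERIV_imp_deriv GH that)+
  obtain M\<^sub>1 c\<^sub>1 where FP1: "classical_FP \<mu> \<gamma> \<eta> B\<^sub>1 m\<^sub>1 M\<^sub>1 c\<^sub>1"
    by (rule FP_weak_solution_imp_classical_FP[OF H1 S1(6) cB1 b1])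
  obtain M\<^sub>2 c\<^sub>2 where FP2: "classical_FP \<mu> \<gamma> \<eta> B\<^sub>2 m\<^sub>2 M\<^sub>2 c\<^sub>2"
    by (rule FP_weak_solution_imp_classical_FP[OF H1 S2(6) cB2 b2])
  note H = H1D[OF H1] and D1 = classical_FPD[OF FP1] and D2 = classical_FPD[OF FP2]
  define r where "r = \<rho>\<^sub>1 - \<rho>\<^sub>2"
  define w v a D where "w j s = on_edge N u\<^sub>1 j s - on_edge N u\<^sub>2 j s" and "v j s = ?V1 j s - ?V2 j s"
    and "a j s = ?A1 j s - ?A2 j s" and "D j s = h j s (?V1 j s) - h j s (?V2 j s)" for j s
  define W \<phi> where "W x = u\<^sub>1 x - u\<^sub>2 x" and "\<phi> x = F ?\<mm>1 x - F ?\<mm>2 x" for x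
  have w: "(w j has_real_derivative v j s) (at s within {0..len N j})"
    and v: "(v j has_real_derivative a j s) (at s within {0..len N j})" if "j \<in> edges N" "s \<in> {0..len N j}" for j s
    unfolding w_def[abs_def] v_def[abs_def] a_def by (intro DERIV_diff d1 d2 that)+
  have ca: "continuous_on {0..len N j} (a j)" if "j \<in> edges N" for j
    unfolding a_def by (intro continuous_intros d1 d2 that)
  have cv: "continuous_on {0..len N j} (v j)" if "j \<in> edges N" for j
    unfolding v_def by (intro continuous_intros cV1 cV2 that)
  have cD: "continuous_on {0..len N j} (D j)" if "j \<in> edges N" for j
    unfolding D_def by (intro continuous_intros hc cV1 cV2 that)
  have W: "w j 0 = W (src N j)" "w j (len N j) = W (tgt N j)" if "j \<in> edges N" for j
    using param_0 param_len[OF that] by (auto simp: w_def W_def on_edge_def)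
  have eq: "D j s + r - \<mu> j * a j s = \<phi> (param N j s)" if "j \<in> edges N" "s \<in> {0<..<len N j}" for j s
    using S1(2)[OF that] S2(2)[OF that] by (simp add: D_def r_def a_def \<phi>_def hH[OF that] algebra_simps)
  have ov: "outflow v j x = outflow ?V1 j x - outflow ?V2 j x" for j x
    by (simp add: outflow_def v_def)
  have inner: "(\<Sum>j\<in>incident N x. \<mu> j * \<gamma> x j * outflow v j x) = \<eta> x * (\<phi> x - r)" if "x \<in> inner_verts N" for x
    using S1(3)[OF that] S2(3)[OF that]
    by (simp add: ov right_diff_distrib sum_subtractf) (simp add: \<phi>_def r_def algebra_simps)
  have bdry: "outflow v j x = 0" if "x \<in> boundary_verts N" "j \<in> incident N x" for x j
    using S1(4)[OF that] S2(4)[OF that] by (simp add: ov)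
  define e where "e j s = M\<^sub>1 j s * (D j s - B\<^sub>1 j s * v j s) - M\<^sub>2 j s * (D j s - B\<^sub>2 j s * v j s)" for j s
  have ext: "extends (\<lambda>j s. D j s + r - \<mu> j * a j s) \<phi>"
    unfolding extends_def on_edge_def by (intro ballI conjI continuous_intros cD ca eq[symmetric])
  \<comment> \<open>The function \<open>e\<close> is the integrand that convexity makes nonpositive.\<close>
  have pairing: "coupling_pairing F ?\<mm>1 ?\<mm>2 = (\<Sum>j\<in>edges N. LBINT s:{0<..<len N j}. e j s)"
  proof -
    have "coupling_pairing F ?\<mm>1 ?\<mm>2 = integral\<^sup>L ?\<mm>1 \<phi> - integral\<^sup>L ?\<mm>2 \<phi>"
      by (simp add: coupling_pairing_def \<phi>_def[abs_def])
    then show ?thesis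
      unfolding e_def classical_FP_net_measure(2)[OF H1 FP1 ext] classical_FP_net_measure(2)[OF H1 FP2 ext]
      by (rule trans) (rule duality_identity[OF H1 FP1 FP2 cB1 cB2 w v ca W cD inner bdry, symmetric])
  qed
  have conv: "convex_on UNIV (H x)" if "x \<in> points N - verts N" for x
    using assms(7) that strictly_convex_on_imp_convex_on by blast
  have gap: "D j s - B\<^sub>1 j s * v j s \<le> 0" "0 \<le> D j s - B\<^sub>2 j s * v j s" if "j \<in> edges N" "s \<in> {0<..<len N j}" for j s
    using convex_below_tangent_gap[OF conv[OF param_interior(2)[OF that]] GH[OF that], of "?V1 j s" "?V2 j s"]
      convex_below_tangent_gap[OF conv[OF param_interior(2)[OF that]] GH[OF that], of "?V2 j s" "?V1 j s"]
    by (simp_all add: D_def B\<^sub>1_def B\<^sub>2_def v_def hH[OF that] algebra_simps)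
  have ce: "continuous_on {0..len N j} (\<lambda>s. - e j s)" if "j \<in> edges N" for j
    unfolding e_def by (intro continuous_intros D1(8) D2(8) cD cB1 cB2 cv that)
  have e_int: "0 \<le> - e j s" if "j \<in> edges N" "s \<in> {0<..<len N j}" for j s
  proof -
    have "0 \<le> M\<^sub>1 j s" "0 \<le> M\<^sub>2 j s" using D1(3)[OF that(1), of s] D2(3)[OF that(1), of s] that by auto
    then have "M\<^sub>1 j s * (D j s - B\<^sub>1 j s * v j s) \<le> 0" "0 \<le> M\<^sub>2 j s * (D j s - B\<^sub>2 j s * v j s)"
      using gap[OF that] by (auto simp: mult_nonneg_nonpos)
    then show ?thesis by (simp add: e_def)
  qed
  have e: "0 \<le> - e j s" if "j \<in> edges N" "s \<in> {0..len N j}" for j s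
    by (rule continuous_nonneg_on_closure[OF len_pos[OF that(1)] ce[OF that(1)] e_int[OF that(1)] that(2)])
  have e_int_nonneg: "0 \<le> - (LBINT s:{0<..<len N j}. e j s)" if j: "j \<in> edges N" for j
  proof -
    have "0 \<le> (LBINT s:{0<..<len N j}. - e j s)"
      unfolding set_lebesgue_integral_def using e_int[OF j] by (intro integral_nonneg_AE AE_I2) (auto simp: indicator_def)
    then show ?thesis by (simp add: set_lebesgue_integral_def)
  qed
  have pairing_le: "coupling_pairing F ?\<mm>1 ?\<mm>2 \<le> 0"
    using sum_nonneg[of "edges N" "\<lambda>j. - (LBINT s:{0<..<len N j}. e j s)"] e_int_nonneg
    by (simp add: pairing sum_negf)
  have FPd: "m \<in> PC N \<and> (\<forall>x\<in>points N - verts N. 0 \<le> m x) \<and> compatible N \<gamma> m" if "FP_weak_solution N \<mu> \<gamma> \<eta> b m" for b m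
  proof -
    have "m \<in> V12_gamma N \<gamma>"
      using that unfolding FP_weak_solution_def by (elim conjE)
    moreover have "\<forall>x\<in>points N - verts N. 0 \<le> m x"
      using that unfolding FP_weak_solution_def by (elim conjE)
    ultimately show ?thesis by (simp add: V12_gamma_def)
  qed
  have adm: "m\<^sub>1 \<in> admissible_densities N \<gamma> \<eta>" "m\<^sub>2 \<in> admissible_densities N \<gamma> \<eta>"
    using FPd[OF S1(6)] FPd[OF S2(6)] classical_FP_net_measure(1)[OF H1 FP1] classical_FP_net_measure(1)[OF H1 FP2]
    by (simp_all add: admissible_densities_def)
  have same: "?\<mm>1 = ?\<mm>2 \<and> (\<forall>j\<in>edges N. \<forall>s\<in>{0..len N j}. M\<^sub>1 j s = M\<^sub>2 j s)"
    using assms(7)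
  proof (elim disjE conjE)
    assume "strictly_monotone_coupling N \<gamma> \<eta> F"
    then have "?\<mm>1 = ?\<mm>2" using adm pairing_le unfolding strictly_monotone_coupling_def by force
    then show ?thesis using net_measure_eq_imp_density_eq[OF H1 FP1 FP2] by blast
  next
    assume sc: "\<forall>x\<in>points N - verts N. strictly_convex_on UNIV (H x)" and "monotone_coupling N \<gamma> \<eta> F"
    then have "0 \<le> coupling_pairing F ?\<mm>1 ?\<mm>2" using adm unfolding monotone_coupling_def by blast
    then have "(\<Sum>j\<in>edges N. - (LBINT s:{0<..<len N j}. e j s)) = 0"
      using pairing_le by (simp add: pairing sum_negf)
    then have i0: "(LBINT s:{0<..<len N j}. - e j s) = 0" if "j \<in> edges N" for j
      using sum_nonneg_eq_0_iff[OF finite_edges, of "\<lambda>j. - (LBINT s:{0<..<len N j}. e j s)"] e_int_nonneg that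
      by (simp add: set_lebesgue_integral_def)
    have e0: "- e j s = 0" if "j \<in> edges N" "s \<in> {0..len N j}" for j s
      by (rule continuous_nonneg_integral_zero[OF len_pos[OF that(1)] ce[OF that(1)] e[OF that(1)] i0[OF that(1)] that(2)])
    \<comment> \<open>Already the first of the two terms of \<open>e\<close> vanishes, and \<open>M\<^sub>1 > 0\<close>.\<close>
    have v0: "v j s = 0" if j: "j \<in> edges N" and s: "s \<in> {0<..<len N j}" for j s
    proof -
      have pos: "0 < M\<^sub>1 j s" "0 < M\<^sub>2 j s"
        using classical_FP_positive[OF H1 FP1 cB1 j, of s] classical_FP_positive[OF H1 FP2 cB2 j, of s] s by auto
      have "M\<^sub>1 j s * (D j s - B\<^sub>1 j s * v j s) \<le> 0" "0 \<le> M\<^sub>2 j s * (D j s - B\<^sub>2 j s * v j s)"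
        using gap[OF j s] pos by (auto simp: mult_nonneg_nonpos)
      then have "M\<^sub>1 j s * (D j s - B\<^sub>1 j s * v j s) = 0" using e0[OF j, of s] s by (simp add: e_def)
      then have "D j s - B\<^sub>1 j s * v j s = 0" using pos by simp
      then have z: "H (param N j s) (?V1 j s) - H (param N j s) (?V2 j s) - G j s (?V1 j s) * (?V1 j s - ?V2 j s) = 0"
        unfolding D_def B\<^sub>1_def v_def hH[OF j s] .
      have "?V1 j s = ?V2 j s"
        by (rule strictly_convex_tangent_gap[OF sc[rule_format, OF param_interior(2)[OF j s]] GH[OF j s] z])
      then show ?thesis by (simp add: v_def)
    qed
    have v_zero: "v j s = 0" if j: "j \<in> edges N" and s: "s \<in> {0..len N j}" for j s
      by (rule continuous_AE_zero[OF len_pos[OF j] cv[OF j] _ s]) (use v0[OF j] in auto)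
    have BB: "B\<^sub>2 j s = B\<^sub>1 j s" if "j \<in> edges N" "s \<in> {0..len N j}" for j s
    proof -
      have "?V2 j s = ?V1 j s" using v_zero[OF that] by (simp add: v_def)
      then show ?thesis by (simp only: B\<^sub>1_def B\<^sub>2_def)
    qed
    have FP2': "classical_FP \<mu> \<gamma> \<eta> B\<^sub>1 m\<^sub>2 M\<^sub>2 c\<^sub>2"
      using FP2 BB unfolding classical_FP_def by simp
    note MM = classical_FP_unique[OF H1 FP1 FP2' cB1]
    have "?\<mm>1 = ?\<mm>2" by (rule density_eq_imp_net_measure_eq[OF H1 FP1 FP2 MM])
    then show ?thesis using MM by blast
  qed
  have ne: "edges N \<noteq> {}" by (rule edges_nonempty[OF FP1])
  have "\<exists>R. \<forall>j\<in>edges N. \<forall>s\<in>{0..len N j}. \<bar>?V1 j s\<bar> \<le> R \<and> \<bar>?V2 j s\<bar> \<le> R"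
  proof -
    have "bounded (\<Union>j\<in>edges N. ?V1 j ` {0..len N j} \<union> ?V2 j ` {0..len N j})"
      using finite_edges
      by (intro bounded_UN bounded_Un[THEN iffD2] ballI conjI compact_imp_bounded compact_continuous_image cV1 cV2 compact_Icc)
    then obtain R where "\<forall>y\<in>(\<Union>j\<in>edges N. ?V1 j ` {0..len N j} \<union> ?V2 j ` {0..len N j}). norm y \<le> R"
      unfolding bounded_iff by blast
    then show ?thesis by (intro exI[of _ R]) auto
  qed
  then obtain R where R: "\<And>j s. j \<in> edges N \<Longrightarrow> s \<in> {0..len N j} \<Longrightarrow> \<bar>?V1 j s\<bar> \<le> R \<and> \<bar>?V2 j s\<bar> \<le> R" by blast
  obtain K where K: "\<And>j s p p'. j \<in> edges N \<Longrightarrow> s \<in> {0<..<len N j} \<Longrightarrow> \<bar>p\<bar> \<le> R \<Longrightarrow> \<bar>p'\<bar> \<le> R \<Longrightarrow>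
        \<bar>H (param N j s) p - H (param N j s) p'\<bar> \<le> K * \<bar>p - p'\<bar>"
    using lip[of R] by blast
  \<comment> \<open>With equal couplings, \<open>w\<close> is a difference of two solutions of one Hamilton--Jacobi problem.\<close>
  have \<phi>0: "\<phi> x = 0" for x using same by (simp add: \<phi>_def)
  have HJ: "\<mu> j * a j s = D j s + r" and DK: "\<bar>D j s\<bar> \<le> K * \<bar>v j s\<bar>" if "j \<in> edges N" "s \<in> {0<..<len N j}" for j s
    using eq[OF that] \<phi>0 K[OF that] R[OF that(1), of s] that by (auto simp: D_def v_def hH[OF that])
  have inner0: "(\<Sum>j\<in>incident N x. \<mu> j * \<gamma> x j * outflow v j x) = - (\<eta> x * r)" if "x \<in> inner_verts N" for x
    using inner[OF that] \<phi>0 by simp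
  note HJ_unique = HJ_difference_constant[OF H1 ne w v W HJ DK inner0 bdry]
  obtain X where X: "\<And>j s. j \<in> edges N \<Longrightarrow> s \<in> {0..len N j} \<Longrightarrow> on_edge N u\<^sub>1 j s - on_edge N u\<^sub>2 j s = X"
    using HJ_unique(2) unfolding w_def by blast
  have X0: "X = 0" by (rule zero_mean_difference_constant[OF ne cU S1(5) S2(5) X])
  show ?thesis
  proof (intro conjI ballI)
    show "\<rho>\<^sub>1 = \<rho>\<^sub>2" using HJ_unique(1) by (simp add: r_def)
    fix x assume "x \<in> points N"
    then obtain j s where "j \<in> edges N" "s \<in> {0..len N j}" "x = param N j s" by (rule pointE)
    then show "u\<^sub>1 x = u\<^sub>2 x" using X[of j s] X0 by (simp add: on_edge_def)
  next
    fix x assume "x \<in> points N - verts N"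
    then obtain j s where *: "j \<in> edges N" "s \<in> {0<..<len N j}" "x = param N j s" by (rule interior_pointE)
    then have "on_edge N m\<^sub>1 j s = M\<^sub>1 j s" "on_edge N m\<^sub>2 j s = M\<^sub>2 j s"
      using D1(1) D2(1) by (auto simp: extends_def)
    then show "m\<^sub>1 x = m\<^sub>2 x" using same * by (simp add: on_edge_def)
  qed
qed

end
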